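(* Let $b^t:\Psi\to\Psi$ be a flow of piecewise diffeomorphisms on a compact manifold $\Psi$. Suppose given: (1) a fibration $q:\Psi\to Z$ with compact base $Z$ and fibers $R_z=q^{-1}(z)$ transversal to the flow; (2) a closed submanifold $M\subset\Psi$ with $\dim M=\dim Z-1$, transversal to the flow, and such that $N=\bigcup_{t\le 0}b^t(M)$ is transversal to the fibers $R_z$. Let $dz$, $dm$ be finite Lebesgue-class measures on $Z$, $M$ respectively and let $dt$ be Lebesgue measure on $\mathbb R$. Then there exists a positive function $r$ on $M\times\mathbb R_+$, determined by the data (1) and (2) (and the fixed measures), such that for every continuous non-negative weight function $w(x,t)$ on $\Psi\times\mathbb R_+$, with the weighted counting function $$g(z;w)=\sum_{(x,t)\in G(z)}w(x,t),\qquad G(z)=\{(x,t):x\in R_z,\ t\ge 0,\ b^t(x)\in M\},$$ one has $$\int_Z g(z;w)\,dz=\int_{M\times\mathbb R_+}w(b^{-t}m,t)\,r(m,t)\,dm\,dt .$$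
   Context: "Manifold" means a compact manifold, possibly with boundary, corners and singular points. $\mathbb R_+=[0,\infty)$. The maps $b^t$ are diffeomorphisms off a singular set; all expressions involving $b^{t}$, $b^{-t}$ refer to the points where these are defined and regular (pairs $(m,t)$ for which $b^{-t}m$ is not defined do not contribute to the right-hand side). A Lebesgue-class measure is one that is mutually absolutely continuous with Lebesgue (smooth) measure. *)

theory Defs
  imports "HOL-Analysis.Analysis"
begin

text \<open>
  Manifolds are subsets of a Euclidean space of arbitrary dimension, and differentiability of
  maps between such subsets means the existence of local extensions (as in Milnor or
  Guillemin--Pollack). By Whitney's embedding theorem this is no restriction for compact
  manifolds. The differentiability class is $C^1$, so that smooth data are a special case.
\<close>

definition C1_on :: "'a::euclidean_space set \<Rightarrow> ('a \<Rightarrow> 'b::euclidean_space) \<Rightarrow> bool" where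
  "C1_on S f \<longleftrightarrow>
     (\<forall>x\<in>S. \<exists>U g. \<exists>g' :: 'a \<Rightarrow> 'a \<Rightarrow>\<^sub>L 'b.
        open U \<and> x \<in> U \<and> (\<forall>y\<in>S \<inter> U. g y = f y) \<and>
        (\<forall>y\<in>U. (g has_derivative blinfun_apply (g' y)) (at y)) \<and> continuous_on U g')"

definition diffeomorphism ::
  "'a::euclidean_space set \<Rightarrow> 'b::euclidean_space set \<Rightarrow> ('a \<Rightarrow> 'b) \<Rightarrow> ('b \<Rightarrow> 'a) \<Rightarrow> bool" where
  "diffeomorphism S T f g \<longleftrightarrow> homeomorphism S T f g \<and> C1_on S f \<and> C1_on T g"

definition orthant :: "'a::euclidean_space set \<Rightarrow> 'a set" where
  "orthant B = {x \<in> span B. \<forall>b\<in>B. 0 \<le> x \<bullet> b}"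

text \<open>
  A local parametrization of \<open>X\<close>: a diffeomorphism from a relatively open subset of the
  standard orthant spanned by \<open>k\<close> of the basis vectors onto a relatively open subset of \<open>X\<close>.
  Interior points, boundary points and corners of \<open>X\<close> are all covered. Taking the parameters in
  the ambient type is harmless since a \<open>k\<close>-dimensional submanifold has \<open>k \<le> DIM('a)\<close>, and it
  includes \<open>k = 0\<close>.
\<close>

definition local_param ::
  "nat \<Rightarrow> 'a::euclidean_space set \<Rightarrow> 'a set \<Rightarrow> 'a set \<Rightarrow> ('a \<Rightarrow> 'a) \<Rightarrow> bool" where
  "local_param k X B W \<phi> \<longleftrightarrow>
     B \<subseteq> Basis \<and> card B = k \<and>
     openin (top_of_set (orthant B)) W \<and> openin (top_of_set X) (\<phi> ` W) \<and>
     (\<exists>\<psi>. diffeomorphism W (\<phi> ` W) \<phi> \<psi>)"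

definition regular_points :: "nat \<Rightarrow> 'a::euclidean_space set \<Rightarrow> 'a set" where
  "regular_points k X = {x. \<exists>B W \<phi>. local_param k X B W \<phi> \<and> x \<in> \<phi> ` W}"

text \<open>
  Sets of \<open>k\<close>-dimensional Hausdorff measure zero. No bound on the radii is needed: for \<open>k > 0\<close>
  a small sum forces small radii, and for \<open>k = 0\<close> (where \<open>0 ^ 0 = 1\<close>) only the empty set
  qualifies.
\<close>

definition hausdorff_null :: "nat \<Rightarrow> 'a::euclidean_space set \<Rightarrow> bool" where
  "hausdorff_null k S \<longleftrightarrow>
     (\<forall>e>0. \<exists>(I :: nat set) c r.
        S \<subseteq> (\<Union>i\<in>I. cball (c i) (r i)) \<and> (\<forall>i\<in>I. 0 \<le> r i) \<and>
        (\<Sum>\<^sub>\<infinity>i\<in>I. ennreal (r i ^ k)) < ennreal e)"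

text \<open>
  Compact \<open>k\<close>-dimensional manifold, possibly with boundary, corners and singular points; the
  singular points form a nowhere dense set of \<open>k\<close>-dimensional measure zero.
\<close>

definition manifold :: "nat \<Rightarrow> 'a::euclidean_space set \<Rightarrow> bool" where
  "manifold k X \<longleftrightarrow>
     compact X \<and> X \<subseteq> closure (regular_points k X) \<and> hausdorff_null k (X - regular_points k X)"

text \<open>
  \<open>pushforward f S x V\<close> is the image of \<open>V\<close> under the differential of \<open>f\<close> at \<open>x\<close>. The derivative
  within \<open>S\<close> is determined only in directions tangent to \<open>S\<close>; all uses have \<open>V\<close> tangent to \<open>S\<close>.
\<close>

definition pushforward ::
  "('a::euclidean_space \<Rightarrow> 'b::euclidean_space) \<Rightarrow> 'a set \<Rightarrow> 'a \<Rightarrow> 'a set \<Rightarrow> 'b set" where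
  "pushforward f S x V = {D v |D v. (f has_derivative D) (at x within S) \<and> v \<in> V}"

definition tangent_space :: "nat \<Rightarrow> 'a::euclidean_space set \<Rightarrow> 'a \<Rightarrow> 'a set" where
  "tangent_space k X x =
     \<Union> {pushforward \<phi> W w (span B) |B W \<phi> w. local_param k X B W \<phi> \<and> w \<in> W \<and> \<phi> w = x}"

text \<open>
  Lebesgue measure on \<open>span B\<close>, defined like \<^const>\<open>lborel\<close>; the point mass at \<open>0\<close> if \<open>B = {}\<close>.
\<close>

definition lborel_span :: "'a::euclidean_space set \<Rightarrow> 'a measure" where
  "lborel_span B = distr (\<Pi>\<^sub>M b\<in>B. (lborel :: real measure)) borel (\<lambda>f. \<Sum>b\<in>B. f b *\<^sub>R b)"

text \<open>
  A Borel measure with the null sets of Lebesgue measure in local coordinates. In particular the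
  singular points are a null set.
\<close>

definition lebesgue_class :: "nat \<Rightarrow> 'a::euclidean_space set \<Rightarrow> 'a measure \<Rightarrow> bool" where
  "lebesgue_class k X \<mu> \<longleftrightarrow>
     sets \<mu> = sets (restrict_space borel X) \<and>
     (\<forall>A\<in>sets \<mu>. emeasure \<mu> A = 0 \<longleftrightarrow>
        (\<forall>B W \<phi>. local_param k X B W \<phi> \<longrightarrow> {w\<in>W. \<phi> w \<in> A} \<in> null_sets (lborel_span B)))"

text \<open>
  \<open>\<Omega>\<close> is the set of pairs \<open>(x, t)\<close> such that \<open>b t x\<close> is defined and regular; outside \<open>\<Omega>\<close> the
  values of \<open>b\<close> are irrelevant. For each \<open>t\<close>, \<open>b t\<close> is a diffeomorphism from
  \<open>{x. (x, t) \<in> \<Omega>}\<close> onto \<open>{x. (x, -t) \<in> \<Omega>}\<close>, and the singular set (the complement) is closed of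
  measure zero.
\<close>

definition piecewise_flow ::
  "nat \<Rightarrow> 'a::euclidean_space set \<Rightarrow> ('a \<times> real) set \<Rightarrow> (real \<Rightarrow> 'a \<Rightarrow> 'a) \<Rightarrow> bool" where
  "piecewise_flow n \<Psi> \<Omega> b \<longleftrightarrow>
     openin (top_of_set (\<Psi> \<times> UNIV)) \<Omega> \<and> \<Omega> \<subseteq> regular_points n \<Psi> \<times> UNIV \<and>
     (\<forall>t. hausdorff_null n {x\<in>\<Psi>. (x, t) \<notin> \<Omega>}) \<and>
     C1_on \<Omega> (\<lambda>(x, t). b t x) \<and>
     (\<forall>x. (x, 0) \<in> \<Omega> \<longrightarrow> b 0 x = x) \<and>
     (\<forall>x t. (x, t) \<in> \<Omega> \<longrightarrow> (b t x, - t) \<in> \<Omega>) \<and>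
     (\<forall>x s t. (x, t) \<in> \<Omega> \<and> (b t x, s) \<in> \<Omega> \<longrightarrow> (x, s + t) \<in> \<Omega> \<and> b (s + t) x = b s (b t x))"

definition fiber :: "'a set \<Rightarrow> ('a \<Rightarrow> 'b) \<Rightarrow> 'b \<Rightarrow> 'a set" where
  "fiber \<Psi> q z = {x\<in>\<Psi>. q x = z}"

text \<open>
  Locally trivial fibration with base of dimension \<open>d\<close> and fibers of dimension \<open>k\<close>; the local
  trivializations are homeomorphisms, and diffeomorphisms between the regular parts.
\<close>

definition fibration ::
  "nat \<Rightarrow> nat \<Rightarrow> 'a::euclidean_space set \<Rightarrow> 'b::euclidean_space set \<Rightarrow> ('a \<Rightarrow> 'b) \<Rightarrow> bool" where
  "fibration d k \<Psi> Z q \<longleftrightarrow>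
     continuous_on \<Psi> q \<and> q ` \<Psi> = Z \<and>
     (\<forall>z\<in>Z. manifold k (fiber \<Psi> q z) \<and>
       (\<exists>U h g. openin (top_of_set Z) U \<and> z \<in> U \<and>
          homeomorphism (\<Psi> \<inter> q -` U) (U \<times> fiber \<Psi> q z) (\<lambda>x. (q x, h x)) g \<and>
          diffeomorphism (regular_points (d + k) \<Psi> \<inter> q -` U)
            ((U \<inter> regular_points d Z) \<times> regular_points k (fiber \<Psi> q z)) (\<lambda>x. (q x, h x)) g))"

text \<open>
  Transversality of a \<open>k\<close>-dimensional submanifold \<open>X\<close> to the flow: at no regular point is the flow
  direction (in particular, it is nonzero) tangent to \<open>X\<close>.
\<close>

definition transversal_to_flow ::
  "nat \<Rightarrow> 'a::euclidean_space set \<Rightarrow> ('a \<times> real) set \<Rightarrow> (real \<Rightarrow> 'a \<Rightarrow> 'a) \<Rightarrow> bool" where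
  "transversal_to_flow k X \<Omega> b \<longleftrightarrow>
     (\<forall>x\<in>regular_points k X. (x, 0) \<in> \<Omega> \<longrightarrow>
        vector_derivative (\<lambda>t. b t x) (at 0) \<notin> tangent_space k X x)"

text \<open>
  The union \<open>N\<close> of the \<open>b t ` M\<close> over \<open>t \<le> 0\<close> is the image of \<open>(m, t) \<mapsto> b t m\<close> and may intersect
  itself; \<open>sheet_tangent\<close> is the tangent space at \<open>b t m\<close> of the sheet of \<open>N\<close> through the
  parameter \<open>(m, t)\<close>. Transversality of \<open>N\<close> to the fibers is required of every sheet.
\<close>

definition sheet_tangent ::
  "nat \<Rightarrow> 'a::euclidean_space set \<Rightarrow> ('a \<times> real) set \<Rightarrow> (real \<Rightarrow> 'a \<Rightarrow> 'a) \<Rightarrow> 'a \<Rightarrow> real \<Rightarrow> 'a set"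
  where
  "sheet_tangent l M \<Omega> b m t =
     pushforward (\<lambda>(y, s). b s y) \<Omega> (m, t) (tangent_space l M m \<times> UNIV)"

definition backward_orbit_transversal ::
  "nat \<Rightarrow> nat \<Rightarrow> nat \<Rightarrow> 'a::euclidean_space set \<Rightarrow> ('a \<Rightarrow> 'b) \<Rightarrow> 'a set \<Rightarrow>
     ('a \<times> real) set \<Rightarrow> (real \<Rightarrow> 'a \<Rightarrow> 'a) \<Rightarrow> bool" where
  "backward_orbit_transversal n k l \<Psi> q M \<Omega> b \<longleftrightarrow>
     (\<forall>m\<in>regular_points l M. \<forall>t\<le>0. (m, t) \<in> \<Omega> \<longrightarrow>
        {u + v |u v. u \<in> sheet_tangent l M \<Omega> b m t \<and>
                     v \<in> tangent_space k (fiber \<Psi> q (q (b t m))) (b t m)}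
        = tangent_space n \<Psi> (b t m))"

definition hits ::
  "'a set \<Rightarrow> ('a \<Rightarrow> 'b) \<Rightarrow> 'a set \<Rightarrow> ('a \<times> real) set \<Rightarrow> (real \<Rightarrow> 'a \<Rightarrow> 'a) \<Rightarrow> 'b \<Rightarrow> ('a \<times> real) set"
  where
  "hits \<Psi> q M \<Omega> b z = {(x, t). x \<in> fiber \<Psi> q z \<and> 0 \<le> t \<and> (x, t) \<in> \<Omega> \<and> b t x \<in> M}"

definition weighted_count ::
  "'a set \<Rightarrow> ('a \<Rightarrow> 'b) \<Rightarrow> 'a set \<Rightarrow> ('a \<times> real) set \<Rightarrow> (real \<Rightarrow> 'a \<Rightarrow> 'a) \<Rightarrow>
     ('a \<times> real \<Rightarrow> real) \<Rightarrow> 'b \<Rightarrow> ennreal" where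
  "weighted_count \<Psi> q M \<Omega> b w z = (\<Sum>\<^sub>\<infinity>p\<in>hits \<Psi> q M \<Omega> b z. ennreal (w p))"

end

theory Submission
  imports Defs
begin

text \<open>
  Sending \<open>p = (m, t)\<close> to \<open>(b\<^bsup>-t\<^esup> m, t)\<close> identifies the set \<open>P\<close> of admissible pairs with the union of
  the sets \<open>G(z)\<close>, and \<open>G(z)\<close> with the fibre over \<open>z\<close> of \<open>F(m, t) = q (b\<^bsup>-t\<^esup> m)\<close>. Hence the left-hand side is
  the integral of the weight against the measure \<open>A \<mapsto> \<integral>\<^sub>Z card (A \<inter> F\<^bsup>-1\<^esup> z) dz\<close> on \<open>P\<close>, and \<open>r\<close> is its
  density with respect to \<open>dm dt\<close>. The density exists and is positive because \<open>F\<close> is locally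
  bi-Lipschitz over the regular points of \<open>M\<close>: transversality of \<open>N\<close> to the fibres makes the
  derivative of \<open>F\<close> map the tangent space of \<open>M \<times> \<real>\<close> onto that of \<open>Z\<close>, and the dimensions agree. Null
  sets of the Lebesgue-class measures are exactly the Hausdorff null sets, which Lipschitz maps preserve.
  Sigma-finiteness comes from cutting the regular part of \<open>P\<close> into countably many pieces, each
  contained in a compact set on which \<open>F\<close> is injective; the singular part is Hausdorff null, and so is its image.
\<close>

section \<open>Hausdorff null sets\<close>

text \<open>The measures \<open>dz\<close> and \<open>dm\<close> are fixed only up to mutual
  absolute continuity, so no Jacobian can give \<open>r\<close>; Radon-Nikodym can, and asks only
  that \<open>F\<close> and its local inverses preserve null sets. The obstacle is that null sets
  are defined chart by chart while \<open>F\<close> respects no charts. Hausdorff null sets are the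
  chart-free substitute: Lipschitz maps preserve them by moving the covering balls, and they agree
  with Lebesgue null sets because a \<open>k\<close>-dimensional ball of radius \<open>r\<close> has
  measure comparable to \<open>r ^ k\<close>. The second obstacle is the boundary: at corners and at
  \<open>t = 0\<close> the domain of \<open>F\<close> is not open, and a derivative within it is
  determined only along tangent directions. Tangent spaces are therefore spanned by velocities of
  one-sided curves, and local injectivity of \<open>F\<close> comes from a quantitative lower bound
  on distances instead of the inverse function theorem. Fibre sums are controlled only off the image
  of the singular points, which is a null set; this is why measurability of the weighted count
  refers to \<open>completion dz\<close>.\<close>

lemma infsum_ennreal_eq_nn_integral:
  fixes f :: "'i \<Rightarrow> ennreal"
  shows "infsum f A = (\<integral>\<^sup>+i. f i \<partial>count_space A)"
proof (rule antisym)
  have A: "infsum f A = (SUP F\<in>{F. finite F \<and> F \<subseteq> A}. sum f F)"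
    by (rule nonneg_infsum_complete) simp
  show "infsum f A \<le> (\<integral>\<^sup>+i. f i \<partial>count_space A)"
    unfolding A
  proof (rule SUP_least, clarify)
    fix F assume F: "finite F" "F \<subseteq> A"
    have "sum f F = (\<integral>\<^sup>+i. f i \<partial>count_space F)"
      using F by (simp add: nn_integral_count_space_finite)
    also have "\<dots> \<le> (\<integral>\<^sup>+i. f i \<partial>count_space A)"
      using F by (auto simp: nn_integral_count_space_indicator intro!: nn_integral_mono split: split_indicator)
    finally show "sum f F \<le> (\<integral>\<^sup>+i. f i \<partial>count_space A)" .
  qed
  show "(\<integral>\<^sup>+i. f i \<partial>count_space A) \<le> infsum f A"
    unfolding nn_integral_def_finite
  proof (rule SUP_least, clarify)
    fix g assume g: "simple_function (count_space A) g" "g \<le> f"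
    show "integral\<^sup>S (count_space A) g \<le> infsum f A"
    proof (cases "finite {a\<in>A. 0 < g a}")
      case True
      have "integral\<^sup>S (count_space A) g = (\<integral>\<^sup>+i. g i \<partial>count_space A)"
        using g by (simp add: nn_integral_eq_simple_integral)
      also have "\<dots> = (\<Sum>a|a\<in>A \<and> 0 < g a. g a)"
        using True by (rule nn_integral_count_space)
      also have "\<dots> \<le> (\<Sum>a|a\<in>A \<and> 0 < g a. f a)"
        using g(2) by (intro sum_mono) (auto simp: le_fun_def)
      also have "\<dots> \<le> infsum f A"
        unfolding A by (rule SUP_upper) (use True in auto)
      finally show ?thesis .
    next
      \<comment> \<open>\<open>g\<close> has finitely many values but infinite support, so some
        positive value \<open>y\<close> is taken infinitely often. There \<open>f\<close> is at
        least \<open>y\<close>, hence \<open>infsum f A\<close> is infinite.\<close>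
      case False
      have fin: "finite (g ` A)"
        using g(1) by (simp add: simple_function_def)
      have "\<exists>y\<in>g ` {a\<in>A. 0 < g a}. infinite {a\<in>{a\<in>A. 0 < g a}. g a = y}"
      proof (rule ccontr)
        assume "\<not> ?thesis"
        then have "finite (\<Union>y\<in>g ` {a\<in>A. 0 < g a}. {a\<in>{a\<in>A. 0 < g a}. g a = y})"
          by (intro finite_UN_I finite_subset[OF _ fin]) auto
        moreover have "(\<Union>y\<in>g ` {a\<in>A. 0 < g a}. {a\<in>{a\<in>A. 0 < g a}. g a = y}) = {a\<in>A. 0 < g a}"
          by auto
        ultimately show False using False by simp
      qed
      then obtain y a where "a \<in> A" "0 < g a" "y = g a" "infinite {a\<in>{a\<in>A. 0 < g a}. g a = y}"
        by auto
      moreover have "{a\<in>{a\<in>A. 0 < g a}. g a = y} \<subseteq> {a\<in>A. g a = y}" by auto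
      ultimately have y: "y > 0" "infinite {a\<in>A. g a = y}"
        using infinite_super by blast+
      have "\<infinity> = infsum f {a\<in>A. g a = y}"
        using y g(2) by (intro infsum_superconst_infinite_ennreal[symmetric, of _ y]) (auto simp: le_fun_def)
      also have "\<dots> \<le> infsum f A"
        by (intro infsum_mono_neutral nonneg_summable_on_complete) auto
      finally show ?thesis by (metis infinity_ennreal_def top_greatest top.extremum_uniqueI)
    qed
  qed
qed

lemma nn_integral_count_space_Sigma:
  fixes f :: "'a \<times> 'b \<Rightarrow> ennreal"
  shows "(\<integral>\<^sup>+p. f p \<partial>count_space (Sigma A B)) =
    (\<integral>\<^sup>+x. \<integral>\<^sup>+y. f (x, y) \<partial>count_space (B x) \<partial>count_space A)"
proof -
  have "(\<integral>\<^sup>+p. f p \<partial>count_space (Sigma A B)) = (\<integral>\<^sup>+p. f p * indicator (Sigma A B) p \<partial>count_space UNIV)"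
    by (rule nn_integral_count_space_indicator) simp
  also have "\<dots> = (\<integral>\<^sup>+x. (\<integral>\<^sup>+y. f (x, y) * indicator (B x) y \<partial>count_space UNIV) * indicator A x \<partial>count_space UNIV)"
    by (subst nn_integral_fst_count_space[symmetric])
      (auto intro!: nn_integral_cong split: split_indicator)
  finally show ?thesis
    by (simp add: nn_integral_count_space_indicator)
qed

lemma hausdorff_null_iff:
  "hausdorff_null k S \<longleftrightarrow>
     (\<forall>e>0. \<exists>(I :: nat set) c r.
        S \<subseteq> (\<Union>i\<in>I. cball (c i) (r i)) \<and> (\<forall>i\<in>I. 0 \<le> r i) \<and>
        (\<integral>\<^sup>+i. ennreal (r i ^ k) \<partial>count_space I) < ennreal e)"
  unfolding hausdorff_null_def infsum_ennreal_eq_nn_integral ..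

lemma hausdorff_nullE:
  assumes "hausdorff_null k S" "0 < e"
  obtains I :: "nat set" and c r where "S \<subseteq> (\<Union>i\<in>I. cball (c i) (r i))" "\<And>i. i \<in> I \<Longrightarrow> 0 \<le> r i"
    "(\<integral>\<^sup>+i. ennreal (r i ^ k) \<partial>count_space I) < ennreal e"
  using assms(1)[unfolded hausdorff_null_iff, rule_format, OF assms(2)] by (elim exE conjE) (rule that, auto)

text \<open>Covers arise indexed by pairs or by their own centres, while the definition wants
  indices in \<open>nat\<close>. A countable index set can be renumbered by \<open>to_nat_on\<close>
  without changing the sum.\<close>

lemma hausdorff_nullI:
  fixes S :: "'a::euclidean_space set"
  assumes "\<And>e. 0 < e \<Longrightarrow> \<exists>(I :: 'i set) c r. countable I \<and>
        S \<subseteq> (\<Union>i\<in>I. cball (c i) (r i)) \<and> (\<forall>i\<in>I. 0 \<le> r i) \<and>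
        (\<integral>\<^sup>+i. ennreal (r i ^ k) \<partial>count_space I) < ennreal e"
  shows "hausdorff_null k S"
  unfolding hausdorff_null_iff
proof (intro allI impI)
  fix e :: real assume "0 < e"
  from assms[OF this] obtain I :: "'i set" and c :: "'i \<Rightarrow> 'a" and r where I: "countable I"
    "S \<subseteq> (\<Union>i\<in>I. cball (c i) (r i))" "\<forall>i\<in>I. 0 \<le> r i"
    "(\<integral>\<^sup>+i. ennreal (r i ^ k) \<partial>count_space I) < ennreal e" by auto
  let ?h = "from_nat_into I" and ?J = "to_nat_on I ` I"
  have b: "bij_betw ?h ?J I"
    using I(1) by (intro bij_betw_byWitness[where f'="to_nat_on I"]) auto
  have "(\<integral>\<^sup>+j. ennreal (r (?h j) ^ k) \<partial>count_space ?J) = (\<integral>\<^sup>+i. ennreal (r i ^ k) \<partial>count_space I)"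
    by (rule nn_integral_bij_count_space[OF b])
  moreover have "S \<subseteq> (\<Union>j\<in>?J. cball (c (?h j)) (r (?h j)))"
    using I(1,2) by force
  moreover have "\<forall>j\<in>?J. 0 \<le> r (?h j)"
    using I(1,3) by auto
  ultimately show "\<exists>(J :: nat set) c r. S \<subseteq> (\<Union>i\<in>J. cball (c i) (r i)) \<and> (\<forall>i\<in>J. 0 \<le> r i) \<and>
        (\<integral>\<^sup>+i. ennreal (r i ^ k) \<partial>count_space J) < ennreal e"
    using I(4)
    by (intro exI[of _ ?J] exI[of _ "\<lambda>j. c (?h j)"] exI[of _ "\<lambda>j. r (?h j)"]) auto
qed

lemma hausdorff_null_subset: "hausdorff_null k T \<Longrightarrow> S \<subseteq> T \<Longrightarrow> hausdorff_null k S"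
  unfolding hausdorff_null_def by (meson order_trans)

lemma hausdorff_null_empty [simp]: "hausdorff_null k {}"
  unfolding hausdorff_null_def by (intro allI impI exI[of _ "{}"]) auto

text \<open>A ball contributes \<open>r ^ 0 = 1\<close> whatever its radius, so a sum below
  \<open>1\<close> leaves room for no ball at all.\<close>

lemma hausdorff_null_0:
  assumes "hausdorff_null 0 S" shows "S = {}"
proof -
  from assms obtain I :: "nat set" and c r where I: "S \<subseteq> (\<Union>i\<in>I. cball (c i) (r i))"
    "(\<integral>\<^sup>+i. ennreal (r i ^ 0) \<partial>count_space I) < ennreal 1"
    unfolding hausdorff_null_iff by (metis zero_less_one)
  have "I = {}"
  proof (rule ccontr)
    assume "I \<noteq> {}"
    then obtain i where "i \<in> I" by auto
    then have "ennreal (r i ^ 0) \<le> (\<integral>\<^sup>+i. ennreal (r i ^ 0) \<partial>count_space I)"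
      by (rule nn_integral_ge_point)
    with I(2) show False by simp
  qed
  with I show ?thesis by auto
qed

lemma hausdorff_null_UN_nat:
  fixes S :: "nat \<Rightarrow> 'a::euclidean_space set"
  assumes "\<And>n. hausdorff_null k (S n)"
  shows "hausdorff_null k (\<Union>n. S n)"
proof (rule hausdorff_nullI[where 'i = "nat \<times> nat"])
  fix e :: real assume e: "0 < e"
  \<comment> \<open>The shares add up to \<open>e / 2\<close> instead of \<open>e\<close>, because
    summing infinitely many strict bounds is only used to give \<open>\<le>\<close>.\<close>
  have ex: "\<forall>n. \<exists>(I :: nat set) c r. S n \<subseteq> (\<Union>i\<in>I. cball (c i) (r i)) \<and> (\<forall>i\<in>I. 0 \<le> r i) \<and>
        (\<integral>\<^sup>+i. ennreal (r i ^ k) \<partial>count_space I) < ennreal (e / 2 * (1/2)^Suc n)"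
    using assms[unfolded hausdorff_null_iff] e by simp
  obtain I :: "nat \<Rightarrow> nat set" where "\<forall>n. \<exists>c r. S n \<subseteq> (\<Union>i\<in>I n. cball (c i) (r i)) \<and> (\<forall>i\<in>I n. 0 \<le> r i) \<and>
        (\<integral>\<^sup>+i. ennreal (r i ^ k) \<partial>count_space (I n)) < ennreal (e / 2 * (1/2)^Suc n)"
    using choice[OF ex] by (elim exE)
  from choice[OF this] obtain c where "\<forall>n. \<exists>r. S n \<subseteq> (\<Union>i\<in>I n. cball (c n i) (r i)) \<and> (\<forall>i\<in>I n. 0 \<le> r i) \<and>
        (\<integral>\<^sup>+i. ennreal (r i ^ k) \<partial>count_space (I n)) < ennreal (e / 2 * (1/2)^Suc n)" by (elim exE)
  from choice[OF this] obtain r where r: "\<forall>n. S n \<subseteq> (\<Union>i\<in>I n. cball (c n i) (r n i)) \<and> (\<forall>i\<in>I n. 0 \<le> r n i) \<and>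
        (\<integral>\<^sup>+i. ennreal (r n i ^ k) \<partial>count_space (I n)) < ennreal (e / 2 * (1/2)^Suc n)" by (elim exE)
  have I: "\<And>n. S n \<subseteq> (\<Union>i\<in>I n. cball (c n i) (r n i))" "\<And>n i. i \<in> I n \<Longrightarrow> 0 \<le> r n i"
      "\<And>n. (\<integral>\<^sup>+i. ennreal (r n i ^ k) \<partial>count_space (I n)) < ennreal (e / 2 * (1/2)^Suc n)"
    using r by blast+
  let ?J = "Sigma UNIV I"
  have "(\<integral>\<^sup>+p. ennreal (r (fst p) (snd p) ^ k) \<partial>count_space ?J)
    = (\<integral>\<^sup>+n. \<integral>\<^sup>+i. ennreal (r n i ^ k) \<partial>count_space (I n) \<partial>count_space UNIV)"
    by (simp add: nn_integral_count_space_Sigma)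
  also have "\<dots> \<le> (\<integral>\<^sup>+n. ennreal (e / 2 * (1/2)^Suc n) \<partial>count_space UNIV)"
    using I(3) by (intro nn_integral_mono less_imp_le)
  also have "\<dots> = (\<Sum>n. ennreal (e / 2 * (1/2)^Suc n))"
    by (rule nn_integral_count_space_nat)
  also have "\<dots> = ennreal (e / 2)"
  proof -
    have "(\<lambda>n. e / 2 * (1/2)^Suc n) sums (e / 2 * 1)"
      by (intro sums_mult power_half_series)
    then show ?thesis using e
      by (intro suminf_ennreal_eq) auto
  qed
  also have "\<dots> < ennreal e" using e by (simp add: ennreal_less_iff)
  finally have "(\<integral>\<^sup>+p. ennreal (r (fst p) (snd p) ^ k) \<partial>count_space ?J) < ennreal e" .
  moreover have "(\<Union>n. S n) \<subseteq> (\<Union>p\<in>?J. cball (c (fst p) (snd p)) (r (fst p) (snd p)))"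
  proof clarify
    fix n x assume "x \<in> S n"
    with I(1)[of n] obtain i where "i \<in> I n" "x \<in> cball (c n i) (r n i)" by blast
    then show "x \<in> (\<Union>p\<in>?J. cball (c (fst p) (snd p)) (r (fst p) (snd p)))"
      by (intro UN_I[of "(n, i)"]) auto
  qed
  moreover have "\<forall>p\<in>?J. 0 \<le> r (fst p) (snd p)" using I(2) by auto
  moreover have "countable ?J" by simp
  ultimately show "\<exists>(J :: (nat \<times> nat) set) c r. countable J \<and>
        (\<Union>n. S n) \<subseteq> (\<Union>i\<in>J. cball (c i) (r i)) \<and> (\<forall>i\<in>J. 0 \<le> r i) \<and>
        (\<integral>\<^sup>+i. ennreal (r i ^ k) \<partial>count_space J) < ennreal e"
    by (intro exI conjI)
qed

lemma hausdorff_null_UN: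
  assumes "countable I" "\<And>i. i \<in> I \<Longrightarrow> hausdorff_null k (S i)"
  shows "hausdorff_null k (\<Union>i\<in>I. S i)"
proof (cases "I = {}")
  case False
  have "hausdorff_null k (\<Union>n. S (from_nat_into I n))"
    using assms(2) False by (intro hausdorff_null_UN_nat) (simp add: from_nat_into)
  moreover have "(\<Union>i\<in>I. S i) = (\<Union>n. S (from_nat_into I n))"
    by (metis False UN_extend_simps(10) assms(1) range_from_nat_into)
  ultimately show ?thesis by simp
qed simp

lemma hausdorff_null_Un:
  assumes "hausdorff_null k S" "hausdorff_null k T"
  shows "hausdorff_null k (S \<union> T)"
proof -
  have "hausdorff_null k (\<Union>X\<in>{S, T}. X)"
    by (rule hausdorff_null_UN) (use assms in auto)
  then show ?thesis by simp
qed

text \<open>The centres of a cover may lie outside \<open>S\<close>, where \<open>f\<close> is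
  uncontrolled. Each ball that meets \<open>S\<close> is recentred at a point \<open>p i\<close> of
  \<open>S\<close>, which doubles its radius; hence the factor \<open>(2 * L) ^ k\<close>.\<close>

lemma hausdorff_null_lipschitz_image:
  assumes f: "L-lipschitz_on S f" and S: "hausdorff_null k S"
  shows "hausdorff_null k (f ` S)"
proof (rule hausdorff_nullI[where 'i = nat])
  fix e :: real assume e: "0 < e"
  have L: "0 \<le> L" using f by (rule lipschitz_on_nonneg)
  let ?C = "(2 * L) ^ k"
  have C: "0 \<le> ?C" using L by simp
  \<comment> \<open>Dividing by \<open>?C + 1\<close> is safe even if \<open>L = 0\<close>, and it
    makes the final bound strict.\<close>
  have pos: "0 < e / (?C + 1)" using e C by (intro divide_pos_pos) auto
  obtain I :: "nat set" and c r where I: "S \<subseteq> (\<Union>i\<in>I. cball (c i) (r i))"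
    "\<And>i. i \<in> I \<Longrightarrow> 0 \<le> r i" "(\<integral>\<^sup>+i. ennreal (r i ^ k) \<partial>count_space I) < ennreal (e / (?C + 1))"
    by (rule hausdorff_nullE[OF S pos]) (rule that)
  define J where "J = {i\<in>I. S \<inter> cball (c i) (r i) \<noteq> {}}"
  have "\<forall>i\<in>J. \<exists>p. p \<in> S \<inter> cball (c i) (r i)" unfolding J_def by auto
  then obtain p where p: "\<And>i. i \<in> J \<Longrightarrow> p i \<in> S \<inter> cball (c i) (r i)" by metis
  have "f ` S \<subseteq> (\<Union>i\<in>J. cball (f (p i)) (2 * L * r i))"
  proof clarify
    fix x assume x: "x \<in> S"
    with I(1) obtain i where i: "i \<in> I" "x \<in> cball (c i) (r i)" by auto
    with x have iJ: "i \<in> J" by (auto simp: J_def)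
    have "dist (p i) x \<le> dist (p i) (c i) + dist (c i) x" by (rule dist_triangle)
    also have "\<dots> \<le> 2 * r i" using p[OF iJ] i by (simp add: dist_commute)
    finally have d: "dist (p i) x \<le> 2 * r i" .
    have "dist (f (p i)) (f x) \<le> L * dist (p i) x"
      using f p[OF iJ] x by (auto simp: lipschitz_on_def)
    also have "\<dots> \<le> L * (2 * r i)" using d L by (rule mult_left_mono)
    finally show "f x \<in> (\<Union>i\<in>J. cball (f (p i)) (2 * L * r i))"
      using iJ by (auto simp: mult_ac)
  qed
  moreover have "(\<integral>\<^sup>+i. ennreal ((2 * L * r i) ^ k) \<partial>count_space J) < ennreal e"
  proof -
    have "(\<integral>\<^sup>+i. ennreal ((2 * L * r i) ^ k) \<partial>count_space J)
       = (\<integral>\<^sup>+i. ennreal ?C * ennreal (r i ^ k) \<partial>count_space J)"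
      using C I(2) by (intro nn_integral_cong) (auto simp: J_def ennreal_mult' power_mult_distrib)
    also have "\<dots> \<le> (\<integral>\<^sup>+i. ennreal ?C * ennreal (r i ^ k) \<partial>count_space I)"
      by (auto simp: nn_integral_count_space_indicator J_def intro!: nn_integral_mono split: split_indicator)
    also have "\<dots> = ennreal ?C * (\<integral>\<^sup>+i. ennreal (r i ^ k) \<partial>count_space I)"
      by (rule nn_integral_cmult) simp
    also have "\<dots> \<le> ennreal ?C * ennreal (e / (?C + 1))"
      using I(3) by (intro mult_left_mono) auto
    also have "\<dots> = ennreal (?C * (e / (?C + 1)))"
      using C e by (intro ennreal_mult[symmetric]) auto
    also have "\<dots> < ennreal e"
      using e C by (intro ennreal_lessI) (simp_all add: field_simps)
    finally show ?thesis .
  qed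
  moreover have "\<forall>i\<in>J. 0 \<le> 2 * L * r i" using I(2) L by (auto simp: J_def)
  ultimately show "\<exists>(I::nat set) c r. countable I \<and>
        f ` S \<subseteq> (\<Union>i\<in>I. cball (c i) (r i)) \<and> (\<forall>i\<in>I. 0 \<le> r i) \<and>
        (\<integral>\<^sup>+i. ennreal (r i ^ k) \<partial>count_space I) < ennreal e"
    by (intro exI[of _ J] exI[of _ "\<lambda>i. f (p i)"] exI[of _ "\<lambda>i. 2 * L * r i"]) auto
qed

section \<open>Locally Lipschitz images and products with the line\<close>

definition locally_lipschitz_on :: "'a::metric_space set \<Rightarrow> ('a \<Rightarrow> 'b::metric_space) \<Rightarrow> bool" where
  "locally_lipschitz_on S f \<longleftrightarrow> (\<forall>x\<in>S. \<exists>U L. open U \<and> x \<in> U \<and> L-lipschitz_on (S \<inter> U) f)"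

text \<open>The Lipschitz constants are only local. By Lindelof's theorem countably many
  neighbourhoods suffice, and countable unions of null sets are null.\<close>

lemma hausdorff_null_locally_lipschitz_image:
  assumes f: "locally_lipschitz_on S f" and T: "hausdorff_null k T" "T \<subseteq> S"
  shows "hausdorff_null k (f ` T)"
proof -
  from f obtain U L where U: "\<And>x. x \<in> S \<Longrightarrow> open (U x) \<and> x \<in> U x \<and> (L x)-lipschitz_on (S \<inter> U x) f"
    unfolding locally_lipschitz_on_def by metis
  obtain \<F> where F: "\<F> \<subseteq> U ` S" "countable \<F>" "\<Union>\<F> = \<Union>(U ` S)"
    by (rule Lindelof[of "U ` S"]) (use U in auto)
  have "f ` T \<subseteq> (\<Union>V\<in>\<F>. f ` (T \<inter> V))"
  proof clarify
    fix x assume "x \<in> T"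
    then have "x \<in> \<Union>\<F>" using U T(2) F(3) by auto
    with \<open>x \<in> T\<close> show "f x \<in> (\<Union>V\<in>\<F>. f ` (T \<inter> V))" by auto
  qed
  moreover have "hausdorff_null k (\<Union>V\<in>\<F>. f ` (T \<inter> V))"
  proof (rule hausdorff_null_UN[OF F(2)])
    fix V assume "V \<in> \<F>"
    then obtain x where "x \<in> S" "V = U x" using F(1) by auto
    then have "(L x)-lipschitz_on (T \<inter> V) f"
      using U T(2) by (meson Int_mono lipschitz_on_subset order_refl)
    then show "hausdorff_null k (f ` (T \<inter> V))"
      by (rule hausdorff_null_lipschitz_image) (use T(1) in \<open>rule hausdorff_null_subset, auto\<close>)
  qed
  ultimately show ?thesis by (rule hausdorff_null_subset[rotated])
qed

text \<open>Over a ball of radius \<open>s \<le> 1\<close> the cylinder of height \<open>1\<close>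
  is covered by about \<open>1 / s\<close> balls of radius \<open>2 * s\<close>. Up to a constant
  they cost \<open>(1 / s) * s ^ Suc k = s ^ k\<close>, the cost of the original ball.\<close>

lemma hausdorff_null_Times_unit:
  fixes S :: "'a::euclidean_space set" and a :: real
  assumes S: "hausdorff_null k S"
  shows "hausdorff_null (Suc k) (S \<times> {a..a+1})"
proof (cases "k = 0")
  case True
  then show ?thesis using hausdorff_null_0[of S] S by simp
next
  case False
  \<comment> \<open>The \<open>3\<close> bounds \<open>(N i + 1) * s i\<close>, and
    \<open>2 ^ Suc k\<close> comes from the doubled radii in the product.\<close>
  let ?C = "3 * 2 ^ Suc k :: real"
  show ?thesis
  proof (rule hausdorff_nullI[where 'i = "nat \<times> nat"])
    fix e :: real assume e: "0 < e"
    \<comment> \<open>The bound \<open>e' \<le> 1\<close> forces every \<open>s i \<le> 1\<close>,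
      which is what keeps \<open>(N i + 1) * s i\<close> below \<open>3\<close>.\<close>
    define e' where "e' = min 1 (e / (2 * ?C))"
    have e': "0 < e'" "e' \<le> 1" "?C * e' < e"
    proof -
      show "0 < e'" "e' \<le> 1" using e by (auto simp: e'_def)
      have "?C * e' \<le> ?C * (e / (2 * ?C))" by (intro mult_left_mono) (auto simp: e'_def)
      also have "\<dots> < e" using e by simp
      finally show "?C * e' < e" .
    qed
    have pos: "0 < e' / 2" using e' by simp
    obtain I :: "nat set" and c :: "nat \<Rightarrow> 'a" and r where I: "S \<subseteq> (\<Union>i\<in>I. cball (c i) (r i))"
      "\<And>i. i \<in> I \<Longrightarrow> 0 \<le> r i" "(\<integral>\<^sup>+i. ennreal (r i ^ k) \<partial>count_space I) < ennreal (e' / 2)"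
      by (rule hausdorff_nullE[OF S pos]) (rule that)
    define \<delta> where "\<delta> i = e' / 2 * (1/2) ^ Suc i" for i :: nat
    have \<delta>: "0 < \<delta> i" for i using e' by (simp add: \<delta>_def)
    \<comment> \<open>A ball of radius \<open>0\<close> would need infinitely many pieces, so all
      radii are made positive. Enlarging the \<open>k\<close>-th power by the summable
      \<open>\<delta> i\<close>, and not the radius itself, keeps the total small.\<close>
    define s where "s i = root k (r i ^ k + \<delta> i)" for i
    have s: "r i \<le> s i" "0 < s i" "s i ^ k = r i ^ k + \<delta> i" if "i \<in> I" for i
    proof -
      have pos: "0 < r i ^ k + \<delta> i" using I(2)[OF that] \<delta>[of i] by (simp add: add_nonneg_pos)
      then show "0 < s i" using False by (simp add: s_def)
      show eq: "s i ^ k = r i ^ k + \<delta> i" using pos False by (simp add: s_def)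
      then have "r i ^ k \<le> s i ^ k" using \<delta>[of i] by simp
      then show "r i \<le> s i" using \<open>0 < s i\<close> False
        by (meson less_imp_le not_less power_strict_mono I(2)[OF that] zero_less_iff_neq_zero)
    qed
    have sum_s: "(\<integral>\<^sup>+i. ennreal (s i ^ k) \<partial>count_space I) \<le> ennreal e'"
    proof -
      have "(\<integral>\<^sup>+i. ennreal (s i ^ k) \<partial>count_space I)
        = (\<integral>\<^sup>+i. ennreal (r i ^ k) + ennreal (\<delta> i) \<partial>count_space I)"
        using s(3) I(2) \<delta> by (intro nn_integral_cong) (auto simp: less_imp_le)
      also have "\<dots> = (\<integral>\<^sup>+i. ennreal (r i ^ k) \<partial>count_space I) + (\<integral>\<^sup>+i. ennreal (\<delta> i) \<partial>count_space I)"
        by (rule nn_integral_add) auto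
      also have "\<dots> \<le> ennreal (e' / 2) + ennreal (e' / 2)"
      proof (rule add_mono)
        have "(\<integral>\<^sup>+i. ennreal (\<delta> i) \<partial>count_space I) \<le> (\<integral>\<^sup>+i. ennreal (\<delta> i) \<partial>count_space UNIV)"
          by (auto simp: nn_integral_count_space_indicator intro!: nn_integral_mono split: split_indicator)
        also have "\<dots> = (\<Sum>n. ennreal (\<delta> n))"
          by (rule nn_integral_count_space_nat)
        also have "\<dots> = ennreal (e' / 2)"
        proof -
          have "\<delta> sums (e' / 2 * 1)"
            unfolding \<delta>_def by (intro sums_mult power_half_series)
          then show ?thesis using \<delta>
            by (intro suminf_ennreal_eq) (auto simp: less_imp_le)
        qed
        finally show "(\<integral>\<^sup>+i. ennreal (\<delta> i) \<partial>count_space I) \<le> ennreal (e' / 2)" .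
      qed (use I(3) in simp)
      also have "\<dots> = ennreal e'" using e' by (simp flip: ennreal_plus)
      finally show ?thesis .
    qed
    have s1: "s i \<le> 1" if "i \<in> I" for i
    proof (rule ccontr)
      assume "\<not> s i \<le> 1"
      then have "1 < s i ^ k" using False by (simp add: one_less_power)
      moreover have "ennreal (s i ^ k) \<le> ennreal e'"
        using nn_integral_ge_point[OF that, of "\<lambda>i. ennreal (s i ^ k)"] sum_s by simp
      ultimately show False using e' by simp
    qed
    define N where "N i = nat \<lceil>1 / s i\<rceil>" for i
    have N: "(N i + 1) * s i \<le> 3" if "i \<in> I" for i
    proof -
      have "real (N i) \<le> 1 / s i + 1"
        using s(2)[OF that] unfolding N_def by (simp add: of_nat_nat)
      then have "real (N i + 1) * s i \<le> (1 / s i + 2) * s i"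
        using s(2)[OF that] by (intro mult_right_mono) auto
      also have "\<dots> = 1 + 2 * s i" using s(2)[OF that] by (simp add: field_simps)
      finally show ?thesis using s1[OF that] by simp
    qed
    let ?J = "Sigma I (\<lambda>i. {..N i})"
    let ?c = "\<lambda>p. (c (fst p), a + snd p * s (fst p))" and ?r = "\<lambda>p::nat\<times>nat. 2 * s (fst p)"
    have "S \<times> {a..a+1} \<subseteq> (\<Union>p\<in>?J. cball (?c p) (?r p))"
    proof clarify
      fix x t assume x: "x \<in> S" and t: "t \<in> {a..a+1}"
      from x I(1) obtain i where i: "i \<in> I" "x \<in> cball (c i) (r i)" by auto
      define j where "j = nat \<lfloor>(t - a) / s i\<rfloor>"
      have nn: "0 \<le> (t - a) / s i" using t s(2)[OF i(1)] by auto
      then have j: "real j \<le> (t - a) / s i" "(t - a) / s i < real j + 1"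
        by (auto simp: j_def of_nat_nat)
      have "(t - a) / s i \<le> 1 / s i" using t s(2)[OF i(1)] by (auto simp: divide_right_mono)
      then have "j \<le> N i" unfolding j_def N_def
        by (intro nat_mono) linarith
      have "\<bar>a + j * s i - t\<bar> \<le> s i"
        using j s(2)[OF i(1)] by (auto simp: field_simps abs_le_iff)
      then have "dist (c i, a + j * s i) (x, t) \<le> s i + s i"
        using i(2) s(1)[OF i(1)] unfolding dist_Pair_Pair
        by (intro order_trans[OF sqrt_sum_squares_le_sum]) (auto simp: dist_real_def)
      then show "(x, t) \<in> (\<Union>p\<in>?J. cball (?c p) (?r p))"
        using i(1) \<open>j \<le> N i\<close> by (intro UN_I[of "(i, j)"]) auto
    qed
    moreover have "(\<integral>\<^sup>+p. ennreal (?r p ^ Suc k) \<partial>count_space ?J) < ennreal e"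
    proof -
      have "(\<integral>\<^sup>+p. ennreal (?r p ^ Suc k) \<partial>count_space ?J)
        = (\<integral>\<^sup>+i. (\<integral>\<^sup>+j. ennreal ((2 * s i) ^ Suc k) \<partial>count_space {..N i}) \<partial>count_space I)"
        by (subst nn_integral_count_space_Sigma) simp
      also have "\<dots> \<le> (\<integral>\<^sup>+i. ennreal ?C * ennreal (s i ^ k) \<partial>count_space I)"
      proof (rule nn_integral_mono)
        fix i assume "i \<in> space (count_space I)"
        then have i: "i \<in> I" by simp
        have "(\<integral>\<^sup>+j. ennreal ((2 * s i) ^ Suc k) \<partial>count_space {..N i})
          = of_nat (N i + 1) * ennreal ((2 * s i) ^ Suc k)"
          by (simp add: nn_integral_count_space_finite mult.commute)
        also have "\<dots> = ennreal ((N i + 1) * (2 * s i) ^ Suc k)"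
          using s(2)[OF i] by (subst ennreal_mult) (auto simp: ennreal_of_nat_eq_real_of_nat)
        also have "(N i + 1) * (2 * s i) ^ Suc k = ((N i + 1) * s i) * (2 ^ Suc k * s i ^ k)"
          by (simp add: power_mult_distrib)
        also have "ennreal \<dots> \<le> ennreal (3 * (2 ^ Suc k * s i ^ k))"
          using N[OF i] s(2)[OF i] by (intro ennreal_leI mult_right_mono) auto
        also have "\<dots> = ennreal ?C * ennreal (s i ^ k)"
          using s(2)[OF i] by (subst ennreal_mult[symmetric]) (auto simp: mult_ac)
        finally show "(\<integral>\<^sup>+j. ennreal ((2 * s i) ^ Suc k) \<partial>count_space {..N i}) \<le> ennreal ?C * ennreal (s i ^ k)" .
      qed
      also have "\<dots> = ennreal ?C * (\<integral>\<^sup>+i. ennreal (s i ^ k) \<partial>count_space I)"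
        by (rule nn_integral_cmult) simp
      also have "\<dots> \<le> ennreal ?C * ennreal e'"
        using sum_s by (rule mult_left_mono) simp
      also have "\<dots> = ennreal (?C * e')" using e' by (subst ennreal_mult) auto
      also have "\<dots> < ennreal e" using e' e by (intro ennreal_lessI) auto
      finally show ?thesis .
    qed
    moreover have "countable ?J" "\<forall>p\<in>?J. 0 \<le> ?r p" using s(2) by (auto simp: less_imp_le)
    ultimately show "\<exists>(J :: (nat \<times> nat) set) c r. countable J \<and>
        S \<times> {a..a+1} \<subseteq> (\<Union>i\<in>J. cball (c i) (r i)) \<and> (\<forall>i\<in>J. 0 \<le> r i) \<and>
        (\<integral>\<^sup>+i. ennreal (r i ^ Suc k) \<partial>count_space J) < ennreal e"
      by (intro exI conjI)
  qed
qed

lemma hausdorff_null_Times_real: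
  fixes S :: "'a::euclidean_space set" and T :: "real set"
  assumes S: "hausdorff_null k S"
  shows "hausdorff_null (Suc k) (S \<times> T)"
proof (rule hausdorff_null_subset)
  show "hausdorff_null (Suc k) (\<Union>n::int. S \<times> {real_of_int n..real_of_int n + 1})"
    by (intro hausdorff_null_UN hausdorff_null_Times_unit S) auto
  show "S \<times> T \<subseteq> (\<Union>n::int. S \<times> {real_of_int n..real_of_int n + 1})"
  proof clarify
    fix x t assume "x \<in> S"
    moreover have "t \<in> {real_of_int \<lfloor>t\<rfloor>..real_of_int \<lfloor>t\<rfloor> + 1}" by simp
    ultimately show "(x, t) \<in> (\<Union>n::int. S \<times> {real_of_int n..real_of_int n + 1})" by blast
  qed
qed

section \<open>Hausdorff null sets and Ahlfors regular measures\<close>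

text \<open>The upper mass bound turns the sum of the \<open>r ^ k\<close> over any cover into a
  bound for the measure of \<open>S\<close>.\<close>

lemma hausdorff_null_imp_null_sets:
  fixes \<mu> :: "'a::euclidean_space measure"
  assumes sets: "sets \<mu> = sets borel"
    and upper: "\<And>x r. 0 \<le> r \<Longrightarrow> emeasure \<mu> (cball x r) \<le> ennreal (C * r ^ k)"
    and S: "S \<in> sets borel" "hausdorff_null k S"
  shows "S \<in> null_sets \<mu>"
proof -
  define D where "D = max C 1"
  have D: "0 < D" by (simp add: D_def)
  have up: "emeasure \<mu> (cball x r) \<le> ennreal D * ennreal (r ^ k)" if "0 \<le> r" for x r
  proof -
    have "C * r ^ k \<le> D * r ^ k" using that by (intro mult_right_mono) (auto simp: D_def)
    then have "ennreal (C * r ^ k) \<le> ennreal D * ennreal (r ^ k)"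
      using D that by (subst ennreal_mult[symmetric]) (auto intro: ennreal_leI)
    with upper[OF that] show ?thesis by (rule order_trans)
  qed
  have "emeasure \<mu> S \<le> 0"
  proof (rule ennreal_le_epsilon)
    fix e :: real assume e: "0 < e"
    then have pos: "0 < e / D" using D by simp
    obtain I :: "nat set" and c :: "nat \<Rightarrow> 'a" and r where I: "S \<subseteq> (\<Union>i\<in>I. cball (c i) (r i))"
      "\<And>i. i \<in> I \<Longrightarrow> 0 \<le> r i" "(\<integral>\<^sup>+i. ennreal (r i ^ k) \<partial>count_space I) < ennreal (e / D)"
      by (rule hausdorff_nullE[OF S(2) pos]) (rule that)
    define F where "F i = (if i \<in> I then cball (c i) (r i) else {})" for i
    have "emeasure \<mu> S \<le> emeasure \<mu> (\<Union>i. F i)"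
      using I(1) by (intro emeasure_mono) (auto simp: F_def sets)
    also have "\<dots> \<le> (\<Sum>i. emeasure \<mu> (F i))"
      by (intro emeasure_subadditive_countably) (auto simp: F_def sets)
    also have "\<dots> = (\<integral>\<^sup>+i. emeasure \<mu> (F i) \<partial>count_space UNIV)"
      by (rule nn_integral_count_space_nat[symmetric])
    also have "\<dots> \<le> (\<integral>\<^sup>+i. ennreal D * ennreal (r i ^ k) \<partial>count_space I)"
      using I(2) up by (auto simp: nn_integral_count_space_indicator F_def intro!: nn_integral_mono)
    also have "\<dots> = ennreal D * (\<integral>\<^sup>+i. ennreal (r i ^ k) \<partial>count_space I)"
      by (rule nn_integral_cmult) simp
    also have "\<dots> \<le> ennreal D * ennreal (e / D)"
      using I(3) by (intro mult_left_mono) auto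
    also have "\<dots> = ennreal e" using D e by (subst ennreal_mult[symmetric]) auto
    finally show "emeasure \<mu> S \<le> 0 + ennreal e" by simp
  qed
  then show ?thesis using S(1) sets by (intro null_setsI) auto
qed

text \<open>
  A small open neighbourhood of the null set contains balls around its points; by the Vitali
  covering lemma disjoint ones among them cover it after enlargement by the factor \<open>5\<close>, and the
  lower bound turns the sum of the \<open>r ^ k\<close> into a sum of measures of disjoint sets.
\<close>

lemma null_sets_imp_hausdorff_null_bounded:
  fixes \<mu> :: "'a::euclidean_space measure"
  assumes sets: "sets \<mu> = sets borel"
    and fin: "\<And>x r. 0 \<le> r \<Longrightarrow> emeasure \<mu> (cball x r) < \<infinity>"
    and c: "0 < c" and lower: "\<And>x r. x \<in> L \<Longrightarrow> 0 < r \<Longrightarrow> ennreal (c * r ^ k) \<le> emeasure \<mu> (cball x r)"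
    and S: "S \<in> null_sets \<mu>" "S \<subseteq> L" "S \<subseteq> ball 0 (real n)"
  shows "hausdorff_null k S"
proof (rule hausdorff_nullI)
  fix e :: real assume e: "0 < e"
  let ?B = "ball (0::'a) (real n)"
  \<comment> \<open>\<open>outer_regular\<close> needs a finite measure. Restricting
    \<open>\<mu>\<close> to a ball makes it finite and changes nothing on \<open>S\<close>.\<close>
  define \<nu> where "\<nu> = density \<mu> (indicator ?B)"
  have Sb: "S \<in> sets borel" using S(1) sets by auto
  have \<nu>: "emeasure \<nu> A = emeasure \<mu> (A \<inter> ?B)" if "A \<in> sets borel" for A
    using that sets by (simp add: \<nu>_def emeasure_restricted Int_commute)
  have sets_\<nu>: "sets \<nu> = sets borel" by (simp add: \<nu>_def sets)
  have "emeasure \<nu> (space \<nu>) \<le> emeasure \<mu> (cball 0 (real n))"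
    using sets_eq_imp_space_eq[OF sets_\<nu>] by (simp add: \<nu> sets emeasure_mono ball_subset_cball)
  then have fin_\<nu>: "emeasure \<nu> (space \<nu>) \<noteq> \<infinity>" using fin[of "real n" 0] by (auto simp: top_unique)
  have "emeasure \<nu> S = 0"
    using \<nu>[OF Sb] S by (auto simp: Int_absorb2)
  then have inf: "(INF U\<in>{U. S \<subseteq> U \<and> open U}. emeasure \<nu> U) = 0"
    using outer_regular[OF sets_\<nu> fin_\<nu> Sb] by simp
  \<comment> \<open>The divisor \<open>5 ^ k\<close> pays for the Vitali enlargement, the factor
    \<open>c\<close> for the lower mass bound, and the \<open>2\<close> leaves room for a strict
    inequality.\<close>
  have "0 < ennreal (c * e / (2 * 5 ^ k))" using c e by simp
  with inf have "(INF U\<in>{U. S \<subseteq> U \<and> open U}. emeasure \<nu> U) < ennreal (c * e / (2 * 5 ^ k))" by simp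
  then obtain U where U: "S \<subseteq> U" "open U" "emeasure \<nu> U < ennreal (c * e / (2 * 5 ^ k))"
    unfolding INF_less_iff by blast
  define V where "V = U \<inter> ?B"
  have V: "S \<subseteq> V" "open V" "emeasure \<mu> V < ennreal (c * e / (2 * 5 ^ k))"
  proof -
    show "S \<subseteq> V" "open V" unfolding V_def using U(1,2) S(3) by (simp_all add: open_Int)
    have "emeasure \<mu> V = emeasure \<nu> U" unfolding V_def using \<nu>[of U] U(2) by simp
    with U(3) show "emeasure \<mu> V < ennreal (c * e / (2 * 5 ^ k))" by simp
  qed
  \<comment> \<open>The Vitali covering lemma wants uniformly bounded radii, hence the bound
    \<open>1\<close>.\<close>
  have "\<exists>r. 0 < r \<and> r \<le> 1 \<and> cball x r \<subseteq> V" if "x \<in> S" for x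
  proof -
    have "x \<in> V" using V(1) that by auto
    then obtain r where "0 < r" "cball x r \<subseteq> V"
      using open_contains_cball_eq[OF V(2)] by auto
    then show ?thesis
      by (intro exI[of _ "min r 1"]) (auto simp: subset_iff)
  qed
  then obtain r where r: "\<And>x. x \<in> S \<Longrightarrow> 0 < r x \<and> r x \<le> 1 \<and> cball x (r x) \<subseteq> V" by metis
  obtain C where C: "countable C" "C \<subseteq> S"
     "pairwise (\<lambda>i j. disjnt (cball i (r i)) (cball j (r j))) C"
     "S \<subseteq> (\<Union>i\<in>C. cball i (5 * r i))"
    by (rule Vitali_covering_lemma_cballs[of S "\<lambda>x. x" r S 1]) (use r in \<open>auto simp: less_imp_le\<close>)
  have "(\<integral>\<^sup>+x. ennreal (r x ^ k) \<partial>count_space C) * ennreal c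
      = (\<integral>\<^sup>+x. ennreal (r x ^ k) * ennreal c \<partial>count_space C)"
    by (rule nn_integral_multc[symmetric]) simp
  also have "\<dots> \<le> (\<integral>\<^sup>+x. emeasure \<mu> (cball x (r x)) \<partial>count_space C)"
  proof (rule nn_integral_mono)
    fix x assume "x \<in> space (count_space C)"
    then have "x \<in> S" using C by auto
    then have "ennreal (c * r x ^ k) \<le> emeasure \<mu> (cball x (r x))"
      using lower[of x "r x"] r[of x] S(2) by auto
    then show "ennreal (r x ^ k) * ennreal c \<le> emeasure \<mu> (cball x (r x))"
      using r[OF \<open>x \<in> S\<close>] c by (subst ennreal_mult[symmetric]) (auto simp: mult_ac)
  qed
  also have "\<dots> = emeasure \<mu> (\<Union>x\<in>C. cball x (r x))"
    using C(1,3) by (intro emeasure_UN_countable[symmetric])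
      (auto simp: sets disjoint_family_on_def pairwise_def disjnt_def)
  also have "\<dots> \<le> emeasure \<mu> V"
    using r C(2) V by (intro emeasure_mono) (auto simp: sets)
  also have "\<dots> < ennreal (c * e / (2 * 5 ^ k))" by (rule V(3))
  finally have less: "(\<integral>\<^sup>+x. ennreal (r x ^ k) \<partial>count_space C) * ennreal c < ennreal (c * e / (2 * 5 ^ k))" .
  have "(\<integral>\<^sup>+x. ennreal ((5 * r x) ^ k) \<partial>count_space C)
    = (\<integral>\<^sup>+x. ennreal (r x ^ k) * ennreal (5 ^ k) \<partial>count_space C)"
    using C(2) r by (intro nn_integral_cong, subst ennreal_mult[symmetric])
      (auto simp: power_mult_distrib mult_ac less_imp_le)
  also have "\<dots> = (\<integral>\<^sup>+x. ennreal (r x ^ k) \<partial>count_space C) * ennreal (5 ^ k)"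
    by (rule nn_integral_multc) simp
  also have "\<dots> = ((\<integral>\<^sup>+x. ennreal (r x ^ k) \<partial>count_space C) * ennreal c) * ennreal (5 ^ k / c)"
    using c by (simp add: mult.assoc flip: ennreal_mult)
  also have "\<dots> \<le> ennreal (c * e / (2 * 5 ^ k)) * ennreal (5 ^ k / c)"
    using less by (intro mult_right_mono) auto
  also have "\<dots> = ennreal (e / 2)"
    using c e by (subst ennreal_mult[symmetric]) (auto simp: field_simps)
  also have "\<dots> < ennreal e" using e by (simp add: ennreal_less_iff)
  finally show "\<exists>(I :: 'a set) c r. countable I \<and> S \<subseteq> (\<Union>i\<in>I. cball (c i) (r i)) \<and> (\<forall>i\<in>I. 0 \<le> r i) \<and>
        (\<integral>\<^sup>+i. ennreal (r i ^ k) \<partial>count_space I) < ennreal e"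
    using C r by (intro exI[of _ C] exI[of _ "\<lambda>x. x"] exI[of _ "\<lambda>x. 5 * r x"] conjI) (auto simp: subset_iff less_imp_le)
qed

text \<open>The set \<open>L\<close> records where the lower mass bound holds: for Lebesgue measure
  on a proper subspace, a small ball centred off the subspace has mass zero. Intersecting with
  countably many balls reduces to bounded sets.\<close>

lemma null_sets_imp_hausdorff_null:
  fixes \<mu> :: "'a::euclidean_space measure"
  assumes sets: "sets \<mu> = sets borel"
    and upper: "\<And>x r. 0 \<le> r \<Longrightarrow> emeasure \<mu> (cball x r) \<le> ennreal (C * r ^ k)"
    and c: "0 < c" and lower: "\<And>x r. x \<in> L \<Longrightarrow> 0 < r \<Longrightarrow> ennreal (c * r ^ k) \<le> emeasure \<mu> (cball x r)"
    and S: "S \<in> null_sets \<mu>" "S \<subseteq> L"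
  shows "hausdorff_null k S"
proof (rule hausdorff_null_subset)
  have "hausdorff_null k (S \<inter> ball 0 (real n))" for n
  proof (rule null_sets_imp_hausdorff_null_bounded[OF sets _ c lower])
    show "emeasure \<mu> (cball x r) < \<infinity>" if "0 \<le> r" for x r
      using upper[OF that, of x] by (rule order.strict_trans1) simp
    show "S \<inter> ball 0 (real n) \<in> null_sets \<mu>"
      using S sets by (intro null_set_Int2) auto
  qed (use S in auto)
  then show "hausdorff_null k (\<Union>n. S \<inter> ball 0 (real n))" by (rule hausdorff_null_UN_nat)
  show "S \<subseteq> (\<Union>n. S \<inter> ball 0 (real n))"
    using reals_Archimedean2 by auto
qed

section \<open>Ball estimates for Lebesgue measure on coordinate subspaces\<close>

lemma sets_lborel_span [simp, measurable_cong]: "sets (lborel_span B) = sets borel"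
  by (simp add: lborel_span_def)

lemma space_lborel_span [simp]: "space (lborel_span B) = UNIV"
  by (simp add: lborel_span_def)

lemma emeasure_lborel_span:
  fixes B :: "'a::euclidean_space set"
  assumes B: "B \<subseteq> Basis" and A: "A \<in> sets borel"
  shows "emeasure (lborel_span B) A =
    emeasure (\<Pi>\<^sub>M b\<in>B. (lborel :: real measure)) {f\<in>extensional B. (\<Sum>b\<in>B. f b *\<^sub>R b) \<in> A}"
proof -
  have "(\<lambda>f. \<Sum>b\<in>B. f b *\<^sub>R b) \<in> borel_measurable (\<Pi>\<^sub>M b\<in>B. (lborel :: real measure))"
    by (intro borel_measurable_sum borel_measurable_scaleR) auto
  then show ?thesis using A
    by (auto simp: lborel_span_def emeasure_distr space_PiM PiE_def Int_def vimage_def intro!: arg_cong2[where f=emeasure])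
qed

lemma emeasure_PiM_lborel_cube:
  fixes B :: "'i set"
  assumes "finite B" "0 \<le> s"
  shows "emeasure (\<Pi>\<^sub>M b\<in>B. (lborel :: real measure)) (Pi\<^sub>E B (\<lambda>b. {a b - s..a b + s})) = ennreal ((2 * s) ^ card B)"
proof -
  interpret product_sigma_finite "\<lambda>_::'i. lborel :: real measure" by standard
  have "emeasure (\<Pi>\<^sub>M b\<in>B. (lborel :: real measure)) (Pi\<^sub>E B (\<lambda>b. {a b - s..a b + s}))
    = (\<Prod>b\<in>B. emeasure lborel {a b - s..a b + s})"
    using assms by (intro emeasure_PiM) auto
  also have "\<dots> = (\<Prod>b\<in>B. ennreal (2 * s))"
    using assms by (intro prod.cong) auto
  also have "\<dots> = ennreal ((2 * s) ^ card B)"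
    using assms by (simp add: ennreal_power)
  finally show ?thesis .
qed

lemma inner_sum_Basis_subset:
  fixes B :: "'a::euclidean_space set"
  assumes "B \<subseteq> Basis" "b \<in> B"
  shows "(\<Sum>c\<in>B. f c *\<^sub>R c) \<bullet> b = f b"
proof -
  have "finite B" using assms(1) finite_Basis finite_subset by blast
  have "(\<Sum>c\<in>B. f c *\<^sub>R c) \<bullet> b = (\<Sum>c\<in>B. if c = b then f c else 0)"
    unfolding inner_sum_left using assms
    by (intro sum.cong) (auto simp: inner_not_same_Basis subset_iff)
  also have "\<dots> = f b" using \<open>finite B\<close> assms(2) by simp
  finally show ?thesis .
qed

lemma span_Basis_subset_eq_sum:
  fixes B :: "'a::euclidean_space set"
  assumes "B \<subseteq> Basis" "x \<in> span B"
  shows "(\<Sum>b\<in>B. (x \<bullet> b) *\<^sub>R b) = x"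
proof -
  have "finite B" using assms(1) finite_Basis finite_subset by blast
  then obtain f where x: "x = (\<Sum>b\<in>B. f b *\<^sub>R b)"
    using assms(2) span_finite[of B] by auto
  show ?thesis
    by (subst x, subst sum.cong[OF refl]) (auto simp: x inner_sum_Basis_subset[OF assms(1)])
qed

text \<open>The coordinates in \<open>B\<close> of a point of the ball lie in the cube of half-side
  \<open>r\<close> around those of \<open>x\<close>. This works for every centre, also off
  \<open>span B\<close>.\<close>

lemma emeasure_lborel_span_cball_le:
  fixes B :: "'a::euclidean_space set"
  assumes B: "B \<subseteq> Basis" and r: "0 \<le> r"
  shows "emeasure (lborel_span B) (cball x r) \<le> ennreal (2 ^ card B * r ^ card B)"
proof -
  have fin: "finite B" using B finite_Basis finite_subset by blast
  have "emeasure (lborel_span B) (cball x r) \<le>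
    emeasure (\<Pi>\<^sub>M b\<in>B. (lborel :: real measure)) (Pi\<^sub>E B (\<lambda>b. {x \<bullet> b - r..x \<bullet> b + r}))"
    unfolding emeasure_lborel_span[OF B borel_closed[OF closed_cball]]
  proof (rule emeasure_mono)
    show "{f \<in> extensional B. (\<Sum>b\<in>B. f b *\<^sub>R b) \<in> cball x r} \<subseteq> (\<Pi>\<^sub>E b\<in>B. {x \<bullet> b - r..x \<bullet> b + r})"
    proof (clarsimp simp: PiE_def)
      fix f b assume f: "dist x (\<Sum>b\<in>B. f b *\<^sub>R b) \<le> r" and b: "b \<in> B"
      have "\<bar>(x - (\<Sum>b\<in>B. f b *\<^sub>R b)) \<bullet> b\<bar> \<le> norm (x - (\<Sum>b\<in>B. f b *\<^sub>R b))"
        using B b by (intro Basis_le_norm) auto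
      then have "\<bar>x \<bullet> b - f b\<bar> \<le> r"
        using f inner_sum_Basis_subset[OF B b, of f] by (simp add: dist_norm inner_diff_left)
      then show "x \<bullet> b - r \<le> f b \<and> f b \<le> x \<bullet> b + r" by (simp add: abs_le_iff)
    qed
    show "(\<Pi>\<^sub>E b\<in>B. {x \<bullet> b - r..x \<bullet> b + r}) \<in> sets (\<Pi>\<^sub>M b\<in>B. (lborel :: real measure))"
      using fin by (intro sets_PiM_I_finite) auto
  qed
  also have "\<dots> = ennreal (2 ^ card B * r ^ card B)"
    using fin r by (simp add: emeasure_PiM_lborel_cube power_mult_distrib)
  finally show ?thesis .
qed

text \<open>By the triangle inequality over the \<open>card B\<close> coordinates, the cube of
  half-side \<open>r / (card B + 1)\<close> fits into the ball; the \<open>+ 1\<close> covers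
  \<open>B = {}\<close>. The centre has to lie in \<open>span B\<close>, since otherwise it is not
  the sum of its coordinates in \<open>B\<close>.\<close>

lemma emeasure_lborel_span_cball_ge:
  fixes B :: "'a::euclidean_space set"
  assumes B: "B \<subseteq> Basis" and x: "x \<in> span B" and r: "0 < r"
  shows "ennreal ((2 / (card B + 1)) ^ card B * r ^ card B) \<le> emeasure (lborel_span B) (cball x r)"
proof -
  have fin: "finite B" using B finite_Basis finite_subset by blast
  let ?s = "r / (card B + 1)"
  have s: "0 < ?s" using r by simp
  have "ennreal ((2 / (card B + 1)) ^ card B * r ^ card B) = ennreal ((2 * ?s) ^ card B)"
    by (simp add: power_mult_distrib power_divide)
  also have "\<dots> = emeasure (\<Pi>\<^sub>M b\<in>B. (lborel :: real measure)) (Pi\<^sub>E B (\<lambda>b. {x \<bullet> b - ?s..x \<bullet> b + ?s}))"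
    using fin s by (intro emeasure_PiM_lborel_cube[symmetric]) auto
  also have "\<dots> \<le> emeasure (lborel_span B) (cball x r)"
    unfolding emeasure_lborel_span[OF B borel_closed[OF closed_cball]]
  proof (rule emeasure_mono)
    show "(\<Pi>\<^sub>E b\<in>B. {x \<bullet> b - ?s..x \<bullet> b + ?s}) \<subseteq> {f \<in> extensional B. (\<Sum>b\<in>B. f b *\<^sub>R b) \<in> cball x r}"
    proof (intro subsetI CollectI conjI)
      fix f assume f: "f \<in> (\<Pi>\<^sub>E b\<in>B. {x \<bullet> b - ?s..x \<bullet> b + ?s})"
      then show "f \<in> extensional B" by (simp add: PiE_def)
      have "norm (x - (\<Sum>b\<in>B. f b *\<^sub>R b)) = norm (\<Sum>b\<in>B. (x \<bullet> b - f b) *\<^sub>R b)"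
        by (subst span_Basis_subset_eq_sum[OF B x, symmetric]) (simp add: sum_subtractf scaleR_diff_left)
      also have "\<dots> \<le> (\<Sum>b\<in>B. norm ((x \<bullet> b - f b) *\<^sub>R b))" by (rule norm_sum)
      also have "\<dots> \<le> (\<Sum>b\<in>B. ?s)"
      proof (rule sum_mono)
        fix b assume b: "b \<in> B"
        then have "f b \<in> {x \<bullet> b - ?s..x \<bullet> b + ?s}" using f by auto
        then have "\<bar>x \<bullet> b - f b\<bar> \<le> ?s" by (simp add: abs_le_iff)
        then show "norm ((x \<bullet> b - f b) *\<^sub>R b) \<le> ?s" using B b by (simp add: subset_iff)
      qed
      also have "\<dots> \<le> r" using r by (simp add: field_simps)
      finally show "(\<Sum>b\<in>B. f b *\<^sub>R b) \<in> cball x r" by (simp add: dist_norm)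
    qed
    have [measurable]: "(\<lambda>f. \<Sum>b\<in>B. f b *\<^sub>R b) \<in> borel_measurable (\<Pi>\<^sub>M b\<in>B. (lborel :: real measure))"
      by (intro borel_measurable_sum borel_measurable_scaleR) auto
    have "(\<lambda>f. \<Sum>b\<in>B. f b *\<^sub>R b) -` cball x r \<inter> space (\<Pi>\<^sub>M b\<in>B. (lborel :: real measure)) \<in> sets (\<Pi>\<^sub>M b\<in>B. (lborel :: real measure))"
      by (rule measurable_sets[OF _ borel_closed[OF closed_cball]]) measurable
    then show "{f \<in> extensional B. (\<Sum>b\<in>B. f b *\<^sub>R b) \<in> cball x r} \<in> sets (\<Pi>\<^sub>M b\<in>B. (lborel :: real measure))"
      by (simp add: space_PiM PiE_def vimage_def Int_def conj_commute)
  qed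
  finally show ?thesis .
qed

lemma sigma_finite_lborel_span:
  fixes B :: "'a::euclidean_space set"
  assumes B: "B \<subseteq> Basis"
  shows "sigma_finite_measure (lborel_span B)"
proof
  let ?A = "range (\<lambda>n. cball (0::'a) (real n))"
  have "\<exists>n. x \<in> cball (0::'a) (real n)" for x
    using real_arch_simple[of "norm x"] by simp
  moreover have "emeasure (lborel_span B) (cball 0 (real n)) \<noteq> \<infinity>" for n
    using emeasure_lborel_span_cball_le[OF B, of "real n" 0] by (auto simp: top_unique)
  ultimately show "\<exists>A. countable A \<and> A \<subseteq> sets (lborel_span B) \<and> \<Union> A = space (lborel_span B) \<and>
      (\<forall>a\<in>A. emeasure (lborel_span B) a \<noteq> \<infinity>)"
    by (intro exI[of _ ?A]) auto
qed

text \<open>The two ball estimates make \<open>lborel_span B\<close> Ahlfors regular of dimension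
  \<open>k\<close>, so the two comparison lemmas apply. This is the passage from Lebesgue null sets
  in a parameter domain to the chart-free notion.\<close>

lemma hausdorff_null_iff_null_lborel_span:
  fixes B :: "'a::euclidean_space set"
  assumes B: "B \<subseteq> Basis" "card B = k" and S: "S \<in> sets borel" "S \<subseteq> span B"
  shows "hausdorff_null k S \<longleftrightarrow> S \<in> null_sets (lborel_span B)"
proof
  assume "hausdorff_null k S"
  then show "S \<in> null_sets (lborel_span B)"
    using emeasure_lborel_span_cball_le[OF B(1)] B(2) S
    by (intro hausdorff_null_imp_null_sets[where k=k and C="2^k"]) auto
next
  assume "S \<in> null_sets (lborel_span B)"
  then show "hausdorff_null k S"
    using emeasure_lborel_span_cball_le[OF B(1)] emeasure_lborel_span_cball_ge[OF B(1)] B(2) S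
    by (intro null_sets_imp_hausdorff_null[where \<mu>="lborel_span B" and L="span B" and C="2^k" and c="(2 / (k + 1)) ^ k"]) auto
qed

text \<open>The Euclidean ball of radius \<open>r\<close> in the product lies between the products
  of balls of radius \<open>r / 2\<close> and \<open>r\<close>, so the product measure is Ahlfors
  regular of dimension \<open>Suc k\<close>.\<close>

lemma hausdorff_null_iff_null_lborel_span_pair:
  fixes B :: "'a::euclidean_space set" and S :: "('a \<times> real) set"
  assumes B: "B \<subseteq> Basis" "card B = k" and S: "S \<in> sets borel" "S \<subseteq> span B \<times> UNIV"
  shows "hausdorff_null (Suc k) S \<longleftrightarrow> S \<in> null_sets (lborel_span B \<Otimes>\<^sub>M lborel)"
proof -
  let ?\<mu> = "lborel_span B \<Otimes>\<^sub>M (lborel :: real measure)"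
  interpret sigma_finite_measure "lborel_span B" by (rule sigma_finite_lborel_span[OF B(1)])
  have sets: "sets ?\<mu> = sets borel"
    by (simp add: borel_prod[symmetric] cong: sets_pair_measure_cong)
  have times: "emeasure ?\<mu> (cball x r \<times> cball t r) = emeasure (lborel_span B) (cball x r) * ennreal (2 * r)"
    if "0 \<le> r" for x r and t :: real
    using that by (simp add: lborel.emeasure_pair_measure_Times cball_eq_atLeastAtMost)
  have upper: "emeasure ?\<mu> (cball p r) \<le> ennreal (2 ^ Suc k * r ^ Suc k)" if r: "0 \<le> r" for p r
  proof -
    obtain x t where p: "p = (x, t)" by (cases p)
    have "cball p r \<subseteq> cball x r \<times> cball t r"
    proof
      fix q assume "q \<in> cball p r"
      then have "dist (fst p) (fst q) \<le> r" "dist (snd p) (snd q) \<le> r"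
        using dist_fst_le[of p q] dist_snd_le[of p q] by simp_all
      then show "q \<in> cball x r \<times> cball t r" by (cases q) (simp add: p)
    qed
    then have "emeasure ?\<mu> (cball p r) \<le> emeasure ?\<mu> (cball x r \<times> cball t r)"
      by (intro emeasure_mono) auto
    also have "\<dots> \<le> ennreal (2 ^ k * r ^ k) * ennreal (2 * r)"
      unfolding times[OF r] using emeasure_lborel_span_cball_le[OF B(1) r] B(2) by (intro mult_right_mono) auto
    also have "\<dots> = ennreal (2 ^ Suc k * r ^ Suc k)"
      using r by (subst ennreal_mult[symmetric]) (auto simp: mult_ac)
    finally show ?thesis .
  qed
  \<comment> \<open>The lower ball estimate is taken at radius \<open>r / 2\<close>, which yields
    the factor \<open>(1 / 2) ^ k\<close>; the interval of radius \<open>r / 2\<close> has length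
    exactly \<open>r\<close>.\<close>
  let ?c = "(2 / (k + 1)) ^ k * (1 / 2) ^ k"
  have lower: "ennreal (?c * r ^ Suc k) \<le> emeasure ?\<mu> (cball p r)" if p: "p \<in> span B \<times> UNIV" and r: "0 < r" for p r
  proof -
    obtain x t where p': "p = (x, t)" "x \<in> span B" using p by (cases p) auto
    have "ennreal (?c * r ^ Suc k) = ennreal ((2 / (k + 1)) ^ k * (r / 2) ^ k) * ennreal (2 * (r / 2))"
      using r by (subst ennreal_mult[symmetric]) (auto simp: power_divide mult_ac)
    also have "\<dots> \<le> emeasure ?\<mu> (cball x (r / 2) \<times> cball t (r / 2))"
      using emeasure_lborel_span_cball_ge[OF B(1) p'(2), of "r / 2"] r B(2)
      by (subst times) (auto intro!: mult_right_mono)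
    also have "\<dots> \<le> emeasure ?\<mu> (cball p r)"
    proof (intro emeasure_mono subsetI)
      fix q assume q: "q \<in> cball x (r / 2) \<times> cball t (r / 2)"
      have "dist p q \<le> dist x (fst q) + dist t (snd q)"
        unfolding p' by (cases q) (auto simp: dist_Pair_Pair intro: sqrt_sum_squares_le_sum)
      also have "\<dots> \<le> r" using q by auto
      finally show "q \<in> cball p r" by simp
    qed (metis borel_closed closed_cball sets)
    finally show ?thesis .
  qed
  show ?thesis
  proof
    assume "hausdorff_null (Suc k) S"
    then show "S \<in> null_sets ?\<mu>"
      using upper S(1) by (intro hausdorff_null_imp_null_sets[OF sets]) auto
  next
    assume "S \<in> null_sets ?\<mu>"
    then show "hausdorff_null (Suc k) S"
      using upper lower S(2)
      by (intro null_sets_imp_hausdorff_null[OF sets, where L="span B \<times> UNIV" and C="2^Suc k" and c="?c"]) auto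
  qed
qed

section \<open>Local Lipschitz continuity of differentiable maps\<close>

lemma locally_lipschitz_on_imp_continuous_on:
  assumes "locally_lipschitz_on S f"
  shows "continuous_on S f"
  unfolding continuous_on_eq_continuous_within
proof
  fix x assume x: "x \<in> S"
  from bspec[OF assms[unfolded locally_lipschitz_on_def] x]
  obtain U L where U: "open U" "x \<in> U" "L-lipschitz_on (S \<inter> U) f" by (elim exE conjE)
  have "continuous_on (S \<inter> U) f" using U(3) by (rule lipschitz_on_continuous_on)
  then have "continuous (at x within S \<inter> U) f"
    using x U(2) by (simp add: continuous_on_eq_continuous_within)
  moreover have "at x within S \<inter> U = at x within S"
    by (rule at_within_nhd[OF U(2,1)]) auto
  ultimately show "continuous (at x within S) f" by simp
qed

text \<open>The mean value inequality needs a convex domain, which \<open>S\<close> does not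
  provide; it is applied to the local extension \<open>g\<close> on a ball where the derivative
  stays within distance \<open>1\<close> of its value at \<open>x\<close>.\<close>

lemma C1_on_imp_locally_lipschitz_on:
  fixes f :: "'a::euclidean_space \<Rightarrow> 'b::euclidean_space"
  assumes "C1_on S f"
  shows "locally_lipschitz_on S f"
  unfolding locally_lipschitz_on_def
proof
  fix x assume "x \<in> S"
  from bspec[OF assms[unfolded C1_on_def] this] obtain U g and g' :: "'a \<Rightarrow> 'a \<Rightarrow>\<^sub>L 'b"
    where "open U \<and> x \<in> U \<and> (\<forall>y\<in>S \<inter> U. g y = f y) \<and>
        (\<forall>y\<in>U. (g has_derivative blinfun_apply (g' y)) (at y)) \<and> continuous_on U g'"
    by (elim exE)
  then have U: "open U" "x \<in> U" "\<And>y. y \<in> S \<inter> U \<Longrightarrow> g y = f y"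
    "\<And>y. y \<in> U \<Longrightarrow> (g has_derivative blinfun_apply (g' y)) (at y)" "continuous_on U g'"
    by simp_all
  have "isCont g' x" using U(1,2,5) by (simp add: continuous_on_eq_continuous_at)
  then obtain e where e: "0 < e" "\<And>y. dist y x < e \<Longrightarrow> dist (g' y) (g' x) < 1"
    unfolding continuous_at_eps_delta by (metis zero_less_one)
  obtain e' where e': "0 < e'" "ball x e' \<subseteq> U" using U(1,2) open_contains_ball by blast
  let ?V = "ball x (min e e')" and ?L = "norm (g' x) + 1"
  have "?L-lipschitz_on (S \<inter> ?V) f"
  proof (rule lipschitz_onI)
    fix a b assume ab: "a \<in> S \<inter> ?V" "b \<in> S \<inter> ?V"
    have "norm (g a - g b) \<le> ?L * norm (a - b)"
    proof (rule differentiable_bound)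
      show "convex ?V" by simp
      show "(g has_derivative blinfun_apply (g' y)) (at y within ?V)" if "y \<in> ?V" for y
        by (rule has_derivative_at_withinI, rule U(4)) (use that e'(2) in auto)
      show "onorm (blinfun_apply (g' y)) \<le> ?L" if "y \<in> ?V" for y
      proof -
        have "norm (g' y) \<le> norm (g' x) + dist (g' y) (g' x)"
          by (simp add: dist_norm norm_triangle_sub)
        with e(2)[of y] that show ?thesis by (simp add: norm_blinfun.rep_eq[symmetric] dist_commute)
      qed
    qed (use ab in auto)
    then show "dist (f a) (f b) \<le> ?L * dist a b"
      using ab U(3) e'(2) by (auto simp: dist_norm subset_iff)
  qed simp
  then show "\<exists>U L. open U \<and> x \<in> U \<and> L-lipschitz_on (S \<inter> U) f"
    using e(1) e'(1) by (intro exI[of _ ?V] exI[of _ ?L]) auto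
qed

lemma locally_lipschitz_on_Times_real:
  fixes S :: "'a::metric_space set"
  assumes "locally_lipschitz_on S f"
  shows "locally_lipschitz_on (S \<times> (UNIV :: real set)) (\<lambda>p. (f (fst p), snd p))"
  unfolding locally_lipschitz_on_def
proof
  fix p :: "'a \<times> real" assume p: "p \<in> S \<times> UNIV"
  with assms obtain U L where U: "open U" "fst p \<in> U" "L-lipschitz_on (S \<inter> U) f"
    unfolding locally_lipschitz_on_def by (metis mem_Times_iff)
  have "(L + 1)-lipschitz_on (S \<times> (UNIV :: real set) \<inter> U \<times> UNIV) (\<lambda>p. (f (fst p), snd p))"
  proof (rule lipschitz_onI)
    show "0 \<le> L + 1" using lipschitz_on_nonneg[OF U(3)] by simp
    fix a b :: "'a \<times> real" assume ab: "a \<in> S \<times> UNIV \<inter> U \<times> UNIV" "b \<in> S \<times> UNIV \<inter> U \<times> UNIV"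
    have "dist (f (fst a), snd a) (f (fst b), snd b) \<le> dist (f (fst a)) (f (fst b)) + dist (snd a) (snd b)"
      unfolding dist_Pair_Pair by (rule sqrt_sum_squares_le_sum) auto
    also have "\<dots> \<le> L * dist (fst a) (fst b) + dist a b"
      using U(3) ab by (intro add_mono dist_snd_le) (auto simp: lipschitz_on_def mem_Times_iff)
    also have "\<dots> \<le> L * dist a b + dist a b"
      using lipschitz_on_nonneg[OF U(3)] by (intro add_right_mono mult_left_mono dist_fst_le)
    finally show "dist (f (fst a), snd a) (f (fst b), snd b) \<le> (L + 1) * dist a b"
      by (simp add: algebra_simps)
  qed
  then show "\<exists>U L. open U \<and> p \<in> U \<and> L-lipschitz_on (S \<times> UNIV \<inter> U) (\<lambda>p. (f (fst p), snd p))"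
    using U(1,2) by (intro exI[of _ "U \<times> UNIV"] exI[of _ "L + 1"]) (auto simp: mem_Times_iff open_Times)
qed

section \<open>Null sets in charts\<close>

lemma closed_orthant: "B \<subseteq> Basis \<Longrightarrow> closed (orthant B)"
proof -
  have "orthant B = span B \<inter> (\<Inter>b\<in>B. {x. 0 \<le> b \<bullet> x})"
    by (auto simp: orthant_def inner_commute)
  moreover have "closed (span B \<inter> (\<Inter>b\<in>B. {x. 0 \<le> b \<bullet> x}))"
    by (intro closed_Int closed_INT ballI closed_span closed_Collect_le continuous_intros)
  ultimately show ?thesis by simp
qed

lemma local_paramE:
  fixes X :: "'a::euclidean_space set"
  assumes "local_param k X B W \<phi>"
  obtains \<psi> where "B \<subseteq> Basis" "card B = k" "W \<in> sets borel" "W \<subseteq> orthant B" "W \<subseteq> span B" "\<phi> ` W \<subseteq> X"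
    "openin (top_of_set (orthant B)) W" "openin (top_of_set X) (\<phi> ` W)"
    "homeomorphism W (\<phi> ` W) \<phi> \<psi>" "C1_on W \<phi>" "C1_on (\<phi> ` W) \<psi>"
    "locally_lipschitz_on W \<phi>" "locally_lipschitz_on (\<phi> ` W) \<psi>"
proof -
  from assms obtain \<psi> where *: "B \<subseteq> Basis" "card B = k" "openin (top_of_set (orthant B)) W" "openin (top_of_set X) (\<phi> ` W)"
    "diffeomorphism W (\<phi> ` W) \<phi> \<psi>" unfolding local_param_def by auto
  have "W \<in> sets borel"
    using *(3) closed_orthant[OF *(1)] unfolding openin_open by auto
  moreover have "W \<subseteq> orthant B" using openin_imp_subset[OF *(3)] .
  moreover have "\<phi> ` W \<subseteq> X" using openin_imp_subset[OF *(4)] .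
  moreover have "W \<subseteq> span B" using \<open>W \<subseteq> orthant B\<close> by (auto simp: orthant_def)
  moreover have "homeomorphism W (\<phi> ` W) \<phi> \<psi>" "C1_on W \<phi>" "C1_on (\<phi> ` W) \<psi>"
    using *(5) by (simp_all add: diffeomorphism_def)
  ultimately show thesis using *(1-4) by (intro that C1_on_imp_locally_lipschitz_on)
qed

lemma regular_points_subset: "regular_points k X \<subseteq> X"
proof
  fix x assume "x \<in> regular_points k X"
  then obtain B W \<phi> where "local_param k X B W \<phi>" "x \<in> \<phi> ` W"
    unfolding regular_points_def by blast
  then have "openin (top_of_set X) (\<phi> ` W)" "x \<in> \<phi> ` W"
    by (simp_all add: local_param_def)
  then show "x \<in> X" using openin_imp_subset by blast
qed

lemma openin_regular_points: "openin (top_of_set X) (regular_points k X)"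
proof -
  have "regular_points k X = \<Union>{\<phi> ` W |B W \<phi>. local_param k X B W \<phi>}"
    by (auto simp: regular_points_def)
  then show ?thesis by (auto simp: local_param_def)
qed

text \<open>By Lindelof's theorem countably many charts cover the regular points. Countability lets
  null sets be assembled from their parts in charts, and lets quantifiers over charts be exchanged
  with \<open>AE\<close>.\<close>

lemma countable_charts:
  obtains \<C> where "countable \<C>" "\<And>B W \<phi>. (B, W, \<phi>) \<in> \<C> \<Longrightarrow> local_param k X B W \<phi>"
    "regular_points k X = (\<Union>(B, W, \<phi>)\<in>\<C>. \<phi> ` W)"
proof -
  let ?P = "{(B, W, \<phi>). local_param k X B W \<phi>}" and ?im = "\<lambda>(B, W, \<phi>). \<phi> ` W"
  obtain \<F> where F: "\<F> \<subseteq> ?im ` ?P" "countable \<F>" "\<Union>\<F> = \<Union>(?im ` ?P)"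
    by (rule Lindelof_openin[of "?im ` ?P" X]) (auto simp: local_param_def)
  then obtain \<C> where C: "countable \<C>" "\<C> \<subseteq> ?P" "\<F> = ?im ` \<C>"
    by (meson countable_subset_image)
  show thesis
  proof (rule that[OF C(1)])
    show "\<And>B W \<phi>. (B, W, \<phi>) \<in> \<C> \<Longrightarrow> local_param k X B W \<phi>" using C(2) by auto
    have "regular_points k X = \<Union>(?im ` ?P)" by (auto simp: regular_points_def)
    also have "\<dots> = \<Union>(?im ` \<C>)" using F(3) C(3) by simp
    finally show "regular_points k X = (\<Union>(B, W, \<phi>)\<in>\<C>. \<phi> ` W)" .
  qed
qed

lemma chart_image_Collect:
  "\<phi> ` {w\<in>W. \<phi> w \<in> A} = A \<inter> \<phi> ` W"
  by auto

lemma chart_preimage: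
  assumes "homeomorphism W (\<phi> ` W) \<phi> \<psi>"
  shows "{w\<in>W. \<phi> w \<in> A} = \<psi> ` (A \<inter> \<phi> ` W)"
proof (intro equalityI subsetI)
  fix w assume "w \<in> {w\<in>W. \<phi> w \<in> A}"
  then have "w = \<psi> (\<phi> w)" "\<phi> w \<in> A \<inter> \<phi> ` W"
    using assms by (auto simp: homeomorphism_def)
  then show "w \<in> \<psi> ` (A \<inter> \<phi> ` W)" by (rule image_eqI)
qed (use assms in \<open>auto simp: homeomorphism_def\<close>)

text \<open>A parametrization and its inverse are both locally Lipschitz, so Hausdorff null sets
  pass in both directions; in the parameter domain they are the Lebesgue null sets.\<close>

lemma chart_null_iff:
  assumes c: "local_param k X B W \<phi>" and A: "A \<in> sets borel"
  shows "{w\<in>W. \<phi> w \<in> A} \<in> null_sets (lborel_span B) \<longleftrightarrow> hausdorff_null k (A \<inter> \<phi> ` W)"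
proof -
  from local_paramE[OF c] obtain \<psi> where p: "B \<subseteq> Basis" "card B = k" "W \<in> sets borel" "W \<subseteq> span B"
    "homeomorphism W (\<phi> ` W) \<phi> \<psi>"
    "locally_lipschitz_on W \<phi>" "locally_lipschitz_on (\<phi> ` W) \<psi>" by metis
  let ?E = "{w\<in>W. \<phi> w \<in> A}"
  have "?E \<in> sets borel"
  proof -
    have "\<phi> \<in> borel_measurable (restrict_space borel W)"
      using p(5) by (intro borel_measurable_continuous_on_restrict) (simp add: homeomorphism_def)
    then have "\<phi> -` A \<inter> space (restrict_space borel W) \<in> sets (restrict_space borel W)"
      using A by (rule measurable_sets)
    then have "\<phi> -` A \<inter> W \<in> sets borel"
      using p(3) by (auto simp: sets_restrict_space_iff space_restrict_space)
    then show ?thesis by (simp add: vimage_def Int_def conj_commute)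
  qed
  then have "?E \<in> null_sets (lborel_span B) \<longleftrightarrow> hausdorff_null k ?E"
    using p by (intro hausdorff_null_iff_null_lborel_span[symmetric]) auto
  also have "\<dots> \<longleftrightarrow> hausdorff_null k (A \<inter> \<phi> ` W)"
  proof
    assume "hausdorff_null k ?E"
    then have "hausdorff_null k (\<phi> ` ?E)"
      by (rule hausdorff_null_locally_lipschitz_image[OF p(6)]) auto
    then show "hausdorff_null k (A \<inter> \<phi> ` W)" unfolding chart_image_Collect .
  next
    assume "hausdorff_null k (A \<inter> \<phi> ` W)"
    then show "hausdorff_null k ?E"
      unfolding chart_preimage[OF p(5)]
      by (rule hausdorff_null_locally_lipschitz_image[OF p(7)]) auto
  qed
  finally show ?thesis .
qed

text \<open>By Fubini the left-hand side says that the preimage of \<open>A\<close> in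
  \<open>W \<times> UNIV\<close> is null for the product of Lebesgue measures. The parametrization
  times the identity is again locally Lipschitz in both directions.\<close>

lemma chart_pair_null_iff:
  fixes A :: "('a::euclidean_space \<times> real) set"
  assumes c: "local_param k X B W \<phi>" and A: "A \<in> sets borel"
  shows "(AE t in lborel. {w\<in>W. (\<phi> w, t) \<in> A} \<in> null_sets (lborel_span B)) \<longleftrightarrow>
    hausdorff_null (Suc k) (A \<inter> \<phi> ` W \<times> UNIV)"
proof -
  from local_paramE[OF c] obtain \<psi> where p: "B \<subseteq> Basis" "card B = k" "W \<in> sets borel" "W \<subseteq> span B"
    "homeomorphism W (\<phi> ` W) \<phi> \<psi>"
    "locally_lipschitz_on W \<phi>" "locally_lipschitz_on (\<phi> ` W) \<psi>" by metis
  let ?\<Phi> = "\<lambda>p::'a \<times> real. (\<phi> (fst p), snd p)" and ?\<Psi> = "\<lambda>p::'a \<times> real. (\<psi> (fst p), snd p)"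
  let ?E = "{p\<in>W \<times> UNIV. ?\<Phi> p \<in> A}"
  have E: "?E \<in> sets borel"
  proof -
    have "?\<Phi> \<in> borel_measurable (restrict_space borel (W \<times> UNIV))"
      using p(5) by (intro borel_measurable_continuous_on_restrict continuous_intros
        continuous_on_compose2[of W \<phi> "W \<times> UNIV" fst]) (auto simp: homeomorphism_def)
    then have "?\<Phi> -` A \<inter> space (restrict_space borel (W \<times> UNIV)) \<in> sets (restrict_space borel (W \<times> UNIV))"
      using A by (rule measurable_sets)
    moreover have "W \<times> (UNIV :: real set) \<in> sets borel"
      using p(3) by (intro borel_Times) auto
    ultimately have "?\<Phi> -` A \<inter> W \<times> UNIV \<in> sets borel"
      by (auto simp: sets_restrict_space_iff space_restrict_space)
    then show ?thesis by (simp add: vimage_def Int_def conj_commute)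
  qed
  interpret B: sigma_finite_measure "lborel_span B" by (rule sigma_finite_lborel_span[OF p(1)])
  interpret pair_sigma_finite "lborel_span B" "lborel :: real measure" ..
  have E': "?E \<in> sets (lborel_span B \<Otimes>\<^sub>M lborel)"
    using E by (simp add: borel_prod[symmetric] cong: sets_pair_measure_cong)
  have slice: "(\<lambda>w. (w, t)) -` ?E = {w\<in>W. (\<phi> w, t) \<in> A}" for t by auto
  have slice_sets: "{w\<in>W. (\<phi> w, t) \<in> A} \<in> sets (lborel_span B)" for t
    using sets_Pair2[OF E', of t] unfolding slice .
  have "emeasure (lborel_span B \<Otimes>\<^sub>M lborel) ?E = (\<integral>\<^sup>+t. emeasure (lborel_span B) {w\<in>W. (\<phi> w, t) \<in> A} \<partial>lborel)"
    using emeasure_pair_measure_alt2[OF E'] unfolding slice .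
  moreover have "(\<lambda>t. emeasure (lborel_span B) {w\<in>W. (\<phi> w, t) \<in> A}) \<in> borel_measurable lborel"
    using measurable_emeasure_Pair2[OF E'] unfolding slice .
  ultimately have "?E \<in> null_sets (lborel_span B \<Otimes>\<^sub>M lborel) \<longleftrightarrow>
    (AE t in lborel. emeasure (lborel_span B) {w\<in>W. (\<phi> w, t) \<in> A} = 0)"
    using E' by (simp add: null_sets_def nn_integral_0_iff_AE)
  also have "\<dots> \<longleftrightarrow> (AE t in lborel. {w\<in>W. (\<phi> w, t) \<in> A} \<in> null_sets (lborel_span B))"
    using slice_sets by (simp add: null_sets_def)
  finally have 1: "(AE t in lborel. {w\<in>W. (\<phi> w, t) \<in> A} \<in> null_sets (lborel_span B)) \<longleftrightarrow> hausdorff_null (Suc k) ?E"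
    using p E by (subst hausdorff_null_iff_null_lborel_span_pair) auto
  have im: "A \<inter> \<phi> ` W \<times> UNIV = ?\<Phi> ` ?E"
  proof (intro equalityI subsetI)
    fix p assume "p \<in> A \<inter> \<phi> ` W \<times> UNIV"
    then obtain w where "w \<in> W" "p = ?\<Phi> (w, snd p)" "p \<in> A" by (cases p) auto
    then show "p \<in> ?\<Phi> ` ?E" by (intro image_eqI[of _ _ "(w, snd p)"]) auto
  qed auto
  have pre: "?E = ?\<Psi> ` (A \<inter> \<phi> ` W \<times> UNIV)"
  proof (intro equalityI subsetI)
    fix p assume "p \<in> ?E"
    then have "p = ?\<Psi> (?\<Phi> p)" "?\<Phi> p \<in> A \<inter> \<phi> ` W \<times> UNIV"
      using p(5) by (auto simp: homeomorphism_def)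
    then show "p \<in> ?\<Psi> ` (A \<inter> \<phi> ` W \<times> UNIV)" by (rule image_eqI)
  qed (use p(5) in \<open>auto simp: homeomorphism_def\<close>)
  have "hausdorff_null (Suc k) ?E \<longleftrightarrow> hausdorff_null (Suc k) (A \<inter> \<phi> ` W \<times> UNIV)"
  proof
    assume "hausdorff_null (Suc k) ?E"
    then show "hausdorff_null (Suc k) (A \<inter> \<phi> ` W \<times> UNIV)"
      unfolding im by (rule hausdorff_null_locally_lipschitz_image[OF locally_lipschitz_on_Times_real[OF p(6)]]) auto
  next
    assume *: "hausdorff_null (Suc k) (A \<inter> \<phi> ` W \<times> UNIV)"
    show "hausdorff_null (Suc k) ?E"
      by (subst pre, rule hausdorff_null_locally_lipschitz_image[OF locally_lipschitz_on_Times_real[OF p(7)] *]) auto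
  qed
  with 1 show ?thesis by simp
qed

text \<open>A point of \<open>X\<close> outside all charts of the atlas is singular, and the
  singular points are null by hypothesis.\<close>

lemma hausdorff_null_iff_charts:
  assumes X: "hausdorff_null k (X - regular_points k X)" "A \<subseteq> X"
    and C: "countable \<C>" "regular_points k X = (\<Union>(B, W, \<phi>)\<in>\<C>. \<phi> ` W)"
  shows "hausdorff_null k A \<longleftrightarrow> (\<forall>(B, W, \<phi>)\<in>\<C>. hausdorff_null k (A \<inter> \<phi> ` W))"
proof
  assume "hausdorff_null k A"
  then show "\<forall>(B, W, \<phi>)\<in>\<C>. hausdorff_null k (A \<inter> \<phi> ` W)"
    by (auto elim: hausdorff_null_subset)
next
  assume *: "\<forall>(B, W, \<phi>)\<in>\<C>. hausdorff_null k (A \<inter> \<phi> ` W)"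
  have "hausdorff_null k ((\<Union>c\<in>\<C>. A \<inter> (case c of (B, W, \<phi>) \<Rightarrow> \<phi> ` W)) \<union> (X - regular_points k X))"
    using * by (intro hausdorff_null_Un hausdorff_null_UN C X) auto
  then show "hausdorff_null k A"
    by (rule hausdorff_null_subset) (use X(2) C(2) in auto)
qed

section \<open>Null sets of Lebesgue-class measures and of their products with time\<close>

lemma sets_lebesgue_class:
  assumes "lebesgue_class k X \<mu>" "closed X"
  shows "A \<in> sets \<mu> \<longleftrightarrow> A \<in> sets borel \<and> A \<subseteq> X" "space \<mu> = X"
proof -
  have s: "sets \<mu> = sets (restrict_space borel X)" using assms by (simp add: lebesgue_class_def)
  show "A \<in> sets \<mu> \<longleftrightarrow> A \<in> sets borel \<and> A \<subseteq> X"
    unfolding s using assms(2) by (subst sets_restrict_space_iff) auto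
  show "space \<mu> = X" using sets_eq_imp_space_eq[OF s] by (simp add: space_restrict_space)
qed

text \<open>A countable atlas suffices to recover all of \<open>A\<close> up to singular points. In
  chart-free form, null sets of measures on different manifolds can be compared along Lipschitz
  maps.\<close>

lemma lebesgue_class_null_iff:
  assumes \<mu>: "lebesgue_class k X \<mu>" and X: "manifold k X" and A: "A \<in> sets \<mu>"
  shows "emeasure \<mu> A = 0 \<longleftrightarrow> hausdorff_null k A"
proof -
  have cl: "closed X" and sing: "hausdorff_null k (X - regular_points k X)"
    using X by (auto simp: manifold_def compact_imp_closed)
  have A': "A \<in> sets borel" "A \<subseteq> X" using sets_lebesgue_class[OF \<mu> cl] A by auto
  obtain \<C> where C: "countable \<C>" "\<And>B W \<phi>. (B, W, \<phi>) \<in> \<C> \<Longrightarrow> local_param k X B W \<phi>"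
    "regular_points k X = (\<Union>(B, W, \<phi>)\<in>\<C>. \<phi> ` W)" by (rule countable_charts[of k X]) (rule that)
  have "emeasure \<mu> A = 0 \<longleftrightarrow>
        (\<forall>B W \<phi>. local_param k X B W \<phi> \<longrightarrow> hausdorff_null k (A \<inter> \<phi> ` W))"
    using \<mu> A chart_null_iff[OF _ A'(1)] by (simp add: lebesgue_class_def)
  also have "\<dots> \<longleftrightarrow> hausdorff_null k A"
  proof
    assume "\<forall>B W \<phi>. local_param k X B W \<phi> \<longrightarrow> hausdorff_null k (A \<inter> \<phi> ` W)"
    then show "hausdorff_null k A"
      unfolding hausdorff_null_iff_charts[OF sing A'(2) C(1,3)] by (auto dest!: C(2))
  qed (auto elim: hausdorff_null_subset)
  finally show ?thesis .
qed

text \<open>Each inclusion is the measurability of the identity map from one space to the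
  other.\<close>

lemma sets_pair_restrict_borel:
  fixes M :: "'a::euclidean_space measure" and N :: "'b::euclidean_space measure"
  assumes M: "sets M = sets (restrict_space borel X)" and N: "sets N = sets (restrict_space borel Y)"
  shows "sets (M \<Otimes>\<^sub>M N) = sets (restrict_space borel (X \<times> Y))"
proof -
  have sM: "space M = X" and sN: "space N = Y"
    using sets_eq_imp_space_eq[OF M] sets_eq_imp_space_eq[OF N] by (auto simp: space_restrict_space)
  have M1: "(\<lambda>x. x) \<in> measurable M borel"
    by (subst measurable_cong_sets[OF M refl]) (rule measurable_restrict_space1, simp)
  have N1: "(\<lambda>x. x) \<in> measurable N borel"
    by (subst measurable_cong_sets[OF N refl]) (rule measurable_restrict_space1, simp)
  have "(\<lambda>p. (fst p, snd p)) \<in> measurable (M \<Otimes>\<^sub>M N) borel"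
    unfolding borel_prod[symmetric]
    by (intro measurable_Pair measurable_compose[OF measurable_fst M1] measurable_compose[OF measurable_snd N1])
  then have 1: "(\<lambda>p. p) \<in> measurable (M \<Otimes>\<^sub>M N) (restrict_space borel (X \<times> Y))"
    by (intro measurable_restrict_space2) (auto simp: space_pair_measure sM sN)
  have "fst \<in> borel_measurable (borel :: ('a \<times> 'b) measure)"
    by (intro borel_measurable_continuous_onI continuous_on_fst continuous_on_id)
  then have "fst \<in> measurable (restrict_space borel (X \<times> Y)) (restrict_space borel X)"
    by (rule measurable_restrict_space3) auto
  then have f: "fst \<in> measurable (restrict_space borel (X \<times> Y)) M"
    by (subst measurable_cong_sets[OF refl M])
  have "snd \<in> borel_measurable (borel :: ('a \<times> 'b) measure)"
    by (intro borel_measurable_continuous_onI continuous_on_snd continuous_on_id)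
  then have "snd \<in> measurable (restrict_space borel (X \<times> Y)) (restrict_space borel Y)"
    by (rule measurable_restrict_space3) auto
  then have s: "snd \<in> measurable (restrict_space borel (X \<times> Y)) N"
    by (subst measurable_cong_sets[OF refl N])
  have "(\<lambda>p. (fst p, snd p)) \<in> measurable (restrict_space borel (X \<times> Y)) (M \<Otimes>\<^sub>M N)"
    by (intro measurable_Pair f s)
  then have 2: "(\<lambda>p. p) \<in> measurable (restrict_space borel (X \<times> Y)) (M \<Otimes>\<^sub>M N)" by simp
  show ?thesis
  proof (intro equalityI subsetI)
    fix A assume A: "A \<in> sets (M \<Otimes>\<^sub>M N)"
    have "(\<lambda>p. p) -` A \<inter> space (restrict_space borel (X \<times> Y)) = A"
      using sets.sets_into_space[OF A] by (auto simp: space_restrict_space space_pair_measure sM sN)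
    with measurable_sets[OF 2 A] show "A \<in> sets (restrict_space borel (X \<times> Y))" by simp
  next
    fix A assume A: "A \<in> sets (restrict_space borel (X \<times> Y))"
    have "(\<lambda>p. p) -` A \<inter> space (M \<Otimes>\<^sub>M N) = A"
      using sets.sets_into_space[OF A] by (auto simp: space_restrict_space space_pair_measure sM sN)
    with measurable_sets[OF 1 A] show "A \<in> sets (M \<Otimes>\<^sub>M N)" by simp
  qed
qed

text \<open>Of \<open>\<mu>\<close> only the null sets are known, so the product is examined slice
  by slice: almost every time slice is null, which can be tested in charts, and
  \<open>chart_pair_null_iff\<close> reassembles the slices over each chart.\<close>

lemma lebesgue_class_pair_null_iff:
  fixes X :: "'a::euclidean_space set"
  assumes \<mu>: "lebesgue_class k X \<mu>" "sigma_finite_measure \<mu>" and X: "manifold k X"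
    and A: "A \<in> sets (\<mu> \<Otimes>\<^sub>M restrict_space lborel {0::real..})"
  shows "emeasure (\<mu> \<Otimes>\<^sub>M restrict_space lborel {0..}) A = 0 \<longleftrightarrow> hausdorff_null (Suc k) A"
proof -
  let ?R = "restrict_space lborel {0::real..}"
  have cl: "closed X" and sing: "hausdorff_null k (X - regular_points k X)"
    using X by (auto simp: manifold_def compact_imp_closed)
  have sR: "sets ?R = sets (restrict_space borel {0..})"
    by (simp add: sets_restrict_space)
  have A': "A \<in> sets borel" "A \<subseteq> X \<times> {0..}"
  proof -
    have XR: "X \<times> {0::real..} \<in> sets borel" using cl by (intro borel_closed closed_Times) auto
    have "sets \<mu> = sets (restrict_space borel X)" using \<mu> by (simp add: lebesgue_class_def)
    then have "sets (\<mu> \<Otimes>\<^sub>M ?R) = sets (restrict_space borel (X \<times> {0..}))"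
      by (intro sets_pair_restrict_borel sR)
    with A have "A \<in> sets (restrict_space borel (X \<times> {0..}))" by (simp only:)
    with XR show "A \<in> sets borel" "A \<subseteq> X \<times> {0..}"
      by (simp_all add: sets_restrict_space_iff)
  qed
  obtain \<C> where C: "countable \<C>" "\<And>B W \<phi>. (B, W, \<phi>) \<in> \<C> \<Longrightarrow> local_param k X B W \<phi>"
    "regular_points k X = (\<Union>(B, W, \<phi>)\<in>\<C>. \<phi> ` W)" by (rule countable_charts[of k X]) (rule that)
  interpret M: sigma_finite_measure \<mu> by fact
  interpret R: sigma_finite_measure ?R
    by (rule sigma_finite_measure_restrict_space) (auto intro: lborel.sigma_finite_measure_axioms)
  interpret pair_sigma_finite \<mu> ?R ..
  let ?s = "\<lambda>t. (\<lambda>x. (x, t)) -` A"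
  have s: "?s t \<in> sets \<mu>" for t by (rule sets_Pair2[OF A])
  have sb: "?s t \<in> sets borel" "?s t \<subseteq> X" for t
    using s[of t] sets_lebesgue_class[OF \<mu>(1) cl] by auto
  have "emeasure (\<mu> \<Otimes>\<^sub>M ?R) A = 0 \<longleftrightarrow> (AE t in ?R. emeasure \<mu> (?s t) = 0)"
    unfolding emeasure_pair_measure_alt2[OF A] using measurable_emeasure_Pair2[OF A]
    by (simp add: nn_integral_0_iff_AE)
  also have "\<dots> \<longleftrightarrow> (AE t in lborel. t \<in> {0..} \<longrightarrow> emeasure \<mu> (?s t) = 0)"
    by (rule AE_restrict_space_iff) auto
  also have "\<dots> \<longleftrightarrow> (AE t in lborel. emeasure \<mu> (?s t) = 0)"
  proof -
    have "?s t = {}" if "t \<notin> {0..}" for t using A'(2) that by auto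
    then show ?thesis by (intro AE_cong) auto
  qed
  also have "\<dots> \<longleftrightarrow> (AE t in lborel. \<forall>c\<in>\<C>. case c of (B, W, \<phi>) \<Rightarrow> hausdorff_null k (?s t \<inter> \<phi> ` W))"
    using lebesgue_class_null_iff[OF \<mu>(1) X s] hausdorff_null_iff_charts[OF sing sb(2) C(1,3)] by simp
  \<comment> \<open>The exceptional set of times may depend on the chart; countability of the atlas
    absorbs this.\<close>
  also have "\<dots> \<longleftrightarrow> (\<forall>c\<in>\<C>. AE t in lborel. case c of (B, W, \<phi>) \<Rightarrow> hausdorff_null k (?s t \<inter> \<phi> ` W))"
    by (rule AE_ball_countable[OF C(1)])
  also have "\<dots> \<longleftrightarrow> (\<forall>(B, W, \<phi>)\<in>\<C>. hausdorff_null (Suc k) (A \<inter> \<phi> ` W \<times> UNIV))"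
  proof (intro ball_cong refl, clarify)
    fix B W \<phi> assume "(B, W, \<phi>) \<in> \<C>"
    note c = C(2)[OF this]
    have "(AE t in lborel. hausdorff_null k (?s t \<inter> \<phi> ` W)) \<longleftrightarrow>
      (AE t in lborel. {w\<in>W. \<phi> w \<in> ?s t} \<in> null_sets (lborel_span B))"
      using chart_null_iff[OF c sb(1)] by simp
    also have "\<dots> \<longleftrightarrow> hausdorff_null (Suc k) (A \<inter> \<phi> ` W \<times> UNIV)"
      using chart_pair_null_iff[OF c A'(1)] by simp
    finally show "(AE t in lborel. hausdorff_null k (?s t \<inter> \<phi> ` W)) \<longleftrightarrow> hausdorff_null (Suc k) (A \<inter> \<phi> ` W \<times> UNIV)" .
  qed
  also have "\<dots> \<longleftrightarrow> hausdorff_null (Suc k) A"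
  proof
    assume *: "\<forall>(B, W, \<phi>)\<in>\<C>. hausdorff_null (Suc k) (A \<inter> \<phi> ` W \<times> UNIV)"
    have "hausdorff_null (Suc k) ((\<Union>c\<in>\<C>. A \<inter> (case c of (B, W, \<phi>) \<Rightarrow> \<phi> ` W \<times> UNIV)) \<union> (X - regular_points k X) \<times> UNIV)"
      using * by (intro hausdorff_null_Un hausdorff_null_UN hausdorff_null_Times_real C sing) auto
    then show "hausdorff_null (Suc k) A"
    proof (rule hausdorff_null_subset, intro subsetI)
      fix p assume p: "p \<in> A"
      then have "fst p \<in> X" using A'(2) by auto
      then consider "fst p \<in> X - regular_points k X" | c where "c \<in> \<C>" "fst p \<in> (case c of (B, W, \<phi>) \<Rightarrow> \<phi> ` W)"
        using C(3) by blast
      then show "p \<in> (\<Union>c\<in>\<C>. A \<inter> (case c of (B, W, \<phi>) \<Rightarrow> \<phi> ` W \<times> UNIV)) \<union> (X - regular_points k X) \<times> UNIV"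
      proof cases
        case 2
        then show ?thesis using p by (intro UnI1 UN_I[of c]) (auto split: prod.splits simp: mem_Times_iff)
      qed (simp add: mem_Times_iff)
    qed
  qed (auto elim: hausdorff_null_subset)
  finally show ?thesis .
qed

section \<open>Differentiable maps and tangent vectors\<close>

lemma C1_onE:
  fixes f :: "'a::euclidean_space \<Rightarrow> 'b::euclidean_space"
  assumes "C1_on S f" "x \<in> S"
  obtains U g and g' :: "'a \<Rightarrow> 'a \<Rightarrow>\<^sub>L 'b" where "open U" "x \<in> U" "\<And>y. y \<in> S \<Longrightarrow> y \<in> U \<Longrightarrow> g y = f y"
    "\<And>y. y \<in> U \<Longrightarrow> (g has_derivative blinfun_apply (g' y)) (at y)" "continuous_on U g'"
proof -
  from bspec[OF assms(1)[unfolded C1_on_def] assms(2)] obtain U g and g' :: "'a \<Rightarrow> 'a \<Rightarrow>\<^sub>L 'b"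
    where *: "open U \<and> x \<in> U \<and> (\<forall>y\<in>S \<inter> U. g y = f y) \<and>
        (\<forall>y\<in>U. (g has_derivative blinfun_apply (g' y)) (at y)) \<and> continuous_on U g'"
    by (elim exE)
  show thesis by (rule that[of U g g']) (use * in simp_all)
qed

lemma C1_onI:
  fixes f :: "'a::euclidean_space \<Rightarrow> 'b::euclidean_space"
  assumes "\<And>x. x \<in> S \<Longrightarrow> \<exists>U g. \<exists>g' :: 'a \<Rightarrow> 'a \<Rightarrow>\<^sub>L 'b. open U \<and> x \<in> U \<and> (\<forall>y. y \<in> S \<longrightarrow> y \<in> U \<longrightarrow> g y = f y) \<and>
    (\<forall>y. y \<in> U \<longrightarrow> (g has_derivative blinfun_apply (g' y)) (at y)) \<and> continuous_on U g'"
  shows "C1_on S f"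
  unfolding C1_on_def
proof
  fix x assume "x \<in> S"
  from assms[OF this] show "\<exists>U g. \<exists>g' :: 'a \<Rightarrow> 'a \<Rightarrow>\<^sub>L 'b. open U \<and> x \<in> U \<and> (\<forall>y\<in>S \<inter> U. g y = f y) \<and>
    (\<forall>y\<in>U. (g has_derivative blinfun_apply (g' y)) (at y)) \<and> continuous_on U g'"
    by (simp add: Ball_def imp_conjL)
qed

lemma C1_on_subset:
  fixes f :: "'a::euclidean_space \<Rightarrow> 'b::euclidean_space"
  assumes f: "C1_on S f" and T: "T \<subseteq> S"
  shows "C1_on T f"
proof (rule C1_onI)
  fix x assume "x \<in> T"
  then have x: "x \<in> S" using T by auto
  obtain U g and g' :: "'a \<Rightarrow> 'a \<Rightarrow>\<^sub>L 'b" where U: "open U" "x \<in> U" "\<And>y. y \<in> S \<Longrightarrow> y \<in> U \<Longrightarrow> g y = f y"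
    "\<And>y. y \<in> U \<Longrightarrow> (g has_derivative blinfun_apply (g' y)) (at y)" "continuous_on U g'"
    by (rule C1_onE[OF f x]) (rule that)
  show "\<exists>U g. \<exists>g' :: 'a \<Rightarrow> 'a \<Rightarrow>\<^sub>L 'b. open U \<and> x \<in> U \<and> (\<forall>y. y \<in> T \<longrightarrow> y \<in> U \<longrightarrow> g y = f y) \<and>
    (\<forall>y. y \<in> U \<longrightarrow> (g has_derivative blinfun_apply (g' y)) (at y)) \<and> continuous_on U g'"
    by (rule exI[of _ U], rule exI[of _ g], rule exI[of _ g']) (use U T in auto)
qed

lemma C1_on_local:
  fixes f :: "'a::euclidean_space \<Rightarrow> 'b::euclidean_space"
  assumes "\<And>x. x \<in> S \<Longrightarrow> \<exists>T. open T \<and> x \<in> T \<and> C1_on (S \<inter> T) f"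
  shows "C1_on S f"
proof (rule C1_onI)
  fix x assume x: "x \<in> S"
  from assms[OF x] obtain T where T: "open T" "x \<in> T" "C1_on (S \<inter> T) f" by (elim exE conjE)
  obtain U g and g' :: "'a \<Rightarrow> 'a \<Rightarrow>\<^sub>L 'b" where U: "open U" "x \<in> U" "\<And>y. y \<in> S \<inter> T \<Longrightarrow> y \<in> U \<Longrightarrow> g y = f y"
    "\<And>y. y \<in> U \<Longrightarrow> (g has_derivative blinfun_apply (g' y)) (at y)" "continuous_on U g'"
    by (rule C1_onE[OF T(3), of x]) (use x T in \<open>auto intro: that\<close>)
  show "\<exists>U g. \<exists>g' :: 'a \<Rightarrow> 'a \<Rightarrow>\<^sub>L 'b. open U \<and> x \<in> U \<and> (\<forall>y. y \<in> S \<longrightarrow> y \<in> U \<longrightarrow> g y = f y) \<and>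
    (\<forall>y. y \<in> U \<longrightarrow> (g has_derivative blinfun_apply (g' y)) (at y)) \<and> continuous_on U g'"
    by (rule exI[of _ "U \<inter> T"], rule exI[of _ g], rule exI[of _ g'])
      (use U T in \<open>auto intro: open_Int continuous_on_subset\<close>)
qed

lemma C1_on_bounded_linear:
  fixes f :: "'a::euclidean_space \<Rightarrow> 'b::euclidean_space"
  assumes "bounded_linear f"
  shows "C1_on S f"
proof (rule C1_onI)
  fix x
  show "\<exists>U g. \<exists>g' :: 'a \<Rightarrow> 'a \<Rightarrow>\<^sub>L 'b. open U \<and> x \<in> U \<and> (\<forall>y. y \<in> S \<longrightarrow> y \<in> U \<longrightarrow> g y = f y) \<and>
    (\<forall>y. y \<in> U \<longrightarrow> (g has_derivative blinfun_apply (g' y)) (at y)) \<and> continuous_on U g'"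
    by (rule exI[of _ UNIV], rule exI[of _ f], rule exI[of _ "\<lambda>_. Blinfun f"])
      (use assms in \<open>auto simp: bounded_linear_Blinfun_apply bounded_linear_imp_has_derivative\<close>)
qed

lemma C1_on_compose:
  fixes f :: "'a::euclidean_space \<Rightarrow> 'b::euclidean_space" and g :: "'b \<Rightarrow> 'c::euclidean_space"
  assumes f: "C1_on S f" and g: "C1_on T g" and fS: "f ` S \<subseteq> T"
  shows "C1_on S (\<lambda>x. g (f x))"
proof (rule C1_onI)
  fix x assume x: "x \<in> S"
  obtain U F and F' :: "'a \<Rightarrow> 'a \<Rightarrow>\<^sub>L 'b" where U: "open U" "x \<in> U" "\<And>y. y \<in> S \<Longrightarrow> y \<in> U \<Longrightarrow> F y = f y"
    "\<And>y. y \<in> U \<Longrightarrow> (F has_derivative blinfun_apply (F' y)) (at y)" "continuous_on U F'"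
    by (rule C1_onE[OF f x]) (rule that)
  have "f x \<in> T" using x fS by auto
  then obtain V G and G' :: "'b \<Rightarrow> 'b \<Rightarrow>\<^sub>L 'c" where V: "open V" "f x \<in> V" "\<And>y. y \<in> T \<Longrightarrow> y \<in> V \<Longrightarrow> G y = g y"
    "\<And>y. y \<in> V \<Longrightarrow> (G has_derivative blinfun_apply (G' y)) (at y)" "continuous_on V G'"
    by (rule C1_onE[OF g]) (rule that)
  have contF: "continuous_on U F"
    using U(4) by (intro continuous_at_imp_continuous_on ballI) (rule has_derivative_continuous)
  let ?W = "U \<inter> F -` V"
  have W: "open ?W" using contF U(1) V(1) by (rule continuous_open_preimage)
  have d: "((\<lambda>x. G (F x)) has_derivative blinfun_apply (G' (F y) o\<^sub>L F' y)) (at y)" if "y \<in> ?W" for y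
    using has_derivative_compose[OF U(4) V(4)] that by (simp add: blinfun_compose.rep_eq o_def)
  have c: "continuous_on ?W (\<lambda>y. G' (F y) o\<^sub>L F' y)"
  proof (rule bounded_bilinear.continuous_on[OF bounded_bilinear_blinfun_compose])
    show "continuous_on ?W (\<lambda>y. G' (F y))"
      by (rule continuous_on_compose2[OF V(5)]) (auto intro: continuous_on_subset[OF contF])
    show "continuous_on ?W F'" using U(5) by (rule continuous_on_subset) auto
  qed
  have e: "G (F y) = g (f y)" if "y \<in> S" "y \<in> ?W" for y
    using U(3)[of y] V(3)[of "f y"] that fS by auto
  show "\<exists>U h. \<exists>h' :: 'a \<Rightarrow> 'a \<Rightarrow>\<^sub>L 'c. open U \<and> x \<in> U \<and> (\<forall>y. y \<in> S \<longrightarrow> y \<in> U \<longrightarrow> h y = g (f y)) \<and>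
    (\<forall>y. y \<in> U \<longrightarrow> (h has_derivative blinfun_apply (h' y)) (at y)) \<and> continuous_on U h'"
    by (rule exI[of _ ?W], rule exI[of _ "\<lambda>x. G (F x)"], rule exI[of _ "\<lambda>y. G' (F y) o\<^sub>L F' y"], intro conjI)
      (use W U(2,3) V(2) x d c e in auto)
qed

lemma C1_on_add:
  fixes f g :: "'a::euclidean_space \<Rightarrow> 'b::euclidean_space"
  assumes f: "C1_on S f" and g: "C1_on S g"
  shows "C1_on S (\<lambda>x. f x + g x)"
proof (rule C1_onI)
  fix x assume x: "x \<in> S"
  obtain U F and F' :: "'a \<Rightarrow> 'a \<Rightarrow>\<^sub>L 'b" where U: "open U" "x \<in> U" "\<And>y. y \<in> S \<Longrightarrow> y \<in> U \<Longrightarrow> F y = f y"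
    "\<And>y. y \<in> U \<Longrightarrow> (F has_derivative blinfun_apply (F' y)) (at y)" "continuous_on U F'"
    by (rule C1_onE[OF f x]) (rule that)
  obtain V G and G' :: "'a \<Rightarrow> 'a \<Rightarrow>\<^sub>L 'b" where V: "open V" "x \<in> V" "\<And>y. y \<in> S \<Longrightarrow> y \<in> V \<Longrightarrow> G y = g y"
    "\<And>y. y \<in> V \<Longrightarrow> (G has_derivative blinfun_apply (G' y)) (at y)" "continuous_on V G'"
    by (rule C1_onE[OF g x]) (rule that)
  have d: "((\<lambda>x. F x + G x) has_derivative blinfun_apply (F' y + G' y)) (at y)" if "y \<in> U \<inter> V" for y
    using has_derivative_add[OF U(4) V(4)] that by (simp add: plus_blinfun.rep_eq)
  have c: "continuous_on (U \<inter> V) (\<lambda>y. F' y + G' y)"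
    using U(5) V(5) by (intro continuous_on_add) (auto elim: continuous_on_subset)
  show "\<exists>U h. \<exists>h' :: 'a \<Rightarrow> 'a \<Rightarrow>\<^sub>L 'b. open U \<and> x \<in> U \<and> (\<forall>y. y \<in> S \<longrightarrow> y \<in> U \<longrightarrow> h y = f y + g y) \<and>
    (\<forall>y. y \<in> U \<longrightarrow> (h has_derivative blinfun_apply (h' y)) (at y)) \<and> continuous_on U h'"
    by (rule exI[of _ "U \<inter> V"], rule exI[of _ "\<lambda>x. F x + G x"], rule exI[of _ "\<lambda>y. F' y + G' y"], intro conjI)
      (use U(1-3) V(1-3) d c in auto)
qed

lemma C1_on_times_id:
  fixes f :: "'a::euclidean_space \<Rightarrow> 'b::euclidean_space"
  assumes "C1_on S f"
  shows "C1_on (S \<times> T) (\<lambda>p. (f (fst p), snd p :: real))"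
proof -
  have "C1_on (S \<times> T) (\<lambda>p. f (fst p))"
    by (rule C1_on_compose[OF C1_on_bounded_linear[OF bounded_linear_fst] assms]) auto
  then have "C1_on (S \<times> T) (\<lambda>p. (f (fst p), 0 :: real))"
    by (rule C1_on_compose[OF _ C1_on_bounded_linear[of "\<lambda>x. (x, 0)"]])
      (auto intro: bounded_linear_Pair bounded_linear_ident bounded_linear_zero)
  moreover have "C1_on (S \<times> T) (\<lambda>p. (0 :: 'b, snd p))"
    by (intro C1_on_bounded_linear bounded_linear_Pair bounded_linear_snd bounded_linear_zero)
  ultimately have "C1_on (S \<times> T) (\<lambda>p. (f (fst p), 0) + (0, snd p))" by (rule C1_on_add)
  then show ?thesis by simp
qed

lemma C1_on_has_derivative:
  fixes f :: "'a::euclidean_space \<Rightarrow> 'b::euclidean_space"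
  assumes "C1_on S f" "x \<in> S"
  shows "\<exists>D. (f has_derivative D) (at x within S)"
proof -
  obtain U g and g' :: "'a \<Rightarrow> 'a \<Rightarrow>\<^sub>L 'b" where U: "open U" "x \<in> U" "\<And>y. y \<in> S \<Longrightarrow> y \<in> U \<Longrightarrow> g y = f y"
    "\<And>y. y \<in> U \<Longrightarrow> (g has_derivative blinfun_apply (g' y)) (at y)" "continuous_on U g'"
    by (rule C1_onE[OF assms]) (rule that)
  obtain d where d: "0 < d" "ball x d \<subseteq> U" using open_contains_ball_eq[OF U(1)] U(2) by auto
  have "(f has_derivative blinfun_apply (g' x)) (at x within S)"
    by (rule has_derivative_transform_within[OF has_derivative_at_withinI[OF U(4)[OF U(2)]] d(1) assms(2)])
      (use U(3) d(2) in \<open>auto simp: dist_commute subset_iff\<close>)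
  then show ?thesis by blast
qed

text \<open>
  Curves that start at \<open>x\<close> and are defined for small nonnegative times only see the inward
  directions at boundary points and corners; their velocities nevertheless span the tangent space.
\<close>

definition velocities :: "'a::euclidean_space set \<Rightarrow> 'a \<Rightarrow> 'a set" where
  "velocities X x = {u. \<exists>\<gamma> e. 0 < e \<and> \<gamma> 0 = x \<and> \<gamma> ` {0..e} \<subseteq> X \<and>
     (\<gamma> has_vector_derivative u) (at 0 within {0..e::real})}"

definition tangents :: "'a::euclidean_space set \<Rightarrow> 'a \<Rightarrow> 'a set" where
  "tangents X x = span (velocities X x)"

lemma velocitiesI:
  "0 < e \<Longrightarrow> \<gamma> 0 = x \<Longrightarrow> (\<And>h. 0 \<le> h \<Longrightarrow> h \<le> e \<Longrightarrow> \<gamma> h \<in> X) \<Longrightarrow>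
    (\<gamma> has_vector_derivative u) (at 0 within {0..e}) \<Longrightarrow> u \<in> velocities X x"
  unfolding velocities_def by (intro CollectI exI[of _ \<gamma>] exI[of _ e]) auto

lemma velocitiesE:
  assumes "u \<in> velocities X x"
  obtains \<gamma> e where "0 < e" "\<gamma> 0 = x" "\<And>h. 0 \<le> h \<Longrightarrow> h \<le> e \<Longrightarrow> \<gamma> h \<in> X"
    "(\<gamma> has_vector_derivative u) (at 0 within {0..e})"
proof -
  from assms obtain \<gamma> e where "0 < e" "\<gamma> 0 = x" "\<gamma> ` {0..e} \<subseteq> X"
    "(\<gamma> has_vector_derivative u) (at 0 within {0..e})"
    unfolding velocities_def by (elim CollectE exE conjE)
  then show thesis by (intro that[of e \<gamma>]) auto
qed

lemma velocities_local:
  assumes U: "open U" "x \<in> U"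
  shows "velocities (X \<inter> U) x = velocities X x"
proof (intro equalityI subsetI)
  fix u assume "u \<in> velocities X x"
  then obtain \<gamma> e where g: "0 < e" "\<gamma> 0 = x" "\<And>h. 0 \<le> h \<Longrightarrow> h \<le> e \<Longrightarrow> \<gamma> h \<in> X"
    "(\<gamma> has_vector_derivative u) (at 0 within {0..e})" by (rule velocitiesE) (rule that)
  have "continuous (at 0 within {0..e}) \<gamma>"
    using g(4) by (rule has_vector_derivative_continuous)
  then have "eventually (\<lambda>h. \<gamma> h \<in> U) (at 0 within {0..e})"
    using U g(2) by (auto simp: continuous_within intro: topological_tendstoD)
  then obtain d where d: "0 < d" "\<And>h. h \<in> {0..e} \<Longrightarrow> h \<noteq> 0 \<Longrightarrow> dist h 0 < d \<Longrightarrow> \<gamma> h \<in> U"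
    by (auto simp: eventually_at)
  show "u \<in> velocities (X \<inter> U) x"
  proof (rule velocitiesI[of "min e (d / 2)"])
    show "0 < min e (d / 2)" "\<gamma> 0 = x" using g d by auto
    show "\<gamma> h \<in> X \<inter> U" if "0 \<le> h" "h \<le> min e (d / 2)" for h
      using g(2) g(3)[of h] d(1) d(2)[of h] that U(2) by (cases "h = 0") auto
    show "(\<gamma> has_vector_derivative u) (at 0 within {0..min e (d / 2)})"
      by (rule has_vector_derivative_within_subset[OF g(4)]) auto
  qed
next
  fix u assume "u \<in> velocities (X \<inter> U) x"
  then show "u \<in> velocities X x"
    by (rule velocitiesE) (auto intro: velocitiesI)
qed

lemma velocities_mono: "X \<subseteq> Y \<Longrightarrow> velocities X x \<subseteq> velocities Y x"
proof
  fix u assume XY: "X \<subseteq> Y" and "u \<in> velocities X x"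
  from this(2) show "u \<in> velocities Y x"
    by (rule velocitiesE) (use XY in \<open>auto intro: velocitiesI\<close>)
qed

lemma tangents_local: "open U \<Longrightarrow> x \<in> U \<Longrightarrow> tangents (X \<inter> U) x = tangents X x"
  by (simp add: tangents_def velocities_local)

lemma tangents_openin:
  assumes "openin (top_of_set X) Y" "x \<in> Y"
  shows "tangents Y x = tangents X x"
  using assms tangents_local unfolding openin_open by blast

lemma tangents_mono: "X \<subseteq> Y \<Longrightarrow> tangents X x \<subseteq> tangents Y x"
  unfolding tangents_def by (intro span_mono velocities_mono)

lemma velocities_image:
  assumes u: "u \<in> velocities X x" and D: "(f has_derivative D) (at x within X)" and f: "f ` X \<subseteq> Y"
  shows "D u \<in> velocities Y (f x)"
proof -
  obtain \<gamma> e where g: "0 < e" "\<gamma> 0 = x" "\<And>h. 0 \<le> h \<Longrightarrow> h \<le> e \<Longrightarrow> \<gamma> h \<in> X"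
    "(\<gamma> has_vector_derivative u) (at 0 within {0..e})" by (rule velocitiesE[OF u]) (rule that)
  have "\<gamma> ` {0..e} \<subseteq> X" using g(3) by auto
  with D have "(f has_derivative D) (at (\<gamma> 0) within \<gamma> ` {0..e})"
    unfolding g(2) by (rule has_derivative_subset)
  then have "((f \<circ> \<gamma>) has_vector_derivative D u) (at 0 within {0..e})"
    by (rule vector_derivative_diff_chain_within[OF g(4)])
  then show ?thesis
    using g f by (intro velocitiesI[of e "f \<circ> \<gamma>"]) auto
qed

lemma tangents_image:
  assumes D: "(f has_derivative D) (at x within X)" and f: "f ` X \<subseteq> Y"
  shows "D ` tangents X x \<subseteq> tangents Y (f x)"
proof -
  have "D ` tangents X x = span (D ` velocities X x)"
    unfolding tangents_def using has_derivative_linear[OF D] by (rule linear_span_image[symmetric])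
  also have "\<dots> \<subseteq> tangents Y (f x)"
    unfolding tangents_def using velocities_image[OF _ D f] by (intro span_mono) auto
  finally show ?thesis .
qed

text \<open>Along a curve in \<open>X\<close> both compositions coincide, and a one-sided derivative
  on an interval is unique, so \<open>D\<close> and \<open>E\<close> agree on velocities; linearity
  extends this to their span. It replaces uniqueness of derivatives, which fails within thin
  sets.\<close>

lemma derivative_unique_on_tangents:
  fixes f g :: "'a::euclidean_space \<Rightarrow> 'b::euclidean_space"
  assumes D: "(f has_derivative D) (at x within X)" and E: "(g has_derivative E) (at x within X)"
    and eq: "\<And>y. y \<in> X \<Longrightarrow> f y = g y" and u: "u \<in> tangents X x"
  shows "D u = E u"
proof (rule linear_eq_on[OF has_derivative_linear[OF D] has_derivative_linear[OF E] u[unfolded tangents_def]])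
  fix u assume "u \<in> velocities X x"
  then obtain \<gamma> e where g: "0 < e" "\<gamma> 0 = x" "\<And>h. 0 \<le> h \<Longrightarrow> h \<le> e \<Longrightarrow> \<gamma> h \<in> X"
    "(\<gamma> has_vector_derivative u) (at 0 within {0..e})" by (rule velocitiesE) (rule that)
  have sub: "\<gamma> ` {0..e} \<subseteq> X" using g(3) by auto
  have f': "((f \<circ> \<gamma>) has_vector_derivative D u) (at 0 within {0..e})"
    using has_derivative_subset[OF D sub] g(2) by (intro vector_derivative_diff_chain_within[OF g(4)]) simp
  have g': "((g \<circ> \<gamma>) has_vector_derivative E u) (at 0 within {0..e})"
    using has_derivative_subset[OF E sub] g(2) by (intro vector_derivative_diff_chain_within[OF g(4)]) simp
  have "((f \<circ> \<gamma>) has_vector_derivative E u) (at 0 within {0..e})"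
    by (rule has_vector_derivative_transform[OF _ _ g']) (use g(1,3) eq in auto)
  with f' show "D u = E u"
    using vector_derivative_unique_within_closed_interval[of 0 e 0 "f \<circ> \<gamma>"] g(1) by simp
qed

text \<open>From any point, even a corner, one may move in each direction \<open>b\<close> of
  \<open>B\<close> without leaving the orthant, so the velocities contain a basis. Conversely the
  coordinates outside \<open>B\<close> vanish on the orthant, hence so do their derivatives.\<close>

lemma tangents_orthant:
  fixes B :: "'a::euclidean_space set"
  assumes B: "B \<subseteq> Basis" and W: "openin (top_of_set (orthant B)) W" and w: "w \<in> W"
  shows "tangents W w = span B"
proof -
  have wB: "w \<in> orthant B" using W w openin_imp_subset by blast
  have "tangents W w = tangents (orthant B) w" using W w by (rule tangents_openin)
  also have "\<dots> = span B"
  proof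
    have "velocities (orthant B) w \<subseteq> span B"
    proof
      fix u assume u: "u \<in> velocities (orthant B) w"
      have "u \<bullet> c = 0" if c: "c \<in> Basis" "c \<notin> B" for c
      proof (rule derivative_unique_on_tangents[where f="\<lambda>x. x \<bullet> c" and g="\<lambda>x. 0" and D="\<lambda>x. x \<bullet> c" and E="\<lambda>x. 0"])
        show "((\<lambda>x. x \<bullet> c) has_derivative (\<lambda>x. x \<bullet> c)) (at w within orthant B)"
          by (intro bounded_linear_imp_has_derivative bounded_linear_inner_left)
        show "((\<lambda>x. 0) has_derivative (\<lambda>x. 0)) (at w within orthant B)" by simp
        show "x \<bullet> c = 0" if "x \<in> orthant B" for x
          using that c span_substd_basis[OF B] by (auto simp: orthant_def)
        show "u \<in> tangents (orthant B) w" using u by (auto simp: tangents_def intro: span_base)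
      qed
      then show "u \<in> span B" using span_substd_basis[OF B] by auto
    qed
    then show "tangents (orthant B) w \<subseteq> span B"
      unfolding tangents_def using span_minimal subspace_span by blast
    have "B \<subseteq> velocities (orthant B) w"
    proof
      fix b assume b: "b \<in> B"
      show "b \<in> velocities (orthant B) w"
      proof (rule velocitiesI[of 1 "\<lambda>h. w + h *\<^sub>R b"])
        show "w + h *\<^sub>R b \<in> orthant B" if "0 \<le> h" "h \<le> 1" for h
        proof -
          have "w + h *\<^sub>R b \<in> span B"
            using wB b by (intro span_add span_scale) (auto simp: orthant_def intro: span_base)
          then show ?thesis
            using wB b B that by (auto simp: orthant_def inner_Basis inner_add_left subset_iff)
        qed
        show "((\<lambda>h. w + h *\<^sub>R b) has_vector_derivative b) (at 0 within {0..1})"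
          by (auto intro!: derivative_eq_intros)
      qed auto
    qed
    then show "span B \<subseteq> tangents (orthant B) w"
      unfolding tangents_def by (rule span_mono)
  qed
  finally show ?thesis .
qed

section \<open>Tangent vectors of products, charts and regular points\<close>

lemma Pair_0_in_tangents:
  fixes T :: "real set"
  assumes "u \<in> tangents X x" "t \<in> T"
  shows "(u, 0) \<in> tangents (X \<times> T) (x, t)"
proof -
  have "(\<lambda>u. (u, 0 :: real)) ` tangents X x \<subseteq> tangents (X \<times> T) ((\<lambda>y. (y, t)) x)"
    by (rule tangents_image) (use assms(2) in \<open>auto intro!: derivative_eq_intros\<close>)
  then show ?thesis using assms(1) by auto
qed

text \<open>Only a curve forward in time is available, since \<open>t\<close> may be the endpoint of
  \<open>T = {0..}\<close>; scaling then gives every \<open>s\<close>, also negative ones.\<close>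

lemma Pair_1_in_tangents:
  fixes T :: "real set"
  assumes "x \<in> X" "t \<in> T" "{t..} \<subseteq> T"
  shows "(0, s) \<in> tangents (X \<times> T) (x, t)"
proof -
  have "(0, 1) \<in> velocities (X \<times> T) (x, t)"
    by (rule velocitiesI[of 1 "\<lambda>h. (x, t + h)"])
      (use assms in \<open>auto intro!: derivative_eq_intros simp: has_vector_derivative_def\<close>)
  then have "s *\<^sub>R (0, 1) \<in> tangents (X \<times> T) (x, t)"
    unfolding tangents_def by (intro span_scale span_base)
  then show ?thesis by simp
qed

lemma tangents_Times:
  fixes T :: "real set"
  assumes "u \<in> tangents X x" "x \<in> X" "t \<in> T" "{t..} \<subseteq> T"
  shows "(u, s) \<in> tangents (X \<times> T) (x, t)"
proof -
  have "(u, 0) + (0, s) \<in> tangents (X \<times> T) (x, t)"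
    unfolding tangents_def using Pair_0_in_tangents[OF assms(1,3)] Pair_1_in_tangents[OF assms(2-4)]
    by (intro span_add) (simp_all add: tangents_def)
  then show ?thesis by simp
qed

text \<open>The chain rule for \<open>\<psi>\<close> after \<open>\<phi>\<close> and for
  \<open>\<phi>\<close> after \<open>\<psi>\<close>, read along tangent directions only, makes the
  two derivatives inverse to each other between \<open>span B\<close> and the tangent vectors of
  \<open>X\<close>.\<close>

lemma chart_tangents:
  fixes X :: "'a::euclidean_space set"
  assumes c: "local_param k X B W \<phi>" and w: "w \<in> W"
    and D: "(\<phi> has_derivative D) (at w within W)"
  shows "tangents X (\<phi> w) = D ` span B" "inj_on D (span B)"
proof -
  obtain \<psi> where p: "B \<subseteq> Basis" "card B = k" "\<phi> ` W \<subseteq> X" "openin (top_of_set (orthant B)) W" "openin (top_of_set X) (\<phi> ` W)"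
    "homeomorphism W (\<phi> ` W) \<phi> \<psi>" "C1_on W \<phi>" "C1_on (\<phi> ` W) \<psi>"
    by (rule local_paramE[OF c]) (rule that)
  have x: "\<phi> w \<in> \<phi> ` W" using w by auto
  have tw: "tangents W w = span B" using p(1,4) w by (rule tangents_orthant)
  have tx: "tangents (\<phi> ` W) (\<phi> w) = tangents X (\<phi> w)" using p(5) x by (rule tangents_openin)
  obtain E where E: "(\<psi> has_derivative E) (at (\<phi> w) within \<phi> ` W)"
    using C1_on_has_derivative[OF p(8) x] by blast
  have \<psi>\<phi>: "\<psi> (\<phi> y) = y" if "y \<in> W" for y using p(6) that by (simp add: homeomorphism_def)
  have \<phi>\<psi>: "\<phi> (\<psi> y) = y" if "y \<in> \<phi> ` W" for y using \<psi>\<phi> that by auto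
  have img: "\<psi> ` \<phi> ` W = W" using \<psi>\<phi> by force
  have D1: "D ` span B \<subseteq> tangents X (\<phi> w)"
    using tangents_image[OF D subset_refl] unfolding tw tx .
  have "E ` tangents (\<phi> ` W) (\<phi> w) \<subseteq> tangents W (\<psi> (\<phi> w))"
    by (rule tangents_image[OF E]) (simp add: img)
  then have E1: "E u \<in> span B" if "u \<in> tangents X (\<phi> w)" for u
    using that unfolding tx \<psi>\<phi>[OF w] tw by auto
  have DE: "D (E u) = u" if u: "u \<in> tangents X (\<phi> w)" for u
  proof (rule derivative_unique_on_tangents)
    have "(\<phi> has_derivative D) (at (\<psi> (\<phi> w)) within \<psi> ` \<phi> ` W)"
      unfolding img \<psi>\<phi>[OF w] by (rule D)
    from diff_chain_within[OF E this]
    show "((\<lambda>y. \<phi> (\<psi> y)) has_derivative (\<lambda>u. D (E u))) (at (\<phi> w) within \<phi> ` W)" by (simp add: o_def)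
    show "((\<lambda>y. y) has_derivative (\<lambda>u. u)) (at (\<phi> w) within \<phi> ` W)" by simp
  qed (use u tx \<phi>\<psi> in auto)
  have ED: "E (D u) = u" if u: "u \<in> span B" for u
  proof (rule derivative_unique_on_tangents)
    from diff_chain_within[OF D E]
    show "((\<lambda>y. \<psi> (\<phi> y)) has_derivative (\<lambda>u. E (D u))) (at w within W)" by (simp add: o_def)
    show "((\<lambda>y. y) has_derivative (\<lambda>u. u)) (at w within W)" by simp
  qed (use u tw \<psi>\<phi> in auto)
  show "inj_on D (span B)" using ED by (metis inj_on_def)
  have "u \<in> D ` span B" if "u \<in> tangents X (\<phi> w)" for u
    using DE[OF that] E1[OF that] by (metis imageI)
  then show "tangents X (\<phi> w) = D ` span B" using D1 by blast
qed

lemma tangent_space_subset_tangents: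
  fixes X :: "'a::euclidean_space set"
  shows "tangent_space k X x \<subseteq> tangents X x"
proof
  fix u assume "u \<in> tangent_space k X x"
  then obtain B' W' \<phi>' w' D' v where "local_param k X B' W' \<phi>'" "w' \<in> W'" "\<phi>' w' = x"
    "(\<phi>' has_derivative D') (at w' within W')" "v \<in> span B'" "u = D' v"
    unfolding tangent_space_def pushforward_def by blast
  with chart_tangents(1)[of k X B' W' \<phi>' w' D'] show "u \<in> tangents X x" by auto
qed

text \<open>Every chart through \<open>x\<close> yields the same subspace, the span of the
  velocities, so the union over charts in \<open>tangent_space\<close> is a linear space of the
  right dimension.\<close>

lemma tangent_space_eq_tangents:
  fixes X :: "'a::euclidean_space set"
  assumes "x \<in> regular_points k X"
  shows "tangent_space k X x = tangents X x" "dim (tangents X x) = k"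
proof -
  obtain B W \<phi> w where c: "local_param k X B W \<phi>" "w \<in> W" "x = \<phi> w"
    using assms unfolding regular_points_def by blast
  obtain \<psi> where p: "B \<subseteq> Basis" "card B = k" "C1_on W \<phi>"
    by (rule local_paramE[OF c(1)]) (rule that)
  obtain D where D: "(\<phi> has_derivative D) (at w within W)"
    using C1_on_has_derivative[OF p(3) c(2)] by blast
  note t = chart_tangents[OF c(1,2) D]
  show "tangent_space k X x = tangents X x"
  proof
    show "tangents X x \<subseteq> tangent_space k X x"
      unfolding c(3) t(1) tangent_space_def pushforward_def using c D by blast
  qed (rule tangent_space_subset_tangents)
  have "dim (D ` span B) = dim (span B)"
    using t(2) by (intro dim_image_eq has_derivative_linear[OF D]) (simp add: span_span)
  also have "\<dots> = k"
    using p independent_substdbasis[OF p(1)] by (simp add: dim_span dim_eq_card_independent)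
  finally show "dim (tangents X x) = k" using t(1) c(3) by simp
qed

text \<open>A nonzero kernel vector can be extended to a basis of \<open>L\<close>; the remaining
  \<open>dim L - 1\<close> basis vectors then span the image, which is too small to contain
  \<open>T\<close>.\<close>

lemma inj_on_if_dim_le:
  fixes D :: "'a::euclidean_space \<Rightarrow> 'b::euclidean_space"
  assumes D: "linear D" and L: "subspace L" and T: "T \<subseteq> D ` L" and dim: "dim L \<le> dim T"
    and v: "v \<in> L" "D v = 0"
  shows "v = 0"
proof (rule ccontr)
  assume "v \<noteq> 0"
  then have "independent {v}" by simp
  then obtain B where B: "{v} \<subseteq> B" "B \<subseteq> L" "independent B" "L \<subseteq> span B"
    using v(1) maximal_independent_subset_extend[of "{v}" L] by auto
  have fin: "finite B" using B(3) by (rule independent_imp_finite)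
  have card: "card B = dim L" using B(2-4) by (intro basis_card_eq_dim) auto
  have "D ` B \<subseteq> insert 0 (D ` (B - {v}))" using v(2) by auto
  then have "span (D ` B) \<subseteq> span (insert 0 (D ` (B - {v})))" by (rule span_mono)
  moreover have "T \<subseteq> span (D ` B)"
    using T B(4) linear_span_image[OF D, of B] by auto
  ultimately have "T \<subseteq> span (D ` (B - {v}))" by (simp add: span_insert_0)
  then have "dim T \<le> card (D ` (B - {v}))" using fin by (intro dim_le_card) auto
  also have "\<dots> \<le> card (B - {v})" using fin by (intro card_image_le) auto
  also have "\<dots> < card B" using fin B(1) by (intro psubset_card_mono) auto
  finally show False using dim card by simp
qed

text \<open>An injective linear map on \<open>L\<close> is bounded below by some \<open>c\<close>.
  Near \<open>x\<close> the extension \<open>g\<close> minus its linear part has Lipschitz constant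
  at most \<open>c / 2\<close>, so half of the bound survives. Differences of points of
  \<open>S\<close> lie in \<open>L\<close>, which is where the linear bound holds; \<open>S\<close>
  need not be open in \<open>L\<close>.\<close>

lemma C1_on_lower_lipschitz:
  fixes f :: "'a::euclidean_space \<Rightarrow> 'b::euclidean_space"
  assumes f: "C1_on S f" and x: "x \<in> S" and L: "subspace L" "S \<subseteq> L" "L \<subseteq> tangents S x"
    and D: "(f has_derivative D) (at x within S)" and inj: "\<And>v. v \<in> L \<Longrightarrow> D v = 0 \<Longrightarrow> v = 0"
  shows "\<exists>U c. open U \<and> x \<in> U \<and> 0 < c \<and> (\<forall>a\<in>S \<inter> U. \<forall>b\<in>S \<inter> U. c * dist a b \<le> dist (f a) (f b))"
proof -
  obtain U g and g' :: "'a \<Rightarrow> 'a \<Rightarrow>\<^sub>L 'b" where U: "open U" "x \<in> U" "\<And>y. y \<in> S \<Longrightarrow> y \<in> U \<Longrightarrow> g y = f y"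
    "\<And>y. y \<in> U \<Longrightarrow> (g has_derivative blinfun_apply (g' y)) (at y)" "continuous_on U g'"
    by (rule C1_onE[OF f x]) (rule that)
  have Dg: "D v = g' x v" if v: "v \<in> L" for v
  proof (rule derivative_unique_on_tangents[where f=f and g=g and D=D and E="blinfun_apply (g' x)"])
    show "(f has_derivative D) (at x within S \<inter> U)"
      by (rule has_derivative_subset[OF D]) auto
    show "(g has_derivative blinfun_apply (g' x)) (at x within S \<inter> U)"
      by (rule has_derivative_at_withinI[OF U(4)[OF U(2)]])
    show "v \<in> tangents (S \<inter> U) x" using v L(3) tangents_local[OF U(1,2)] by auto
  qed (use U(3) in auto)
  obtain c where c: "0 < c" "\<And>v. v \<in> L \<Longrightarrow> c * norm v \<le> norm (g' x v)"
    using injective_imp_isometric[OF closed_subspace[OF L(1)] L(1) blinfun.bounded_linear_right[of "g' x"]]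
      Dg inj by (metis mult.commute)
  have "isCont g' x" using U(1,2,5) by (simp add: continuous_on_eq_continuous_at)
  then obtain e where e: "0 < e" "\<And>y. dist y x < e \<Longrightarrow> dist (g' y) (g' x) < c / 2"
    unfolding continuous_at_eps_delta using c(1) by (meson half_gt_zero)
  obtain e' where e': "0 < e'" "ball x e' \<subseteq> U" using open_contains_ball_eq[OF U(1)] U(2) by auto
  let ?V = "ball x (min e e')"
  have "c / 2 * dist a b \<le> dist (f a) (f b)" if ab: "a \<in> S \<inter> ?V" "b \<in> S \<inter> ?V" for a b
  proof -
    have "norm ((g a - g' x a) - (g b - g' x b)) \<le> c / 2 * norm (a - b)"
    proof (rule differentiable_bound)
      show "convex ?V" by simp
      fix y assume y: "y \<in> ?V"
      have "((\<lambda>y. g y - g' x y) has_derivative blinfun_apply (g' y - g' x)) (at y)"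
        using has_derivative_diff[OF U(4)[of y] bounded_linear_imp_has_derivative[OF blinfun.bounded_linear_right[of "g' x"]]]
          y e'(2) by (auto simp: minus_blinfun.rep_eq)
      then show "((\<lambda>y. g y - g' x y) has_derivative blinfun_apply (g' y - g' x)) (at y within ?V)"
        by (rule has_derivative_at_withinI)
      show "onorm (blinfun_apply (g' y - g' x)) \<le> c / 2"
        using e(2)[of y] y by (simp add: norm_blinfun.rep_eq[symmetric] dist_norm[symmetric] dist_commute)
    qed (use ab in auto)
    moreover have "c * norm (a - b) \<le> norm (g' x (a - b))"
      using c(2) ab L(1,2) by (auto intro: subspace_diff)
    moreover have "norm (g' x (a - b)) \<le> norm (g a - g b) + norm ((g a - g' x a) - (g b - g' x b))"
    proof -
      have "g' x (a - b) = (g a - g b) - ((g a - g' x a) - (g b - g' x b))"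
        by (simp add: blinfun.diff_right)
      then show ?thesis by (metis norm_triangle_ineq4)
    qed
    moreover have "g a = f a" "g b = f b" using ab e'(2) by (auto intro!: U(3))
    ultimately show ?thesis by (simp add: dist_norm)
  qed
  then show ?thesis
    using e(1) e'(1) c(1) by (intro exI[of _ ?V] exI[of _ "c / 2"]) auto
qed

section \<open>The map from the backward orbit of M to the base\<close>

locale backward_flow =
  fixes \<Psi> M :: "'a::euclidean_space set" and Z :: "'b::euclidean_space set"
    and b :: "real \<Rightarrow> 'a \<Rightarrow> 'a" and \<Omega> :: "('a \<times> real) set" and q :: "'a \<Rightarrow> 'b"
    and d k :: nat
  assumes flow: "piecewise_flow (d + k) \<Psi> \<Omega> b"
    and fibr: "fibration d k \<Psi> Z q"
    and d_pos: "1 \<le> d"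
    and M_sub: "M \<subseteq> \<Psi>"
    and transv: "backward_orbit_transversal (d + k) k (d - 1) \<Psi> q M \<Omega> b"
begin

definition F :: "'a \<times> real \<Rightarrow> 'b" where
  "F p = q (b (- snd p) (fst p))"

definition P :: "('a \<times> real) set" where
  "P = {p \<in> M \<times> {0..}. (fst p, - snd p) \<in> \<Omega>}"

abbreviation R\<Psi> :: "'a set" where "R\<Psi> \<equiv> regular_points (d + k) \<Psi>"

lemma openin_\<Omega>: "openin (top_of_set (\<Psi> \<times> UNIV)) \<Omega>"
  and \<Omega>_regular: "(x, t) \<in> \<Omega> \<Longrightarrow> x \<in> R\<Psi>"
  and C1_b: "C1_on \<Omega> (\<lambda>(x, t). b t x)"
  and b_0: "(x, 0) \<in> \<Omega> \<Longrightarrow> b 0 x = x"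
  and \<Omega>_reverse: "(x, t) \<in> \<Omega> \<Longrightarrow> (b t x, - t) \<in> \<Omega>"
  using flow unfolding piecewise_flow_def by auto

lemma b_inverse: assumes "(x, t) \<in> \<Omega>" shows "b (- t) (b t x) = x"
proof -
  have "(x, - t + t) \<in> \<Omega> \<and> b (- t + t) x = b (- t) (b t x)"
    using flow \<Omega>_reverse[OF assms] assms unfolding piecewise_flow_def by blast
  then have "(x, 0) \<in> \<Omega>" "b 0 x = b (- t) (b t x)" by simp_all
  with b_0[of x] show ?thesis by simp
qed

lemma b_regular: "(x, t) \<in> \<Omega> \<Longrightarrow> b t x \<in> R\<Psi>"
  using \<Omega>_reverse \<Omega>_regular by blast

lemma regular_openin: "openin (top_of_set \<Psi>) R\<Psi>"
  by (rule openin_regular_points)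

lemma regular_in: "x \<in> R\<Psi> \<Longrightarrow> x \<in> \<Psi>"
  using regular_points_subset by blast

lemma cont_q: "continuous_on \<Psi> q" and q_in: "x \<in> \<Psi> \<Longrightarrow> q x \<in> Z"
  using fibr unfolding fibration_def by auto

lemma trivializationE:
  assumes "x \<in> R\<Psi>"
  obtains U h g where "openin (top_of_set Z) U" "q x \<in> U"
    "diffeomorphism (R\<Psi> \<inter> q -` U) ((U \<inter> regular_points d Z) \<times> regular_points k (fiber \<Psi> q (q x)))
       (\<lambda>x. (q x, h x)) g"
proof -
  have "q x \<in> Z" using assms regular_in q_in by blast
  then have "\<exists>U h g. openin (top_of_set Z) U \<and> q x \<in> U \<and>
          homeomorphism (\<Psi> \<inter> q -` U) (U \<times> fiber \<Psi> q (q x)) (\<lambda>x. (q x, h x)) g \<and>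
          diffeomorphism (R\<Psi> \<inter> q -` U)
            ((U \<inter> regular_points d Z) \<times> regular_points k (fiber \<Psi> q (q x))) (\<lambda>x. (q x, h x)) g"
    using fibr unfolding fibration_def by simp
  then show thesis by (elim exE conjE) (rule that)
qed

text \<open>A fibration is a priori only continuous; over the regular points \<open>q\<close> is the
  first component of a trivialization that is a diffeomorphism.\<close>

lemma C1_q: "C1_on R\<Psi> q"
proof (rule C1_on_local)
  fix x assume x: "x \<in> R\<Psi>"
  obtain U h g where U: "openin (top_of_set Z) U" "q x \<in> U"
    "diffeomorphism (R\<Psi> \<inter> q -` U) ((U \<inter> regular_points d Z) \<times> regular_points k (fiber \<Psi> q (q x)))
       (\<lambda>x. (q x, h x)) g" by (rule trivializationE[OF x]) (rule that)
  have "openin (top_of_set \<Psi>) (\<Psi> \<inter> q -` U)"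
    using cont_q U(1) q_in by (intro continuous_openin_preimage[of _ _ Z]) auto
  then obtain T where T: "open T" "\<Psi> \<inter> q -` U = \<Psi> \<inter> T"
    unfolding openin_open by auto
  have eq: "R\<Psi> \<inter> T = R\<Psi> \<inter> q -` U" using T(2) regular_in by blast
  have "C1_on (R\<Psi> \<inter> q -` U) (\<lambda>x. fst (q x, h x))"
  proof (rule C1_on_compose[OF _ C1_on_bounded_linear[OF bounded_linear_fst]])
    show "C1_on (R\<Psi> \<inter> q -` U) (\<lambda>x. (q x, h x))" using U(3) by (simp add: diffeomorphism_def)
    show "(\<lambda>x. (q x, h x)) ` (R\<Psi> \<inter> q -` U) \<subseteq> UNIV" by simp
  qed
  then have "C1_on (R\<Psi> \<inter> T) q" unfolding eq by simp
  moreover have "x \<in> T" using x U(2) eq by auto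
  ultimately show "\<exists>T. open T \<and> x \<in> T \<and> C1_on (R\<Psi> \<inter> T) q" using T(1) by blast
qed

lemma P_in_\<Omega>: "p \<in> P \<Longrightarrow> (fst p, - snd p) \<in> \<Omega>"
  by (simp add: P_def)

lemma openin_P: "openin (top_of_set (M \<times> {0..})) P"
proof -
  obtain O' where O': "open O'" "\<Omega> = (\<Psi> \<times> UNIV) \<inter> O'"
    using openin_\<Omega> unfolding openin_open by auto
  have mem: "(x, t) \<in> \<Omega> \<longleftrightarrow> x \<in> \<Psi> \<and> (x, t) \<in> O'" for x t using O'(2) by blast
  have "P = (M \<times> {0..}) \<inter> (\<lambda>p. (fst p, - snd p)) -` O'"
    using M_sub mem by (auto simp: P_def)
  moreover have "open ((\<lambda>p::'a \<times> real. (fst p, - snd p)) -` O')"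
    by (rule open_vimage[OF O'(1)]) (intro continuous_intros)
  ultimately show ?thesis unfolding openin_open by blast
qed

lemma C1_orbit: "C1_on P (\<lambda>p. b (- snd p) (fst p))"
proof -
  have "C1_on P (\<lambda>p. (fst p, - snd p))"
    by (intro C1_on_bounded_linear bounded_linear_Pair bounded_linear_fst bounded_linear_minus bounded_linear_snd)
  then have "C1_on P (\<lambda>p. (\<lambda>(x, t). b t x) (fst p, - snd p))"
    by (rule C1_on_compose[OF _ C1_b]) (auto intro: P_in_\<Omega>)
  then show ?thesis by simp
qed

lemma C1_F: "C1_on P F"
  unfolding F_def[abs_def]
  by (rule C1_on_compose[OF C1_orbit C1_q]) (auto dest: P_in_\<Omega> b_regular)

lemma F_in_Z: "p \<in> P \<Longrightarrow> F p \<in> Z"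
  unfolding F_def using P_in_\<Omega> b_regular regular_in q_in by blast

lemma tangents_regular: "x \<in> R\<Psi> \<Longrightarrow> tangents R\<Psi> x = tangents \<Psi> x"
  by (rule tangents_openin[OF regular_openin])

text \<open>A local section of the fibration through \<open>x\<close> lifts tangent vectors of the base.\<close>

lemma q_submersion:
  assumes x: "x \<in> R\<Psi>" and Dq: "(q has_derivative Dq) (at x within R\<Psi>)"
  shows "q x \<in> regular_points d Z" "tangents Z (q x) \<subseteq> Dq ` tangents \<Psi> x"
proof -
  let ?z = "q x"
  obtain U h g where U: "openin (top_of_set Z) U" "?z \<in> U"
    "diffeomorphism (R\<Psi> \<inter> q -` U) ((U \<inter> regular_points d Z) \<times> regular_points k (fiber \<Psi> q ?z))
       (\<lambda>x. (q x, h x)) g" by (rule trivializationE[OF x]) (rule that)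
  let ?S = "R\<Psi> \<inter> q -` U" and ?V = "U \<inter> regular_points d Z" and ?R = "regular_points k (fiber \<Psi> q ?z)"
  have hom: "homeomorphism ?S (?V \<times> ?R) (\<lambda>x. (q x, h x)) g" and g: "C1_on (?V \<times> ?R) g"
    using U(3) by (auto simp: diffeomorphism_def)
  have xS: "x \<in> ?S" using x U(2) by auto
  then have "(?z, h x) \<in> ?V \<times> ?R" using hom by (auto simp: homeomorphism_def)
  then have zV: "?z \<in> ?V" and y: "h x \<in> ?R" by auto
  then show "?z \<in> regular_points d Z" by simp
  have "openin (top_of_set Z) ?V" using U(1) openin_regular_points by (rule openin_Int)
  then have tV: "tangents ?V ?z = tangents Z ?z" using zV by (rule tangents_openin)
  let ?\<sigma> = "\<lambda>z. g (z, h x)"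
  have \<sigma>: "\<exists>D. (?\<sigma> has_derivative D) (at ?z within ?V)"
  proof -
    obtain D where D: "(g has_derivative D) (at (?z, h x) within ?V \<times> ?R)"
      using C1_on_has_derivative[OF g] zV y by blast
    have "(\<lambda>z. (z, h x)) ` ?V \<subseteq> ?V \<times> ?R" using y by auto
    then have "(g has_derivative D) (at ((\<lambda>z. (z, h x)) ?z) within (\<lambda>z. (z, h x)) ` ?V)"
      using has_derivative_subset[OF D] by simp
    moreover have "((\<lambda>z. (z, h x)) has_derivative (\<lambda>v. (v, 0))) (at ?z within ?V)"
      by (auto intro!: derivative_eq_intros)
    ultimately have "(g \<circ> (\<lambda>z. (z, h x)) has_derivative D \<circ> (\<lambda>v. (v, 0))) (at ?z within ?V)"
      by (intro diff_chain_within)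
    then show ?thesis by (auto simp: o_def)
  qed
  then obtain D\<sigma> where D\<sigma>: "(?\<sigma> has_derivative D\<sigma>) (at ?z within ?V)" by blast
  have \<sigma>S: "?\<sigma> z \<in> ?S" if "z \<in> ?V" for z
  proof -
    have "g ` (?V \<times> ?R) = ?S" using hom by (simp add: homeomorphism_def)
    then show ?thesis using that y by blast
  qed
  have q\<sigma>: "q (?\<sigma> z) = z" if "z \<in> ?V" for z
  proof -
    have "(q (g (z, h x)), h (g (z, h x))) = (z, h x)"
      using hom that y unfolding homeomorphism_def by blast
    then show ?thesis by simp
  qed
  have \<sigma>z: "?\<sigma> ?z = x" using hom xS by (auto simp: homeomorphism_def)
  have "D\<sigma> ` tangents ?V ?z \<subseteq> tangents R\<Psi> (?\<sigma> ?z)"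
    by (rule tangents_image[OF D\<sigma>]) (use \<sigma>S in auto)
  then have D\<sigma>1: "D\<sigma> e \<in> tangents \<Psi> x" if "e \<in> tangents Z ?z" for e
    using that unfolding tV \<sigma>z tangents_regular[OF x] by auto
  have "(q has_derivative Dq) (at (?\<sigma> ?z) within ?\<sigma> ` ?V)"
    unfolding \<sigma>z by (rule has_derivative_subset[OF Dq]) (use \<sigma>S in auto)
  then have qs: "((\<lambda>z. q (?\<sigma> z)) has_derivative (\<lambda>e. Dq (D\<sigma> e))) (at ?z within ?V)"
    using diff_chain_within[OF D\<sigma>] by (simp add: o_def)
  have "Dq (D\<sigma> e) = e" if e: "e \<in> tangents Z ?z" for e
    by (rule derivative_unique_on_tangents[OF qs has_derivative_ident]) (use q\<sigma> e tV in auto)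
  then show "tangents Z ?z \<subseteq> Dq ` tangents \<Psi> x"
    using D\<sigma>1 by (metis imageI subsetI)
qed

text \<open>\<open>q\<close> is constant along the fibre. The fibre is first cut down to an open set
  where it consists of regular points, because \<open>Dq\<close> is a derivative within
  those.\<close>

lemma q_derivative_fiber:
  assumes x: "x \<in> R\<Psi>" and Dq: "(q has_derivative Dq) (at x within R\<Psi>)"
    and v: "v \<in> tangents (fiber \<Psi> q (q x)) x"
  shows "Dq v = 0"
proof -
  let ?R = "fiber \<Psi> q (q x)"
  obtain T where T: "open T" "R\<Psi> = \<Psi> \<inter> T" using regular_openin unfolding openin_open by auto
  have sub: "?R \<inter> T \<subseteq> R\<Psi>" using T(2) by (auto simp: fiber_def)
  have "x \<in> T" using x T(2) by auto
  then have v': "v \<in> tangents (?R \<inter> T) x" using v tangents_local[OF T(1)] by simp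
  show ?thesis
    by (rule derivative_unique_on_tangents[OF has_derivative_subset[OF Dq sub] has_derivative_const _ v', of "q x"])
      (auto simp: fiber_def)
qed

lemma F_derivative:
  assumes p: "p \<in> P" and Dq: "(q has_derivative Dq) (at (b (- snd p) (fst p)) within R\<Psi>)"
    and Db: "((\<lambda>(x, t). b t x) has_derivative Db) (at (fst p, - snd p) within \<Omega>)"
  shows "(F has_derivative (\<lambda>v. Dq (Db (fst v, - snd v)))) (at p within P)"
proof -
  let ?N = "\<lambda>p::'a \<times> real. (fst p, - snd p)" and ?\<beta> = "\<lambda>(x, t). b t x"
  have N: "(?N has_derivative ?N) (at p within P)"
    by (auto intro!: derivative_eq_intros)
  have "(?\<beta> has_derivative Db) (at (?N p) within ?N ` P)"
    by (rule has_derivative_subset[OF Db]) (auto intro: P_in_\<Omega>)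
  from diff_chain_within[OF N this]
  have bN: "(?\<beta> \<circ> ?N has_derivative Db \<circ> ?N) (at p within P)" .
  have "(?\<beta> \<circ> ?N) ` P \<subseteq> R\<Psi>" by (auto dest: P_in_\<Omega> b_regular)
  then have "(q has_derivative Dq) (at ((?\<beta> \<circ> ?N) p) within (?\<beta> \<circ> ?N) ` P)"
    using has_derivative_subset[OF Dq] by simp
  from diff_chain_within[OF bN this] show ?thesis
    by (simp add: o_def F_def[abs_def])
qed

text \<open>\<open>Dq\<close> kills the tangent vectors of the fibre and is onto the tangent space
  of \<open>Z\<close>, so by transversality the tangent vectors of the sheet alone already map onto
  it. Their parameters form a space of dimension \<open>(d - 1) + 1 = d\<close>, so there is no
  kernel left.\<close>

lemma F_derivative_injective:
  assumes p: "p \<in> P" "fst p \<in> regular_points (d - 1) M"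
    and Dq: "(q has_derivative Dq) (at (b (- snd p) (fst p)) within R\<Psi>)"
    and Db: "((\<lambda>(x, t). b t x) has_derivative Db) (at (fst p, - snd p) within \<Omega>)"
    and v: "v \<in> tangents M (fst p) \<times> UNIV" "Dq (Db (fst v, - snd v)) = 0"
  shows "v = 0"
proof -
  obtain m t where mt: "p = (m, t)" by (cases p)
  let ?x = "b (- t) m" and ?L = "tangents M m \<times> (UNIV :: real set)"
  have \<Omega>: "(m, - t) \<in> \<Omega>" using P_in_\<Omega>[OF p(1)] mt by simp
  have t: "0 \<le> t" and m: "m \<in> M" using p(1) mt by (auto simp: P_def)
  have x: "?x \<in> R\<Psi>" using b_regular[OF \<Omega>] .
  have Dq': "(q has_derivative Dq) (at ?x within R\<Psi>)" using Dq mt by simp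
  have Db': "((\<lambda>(x, t). b t x) has_derivative Db) (at (m, - t) within \<Omega>)" using Db mt by simp
  have m_reg: "m \<in> regular_points (d - 1) M" using p(2) mt by simp
  have lin: "linear (\<lambda>v. Dq (Db (fst v, - snd v)))"
    using has_derivative_linear[OF F_derivative[OF p(1) Dq Db]] .
  have sub: "subspace ?L" unfolding tangents_def by (intro subspace_Times subspace_span subspace_UNIV)
  have tang: "(\<tau>, s) \<in> tangents \<Omega> (m, - t)" if "\<tau> \<in> tangents M m" for \<tau> s
  proof -
    have "(\<tau>, s) \<in> tangents (M \<times> UNIV) (m, - t)" using that m by (intro tangents_Times) auto
    also have "\<dots> \<subseteq> tangents (\<Psi> \<times> UNIV) (m, - t)" using M_sub by (intro tangents_mono) auto
    also have "\<dots> = tangents \<Omega> (m, - t)" using tangents_openin[OF openin_\<Omega> \<Omega>] by simp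
    finally show ?thesis .
  qed
  have "tangents Z (q ?x) \<subseteq> (\<lambda>v. Dq (Db (fst v, - snd v))) ` ?L"
  proof
    fix e assume "e \<in> tangents Z (q ?x)"
    then obtain u where u: "u \<in> tangents \<Psi> ?x" "e = Dq u"
      using q_submersion(2)[OF x Dq'] by auto
    have "u \<in> tangent_space (d + k) \<Psi> ?x" using u(1) tangent_space_eq_tangents(1)[OF x] by simp
    moreover have "{u + v |u v. u \<in> sheet_tangent (d - 1) M \<Omega> b m (- t) \<and>
        v \<in> tangent_space k (fiber \<Psi> q (q ?x)) ?x} = tangent_space (d + k) \<Psi> ?x"
      using transv m_reg t \<Omega> unfolding backward_orbit_transversal_def by simp
    ultimately obtain u1 v1 where u1: "u1 \<in> sheet_tangent (d - 1) M \<Omega> b m (- t)"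
      "v1 \<in> tangent_space k (fiber \<Psi> q (q ?x)) ?x" "u = u1 + v1" by blast
    from u1(1) obtain D \<tau> s where D: "((\<lambda>(y, s). b s y) has_derivative D) (at (m, - t) within \<Omega>)"
      "\<tau> \<in> tangent_space (d - 1) M m" "u1 = D (\<tau>, s)"
      unfolding sheet_tangent_def pushforward_def by blast
    have \<tau>: "\<tau> \<in> tangents M m" using D(2) tangent_space_subset_tangents by blast
    \<comment> \<open>\<open>pushforward\<close> allows any derivative within
      \<open>\<Omega>\<close>, so \<open>D\<close> may differ from \<open>Db\<close>; they agree on
      vectors tangent to \<open>\<Omega>\<close>.\<close>
    have "u1 = Db (\<tau>, s)"
      unfolding D(3) by (rule derivative_unique_on_tangents[OF D(1) Db' refl tang[OF \<tau>]])
    moreover have "Dq v1 = 0"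
      using q_derivative_fiber[OF x Dq'] u1(2) tangent_space_subset_tangents by blast
    ultimately have "e = Dq (Db (\<tau>, s))"
      using u(2) u1(3) linear_add[OF has_derivative_linear[OF Dq']] by simp
    \<comment> \<open>The sheet is parametrized by the flow time \<open>- t\<close>, the map
      \<open>F\<close> by \<open>t\<close>; hence the sign in the witness.\<close>
    then show "e \<in> (\<lambda>v. Dq (Db (fst v, - snd v))) ` ?L"
      using \<tau> by (intro image_eqI[of _ _ "(\<tau>, - s)"]) auto
  qed
  moreover have "dim ?L \<le> dim (tangents Z (q ?x))"
  proof -
    have "dim ?L = dim (tangents M m) + dim (UNIV :: real set)"
      by (intro dim_Times) (auto simp: tangents_def)
    also have "\<dots> = d" using tangent_space_eq_tangents(2)[OF m_reg] d_pos by simp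
    also have "\<dots> = dim (tangents Z (q ?x))"
      using tangent_space_eq_tangents(2)[OF q_submersion(1)[OF x Dq']] by simp
    finally show ?thesis by simp
  qed
  moreover have "v \<in> ?L" using v(1) mt by simp
  ultimately show ?thesis
    using inj_on_if_dim_le[OF lin sub] v(2) by blast
qed

text \<open>The lower bound for differentiable maps wants a domain inside a linear space on which
  the derivative is injective. A chart of \<open>M\<close> times the identity in time provides one,
  and its Lipschitz constant carries the estimate back to \<open>P\<close>.\<close>

lemma F_lower_lipschitz:
  assumes p: "p \<in> P" "fst p \<in> regular_points (d - 1) M"
  shows "\<exists>U c. open U \<and> p \<in> U \<and> 0 < c \<and> (\<forall>a\<in>P \<inter> U. \<forall>a'\<in>P \<inter> U. c * dist a a' \<le> dist (F a) (F a'))"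
proof -
  obtain m t where mt: "p = (m, t)" by (cases p)
  have \<Omega>: "(m, - t) \<in> \<Omega>" using P_in_\<Omega>[OF p(1)] mt by simp
  have t: "0 \<le> t" and m: "m \<in> M" using p(1) mt by (auto simp: P_def)
  have x: "b (- snd p) (fst p) \<in> R\<Psi>" using b_regular[OF \<Omega>] mt by simp
  obtain Dq where Dq: "(q has_derivative Dq) (at (b (- snd p) (fst p)) within R\<Psi>)"
    using C1_on_has_derivative[OF C1_q x] by blast
  obtain Db where Db: "((\<lambda>(x, t). b t x) has_derivative Db) (at (fst p, - snd p) within \<Omega>)"
    using C1_on_has_derivative[OF C1_b P_in_\<Omega>[OF p(1)]] by blast
  define DF where "DF v = Dq (Db (fst v, - snd v))" for v
  have DF: "(F has_derivative DF) (at p within P)"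
    using F_derivative[OF p(1) Dq Db] unfolding DF_def[abs_def] .
  have DF0: "v = 0" if "v \<in> tangents M m \<times> UNIV" "DF v = 0" for v
    using F_derivative_injective[OF p Dq Db, of v] that mt by (simp add: DF_def)
  obtain B W \<phi> w where c: "local_param (d - 1) M B W \<phi>" "w \<in> W" "m = \<phi> w"
    using p(2) mt unfolding regular_points_def by auto
  obtain \<psi> where \<phi>: "B \<subseteq> Basis" "W \<subseteq> span B" "\<phi> ` W \<subseteq> M" "openin (top_of_set (orthant B)) W" "openin (top_of_set M) (\<phi> ` W)"
    "homeomorphism W (\<phi> ` W) \<phi> \<psi>" "C1_on W \<phi>" "locally_lipschitz_on W \<phi>"
    by (rule local_paramE[OF c(1)]) (rule that)
  have \<psi>\<phi>: "\<psi> (\<phi> y) = y" if "y \<in> W" for y using \<phi>(6) that by (simp add: homeomorphism_def)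
  let ?\<Phi> = "\<lambda>p::'a \<times> real. (\<phi> (fst p), snd p)" and ?\<Psi> = "\<lambda>p::'a \<times> real. (\<psi> (fst p), snd p)"
  let ?L = "span B \<times> (UNIV :: real set)"
  define Dom where "Dom = {p \<in> W \<times> {0..}. ?\<Phi> p \<in> P}"
  have p0: "(w, t) \<in> Dom" using c p(1) t mt by (simp add: Dom_def)
  have p0': "?\<Phi> (w, t) = p" using c(3) mt by simp
  have \<Phi>Dom: "?\<Phi> ` Dom \<subseteq> P" by (auto simp: Dom_def)
  have C1\<Phi>: "C1_on Dom ?\<Phi>"
    by (rule C1_on_subset[OF C1_on_times_id[OF \<phi>(7), of "{0..}"]]) (auto simp: Dom_def)
  have C1H: "C1_on Dom (\<lambda>a. F (?\<Phi> a))" by (rule C1_on_compose[OF C1\<Phi> C1_F \<Phi>Dom])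
  obtain D\<phi> where D\<phi>: "(\<phi> has_derivative D\<phi>) (at w within W)"
    using C1_on_has_derivative[OF \<phi>(7) c(2)] by blast
  have D\<Phi>: "(?\<Phi> has_derivative (\<lambda>v. (D\<phi> (fst v), snd v))) (at (w, t) within Dom)"
  proof (rule has_derivative_Pair)
    have f: "(fst has_derivative fst) (at (w, t) within Dom)"
      by (intro bounded_linear_imp_has_derivative bounded_linear_fst)
    have "fst ` Dom \<subseteq> W" by (auto simp: Dom_def)
    then have "(\<phi> has_derivative D\<phi>) (at (fst (w, t)) within fst ` Dom)"
      using has_derivative_subset[OF D\<phi>] by simp
    from diff_chain_within[OF f this]
    show "((\<lambda>a. \<phi> (fst a)) has_derivative (\<lambda>v. D\<phi> (fst v))) (at (w, t) within Dom)" by (simp add: o_def)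
    show "(snd has_derivative snd) (at (w, t) within Dom)"
      by (intro bounded_linear_imp_has_derivative bounded_linear_snd)
  qed
  have "(F has_derivative DF) (at (?\<Phi> (w, t)) within ?\<Phi> ` Dom)"
    unfolding p0' by (rule has_derivative_subset[OF DF \<Phi>Dom])
  from diff_chain_within[OF D\<Phi> this]
  have DH: "((\<lambda>a. F (?\<Phi> a)) has_derivative (\<lambda>v. DF (D\<phi> (fst v), snd v))) (at (w, t) within Dom)"
    by (simp add: o_def)
  have inj: "v = 0" if v: "v \<in> ?L" "DF (D\<phi> (fst v), snd v) = 0" for v
  proof -
    have fv: "fst v \<in> span B" using v(1) by auto
    then have "D\<phi> (fst v) \<in> tangents M m"
      using chart_tangents(1)[OF c(1,2) D\<phi>] c(3) by auto
    then have "(D\<phi> (fst v), snd v) = 0" using v(2) by (intro DF0) auto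
    then have "D\<phi> (fst v) = 0" and s: "snd v = 0" by (auto simp: zero_prod_def)
    then have "D\<phi> (fst v) = D\<phi> 0" using linear_0[OF has_derivative_linear[OF D\<phi>]] by simp
    then have "fst v = 0"
      using chart_tangents(2)[OF c(1,2) D\<phi>] fv span_zero by (auto dest: inj_onD)
    with s show ?thesis by (simp add: prod_eq_iff)
  qed
  have cont\<Phi>: "continuous_on (W \<times> {0..}) ?\<Phi>"
    using \<phi>(6) by (intro continuous_intros continuous_on_compose2[of W \<phi> _ fst]) (auto simp: homeomorphism_def)
  have "openin (top_of_set (W \<times> {0..})) Dom"
  proof -
    have "?\<Phi> ` (W \<times> {0..}) \<subseteq> M \<times> {0..}" using \<phi>(3) by auto
    then have "openin (top_of_set (W \<times> {0..})) (W \<times> {0..} \<inter> ?\<Phi> -` P)"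
      using cont\<Phi> openin_P by (intro continuous_openin_preimage[where T="M \<times> {0..}"]) auto
    then show ?thesis by (simp add: Dom_def Int_def vimage_def)
  qed
  then have "tangents Dom (w, t) = tangents (W \<times> {0..}) (w, t)"
    using p0 by (rule tangents_openin)
  \<comment> \<open>Also at corners of \<open>W\<close> and at \<open>t = 0\<close> the tangent
    vectors fill all of \<open>?L\<close>, so boundary points need no separate treatment.\<close>
  moreover have "?L \<subseteq> tangents (W \<times> {0..}) (w, t)"
    using tangents_orthant[OF \<phi>(1,4) c(2)] c(2) t by (auto intro!: tangents_Times)
  ultimately have L_tan: "?L \<subseteq> tangents Dom (w, t)" by simp
  have L_sub: "subspace ?L" by (intro subspace_Times subspace_span subspace_UNIV)
  have Dom_L: "Dom \<subseteq> ?L" using \<phi>(2) by (auto simp: Dom_def)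
  obtain U1 c1 where U1: "open U1" "(w, t) \<in> U1" "0 < c1"
    "\<forall>a\<in>Dom \<inter> U1. \<forall>a'\<in>Dom \<inter> U1. c1 * dist a a' \<le> dist (F (?\<Phi> a)) (F (?\<Phi> a'))"
    using C1_on_lower_lipschitz[OF C1H p0 L_sub Dom_L L_tan DH inj] by blast
  have "locally_lipschitz_on (W \<times> UNIV) ?\<Phi>" by (rule locally_lipschitz_on_Times_real[OF \<phi>(8)])
  then obtain U2 L2 where U2: "open U2" "(w, t) \<in> U2" "L2-lipschitz_on ((W \<times> UNIV) \<inter> U2) ?\<Phi>"
    unfolding locally_lipschitz_on_def using c(2) by blast
  have L2: "0 \<le> L2" using U2(3) by (rule lipschitz_on_nonneg)
  have cont\<Psi>: "continuous_on (\<phi> ` W \<times> UNIV) ?\<Psi>"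
    using \<phi>(6) by (intro continuous_intros continuous_on_compose2[of "\<phi> ` W" \<psi> _ fst]) (auto simp: homeomorphism_def)
  have "openin (top_of_set (\<phi> ` W \<times> UNIV)) (\<phi> ` W \<times> UNIV \<inter> ?\<Psi> -` (U1 \<inter> U2))"
    using cont\<Psi> U1(1) U2(1) by (intro continuous_openin_preimage_gen open_Int)
  moreover have "openin (top_of_set (M \<times> UNIV)) (\<phi> ` W \<times> (UNIV :: real set))"
    using \<phi>(5) by (intro openin_Times) auto
  ultimately have "openin (top_of_set (M \<times> UNIV)) (\<phi> ` W \<times> UNIV \<inter> ?\<Psi> -` (U1 \<inter> U2))"
    by (rule openin_trans)
  \<comment> \<open>\<open>U\<close> is an ambient open set whose trace on
    \<open>M \<times> UNIV\<close> is the part of the chart with parameters in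
    \<open>U1 \<inter> U2\<close>; thus every point of \<open>P \<inter> U\<close> lifts.\<close>
  then obtain U where U: "open U" "\<phi> ` W \<times> UNIV \<inter> ?\<Psi> -` (U1 \<inter> U2) = (M \<times> UNIV) \<inter> U"
    unfolding openin_open by auto
  have lift: "?\<Psi> a \<in> Dom \<inter> U1 \<inter> U2 \<and> ?\<Phi> (?\<Psi> a) = a" if a: "a \<in> P \<inter> U" for a
  proof -
    have "a \<in> (M \<times> UNIV) \<inter> U" using a by (auto simp: P_def)
    then have *: "fst a \<in> \<phi> ` W" "?\<Psi> a \<in> U1" "?\<Psi> a \<in> U2" unfolding U(2)[symmetric] by auto
    have "?\<Phi> (?\<Psi> a) = a" using *(1) \<psi>\<phi> by (auto simp: prod_eq_iff)
    moreover have "\<psi> (fst a) \<in> W" using *(1) \<psi>\<phi> by auto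
    ultimately show ?thesis using * a by (auto simp: Dom_def P_def)
  qed
  have "p \<in> \<phi> ` W \<times> UNIV \<inter> ?\<Psi> -` (U1 \<inter> U2)"
    using c(2,3) mt U1(2) U2(2) \<psi>\<phi>[OF c(2)] by auto
  then have pU: "p \<in> U" unfolding U(2) by simp
  \<comment> \<open>Distances in \<open>P\<close> exceed those of the parameters by a factor of at
    most \<open>L2\<close>; the \<open>+ 1\<close> avoids a zero divisor.\<close>
  have "c1 / (L2 + 1) * dist a a' \<le> dist (F a) (F a')" if a: "a \<in> P \<inter> U" "a' \<in> P \<inter> U" for a a'
  proof -
    note l = lift[OF a(1)] lift[OF a(2)]
    have "dist (?\<Phi> (?\<Psi> a)) (?\<Phi> (?\<Psi> a')) \<le> L2 * dist (?\<Psi> a) (?\<Psi> a')"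
      by (rule lipschitz_onD[OF U2(3)]) (use l in \<open>auto simp: Dom_def\<close>)
    also have "\<dots> \<le> (L2 + 1) * dist (?\<Psi> a) (?\<Psi> a')" by (intro mult_right_mono) auto
    finally have "dist a a' \<le> (L2 + 1) * dist (?\<Psi> a) (?\<Psi> a')" using l by simp
    then have "c1 / (L2 + 1) * dist a a' \<le> c1 / (L2 + 1) * ((L2 + 1) * dist (?\<Psi> a) (?\<Psi> a'))"
      using U1(3) L2 by (intro mult_left_mono) auto
    also have "\<dots> = c1 * dist (?\<Psi> a) (?\<Psi> a')" using L2 by simp
    also have "\<dots> \<le> dist (F (?\<Phi> (?\<Psi> a))) (F (?\<Phi> (?\<Psi> a')))"
      using U1(4) l by blast
    also have "\<dots> = dist (F a) (F a')" using l by simp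
    finally show ?thesis .
  qed
  moreover have "0 < c1 / (L2 + 1)" using U1(3) L2 by simp
  ultimately show ?thesis using U(1) pU by blast
qed

end

section \<open>An area formula\<close>

text \<open>Small closed balls cut with \<open>C\<close> are compact, and they stay in
  \<open>S\<close> because they lie in the open set that cuts \<open>S\<close> out of
  \<open>C\<close>. Lindelof's theorem leaves countably many. Compact pieces matter because their
  continuous images are Borel.\<close>

lemma openin_closed_countable_compacts:
  fixes C :: "'a::euclidean_space set"
  assumes C: "closed C" and S: "openin (top_of_set C) S"
    and V: "\<And>x. x \<in> S \<Longrightarrow> open (V x)" "\<And>x. x \<in> S \<Longrightarrow> x \<in> V x"
  obtains K :: "nat \<Rightarrow> 'a set" where "\<And>n. compact (K n)" "(\<Union>n. K n) = S"
    "\<And>n. K n \<noteq> {} \<Longrightarrow> \<exists>x\<in>S. K n \<subseteq> V x"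
proof -
  obtain O' where O': "open O'" "S = C \<inter> O'" using S unfolding openin_open by auto
  have "\<exists>r>0. cball x r \<subseteq> V x \<inter> O'" if x: "x \<in> S" for x
  proof -
    have VO: "open (V x \<inter> O')" "x \<in> V x \<inter> O'" using V[OF x] O' x by auto
    from iffD1[OF spec[OF open_contains_cball_eq[OF VO(1)]] VO(2)] show ?thesis .
  qed
  then obtain r where r: "\<And>x. x \<in> S \<Longrightarrow> 0 < r x \<and> cball x (r x) \<subseteq> V x \<inter> O'" by metis
  obtain \<F> where F: "\<F> \<subseteq> (\<lambda>x. ball x (r x)) ` S" "countable \<F>" "\<Union>\<F> = \<Union>((\<lambda>x. ball x (r x)) ` S)"
    by (rule Lindelof[of "(\<lambda>x. ball x (r x)) ` S"]) auto
  then obtain I where I: "countable I" "I \<subseteq> S" "\<F> = (\<lambda>x. ball x (r x)) ` I"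
    by (meson countable_subset_image)
  \<comment> \<open>For empty \<open>I\<close> the enumeration \<open>from_nat_into I\<close> need
    not hit a point of \<open>S\<close>, so this case is set apart.\<close>
  define K where "K n = (if I = {} then {} else cball (from_nat_into I n) (r (from_nat_into I n)) \<inter> C)" for n
  have in_S: "from_nat_into I n \<in> S" if "I \<noteq> {}" for n using from_nat_into[OF that, of n] I(2) by auto
  show thesis
  proof (rule that[of K])
    show "compact (K n)" for n using C by (simp add: K_def compact_Int_closed)
    show "\<exists>x\<in>S. K n \<subseteq> V x" if ne: "K n \<noteq> {}" for n
    proof -
      have "I \<noteq> {}" using ne by (auto simp: K_def)
      then show ?thesis using r[OF in_S[of n]] in_S[of n] by (intro bexI[of _ "from_nat_into I n"]) (auto simp: K_def)
    qed
    show "(\<Union>n. K n) = S"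
    proof (intro equalityI subsetI)
      fix y assume "y \<in> (\<Union>n. K n)"
      then obtain n where n: "y \<in> K n" by auto
      then have "I \<noteq> {}" by (auto simp: K_def)
      then show "y \<in> S" using r[OF in_S[of n]] n O'(2) by (auto simp: K_def)
    next
      fix y assume y: "y \<in> S"
      then have "y \<in> ball y (r y)" using r by simp
      then have "y \<in> \<Union>\<F>" unfolding F(3) using y by blast
      then obtain x where x: "x \<in> I" "y \<in> ball x (r x)" using I(3) by auto
      then have "y \<in> K (to_nat_on I x)"
        using y O'(2) I(1) by (auto simp: K_def)
      then show "y \<in> (\<Union>n. K n)" by auto
    qed
  qed
qed

lemma area_formula_injective:
  fixes N :: "'p measure" and Q :: "'z measure" and F :: "'p \<Rightarrow> 'z"
  assumes N: "sigma_finite_measure N" and Q: "finite_measure Q" and A: "A \<in> sets N" and inj: "inj_on F A"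
    and im: "\<And>X. X \<in> sets N \<Longrightarrow> X \<subseteq> A \<Longrightarrow> F ` X \<in> sets Q"
    and null: "\<And>X. X \<in> sets N \<Longrightarrow> X \<subseteq> A \<Longrightarrow> emeasure Q (F ` X) = 0 \<longleftrightarrow> emeasure N X = 0"
  shows "\<exists>\<rho> :: 'p \<Rightarrow> real. \<rho> \<in> borel_measurable N \<and> (\<forall>p. 0 < \<rho> p) \<and>
    (\<forall>V :: 'p \<Rightarrow> ennreal. V \<in> borel_measurable N \<longrightarrow>
      (\<lambda>z. \<integral>\<^sup>+p. V p * indicator (A \<inter> F -` {z}) p \<partial>count_space UNIV) \<in> borel_measurable Q \<and>
      (\<integral>\<^sup>+z. (\<integral>\<^sup>+p. V p * indicator (A \<inter> F -` {z}) p \<partial>count_space UNIV) \<partial>Q) =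
      (\<integral>\<^sup>+p. V p * ennreal (\<rho> p) * indicator A p \<partial>N))"
proof -
  interpret N: sigma_finite_measure N by fact
  interpret Q: finite_measure Q by fact
  let ?B = "F ` A"
  define g where "g = inv_into A F"
  have B: "?B \<in> sets Q" by (rule im[OF A subset_refl])
  have gF: "g (F p) = p" if "p \<in> A" for p using inj that by (simp add: g_def)
  have gA: "g z \<in> A" "F (g z) = z" if "z \<in> ?B" for z
    using that by (auto simp: g_def inv_into_into f_inv_into_f)
  have vim: "g -` X \<inter> ?B = F ` (X \<inter> A)" for X using gF by force
  have spB: "space (restrict_space Q ?B) = ?B"
    using sets.sets_into_space[OF B] by (auto simp: space_restrict_space)
  have g_meas: "g \<in> measurable (restrict_space Q ?B) N"
  proof (rule measurableI)
    show "g z \<in> space N" if "z \<in> space (restrict_space Q ?B)" for z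
      using gA(1) that sets.sets_into_space[OF A] unfolding spB by auto
    show "g -` X \<inter> space (restrict_space Q ?B) \<in> sets (restrict_space Q ?B)" if "X \<in> sets N" for X
      unfolding spB vim using that A B by (auto simp: sets_restrict_space_iff intro!: im)
  qed
  define \<nu> where "\<nu> = distr (restrict_space Q ?B) N g"
  have \<nu>: "emeasure \<nu> X = emeasure Q (F ` (X \<inter> A))" if "X \<in> sets N" for X
  proof -
    have "emeasure \<nu> X = emeasure (restrict_space Q ?B) (F ` (X \<inter> A))"
      unfolding \<nu>_def using that g_meas by (subst emeasure_distr) (simp_all add: spB vim)
    also have "\<dots> = emeasure Q (F ` (X \<inter> A))"
      using B by (intro emeasure_restrict_space) auto
    finally show ?thesis .
  qed
  have sets_\<nu>: "sets \<nu> = sets N" by (simp add: \<nu>_def)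
  have ac: "absolutely_continuous N \<nu>"
    unfolding absolutely_continuous_def
  proof
    fix X assume X: "X \<in> null_sets N"
    then have "X \<inter> A \<in> null_sets N" using A by (rule null_set_Int2)
    then have "emeasure Q (F ` (X \<inter> A)) = 0" by (subst null) auto
    then show "X \<in> null_sets \<nu>" using X \<nu>[of X] sets_\<nu> by (auto simp: null_sets_def)
  qed
  obtain f where f: "f \<in> borel_measurable N" "density N f = \<nu>"
    using N.Radon_Nikodym[OF ac sets_\<nu>] by auto
  have \<nu>f: "emeasure \<nu> X = (\<integral>\<^sup>+p. f p * indicator X p \<partial>N)" if "X \<in> sets N" for X
    unfolding f(2)[symmetric] using f(1) that by (rule emeasure_density)
  have "(\<integral>\<^sup>+p. f p \<partial>N) = emeasure \<nu> (space N)"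
    by (subst \<nu>f) (auto intro!: nn_integral_cong)
  also have "\<dots> < \<infinity>" by (subst \<nu>) (auto simp: Q.emeasure_finite less_top[symmetric])
  finally have "AE p in N. f p \<noteq> \<infinity>" using f(1) by (intro nn_integral_PInf_AE) auto
  \<comment> \<open>The part of \<open>A\<close> where \<open>f\<close> vanishes is
    \<open>\<nu>\<close>-null, so its image is \<open>Q\<close>-null; the converse half of
    \<open>null\<close> makes the part itself \<open>N\<close>-null.\<close>
  moreover have "AE p in N. p \<in> A \<longrightarrow> f p \<noteq> 0"
  proof -
    let ?X = "{p \<in> space N. p \<in> A \<and> f p = 0}"
    have X: "?X \<in> sets N" using A f(1) by measurable
    have "emeasure \<nu> ?X = (\<integral>\<^sup>+p. 0 \<partial>N)"
      unfolding \<nu>f[OF X] by (intro nn_integral_cong) (auto split: split_indicator)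
    then have "emeasure Q (F ` (?X \<inter> A)) = 0" using \<nu>[OF X] by simp
    moreover have "?X \<inter> A = ?X" by auto
    ultimately have "emeasure N ?X = 0" using null[OF X] by auto
    then have "?X \<in> null_sets N" using X by auto
    then show ?thesis by (rule AE_I') auto
  qed
  ultimately have ae: "AE p in N. p \<in> A \<longrightarrow> f p \<noteq> 0 \<and> f p \<noteq> \<infinity>" by auto
  \<comment> \<open>The default \<open>1\<close> applies off \<open>A\<close> and on a null subset
    of \<open>A\<close>, so positivity everywhere costs nothing in the formula.\<close>
  define \<rho> where "\<rho> p = (if f p \<noteq> 0 \<and> f p \<noteq> \<infinity> then enn2real (f p) else 1)" for p
  have \<rho>: "ennreal (\<rho> p) = f p" if "f p \<noteq> 0 \<and> f p \<noteq> \<infinity>" for p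
    using that by (simp add: \<rho>_def less_top)
  have \<rho>_pos: "0 < \<rho> p" for p
    by (auto simp: \<rho>_def enn2real_positive_iff less_top zero_less_iff_neq_zero)
  have \<rho>_meas: "\<rho> \<in> borel_measurable N"
    unfolding \<rho>_def[abs_def] using f(1) by measurable
  have "(\<lambda>z. \<integral>\<^sup>+p. V p * indicator (A \<inter> F -` {z}) p \<partial>count_space UNIV) \<in> borel_measurable Q \<and>
      (\<integral>\<^sup>+z. (\<integral>\<^sup>+p. V p * indicator (A \<inter> F -` {z}) p \<partial>count_space UNIV) \<partial>Q) =
      (\<integral>\<^sup>+p. V p * ennreal (\<rho> p) * indicator A p \<partial>N)"
    if V: "V \<in> borel_measurable N" for V :: "'p \<Rightarrow> ennreal"
  proof -
    have c: "(\<integral>\<^sup>+p. V p * indicator (A \<inter> F -` {z}) p \<partial>count_space UNIV) = V (g z) * indicator ?B z" for z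
    proof (cases "z \<in> ?B")
      case True
      have "(\<integral>\<^sup>+p. V p * indicator (A \<inter> F -` {z}) p \<partial>count_space UNIV)
        = (\<integral>\<^sup>+p. V (g z) * indicator {g z} p \<partial>count_space UNIV)"
        using gA[OF True] gF by (intro nn_integral_cong) (auto split: split_indicator)
      then show ?thesis using True by (simp add: nn_integral_cmult_indicator)
    next
      case False
      then have "A \<inter> F -` {z} = {}" by auto
      with False show ?thesis by simp
    qed
    have Vg: "(\<lambda>z. V (g z)) \<in> borel_measurable (restrict_space Q ?B)"
      by (rule measurable_compose[OF g_meas V])
    then have meas: "(\<lambda>z. V (g z) * indicator ?B z) \<in> borel_measurable Q"
      using B by (subst (asm) borel_measurable_restrict_space_iff_ennreal) auto
    have VA: "(\<lambda>p. V p * indicator A p) \<in> borel_measurable N" using V A by simp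
    have "(\<integral>\<^sup>+z. V (g z) * indicator ?B z \<partial>Q) = (\<integral>\<^sup>+z. V (g z) * indicator A (g z) * indicator ?B z \<partial>Q)"
      using gA(1) by (intro nn_integral_cong) (auto split: split_indicator)
    also have "\<dots> = (\<integral>\<^sup>+z. V (g z) * indicator A (g z) \<partial>restrict_space Q ?B)"
      using B by (subst nn_integral_restrict_space) auto
    also have "\<dots> = (\<integral>\<^sup>+p. V p * indicator A p \<partial>\<nu>)"
      unfolding \<nu>_def using g_meas VA by (subst nn_integral_distr) auto
    also have "\<dots> = (\<integral>\<^sup>+p. f p * (V p * indicator A p) \<partial>N)"
      unfolding f(2)[symmetric] using f(1) VA by (rule nn_integral_density)
    also have "\<dots> = (\<integral>\<^sup>+p. V p * ennreal (\<rho> p) * indicator A p \<partial>N)"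
      using ae by (intro nn_integral_cong_AE) (auto simp: \<rho> mult_ac split: split_indicator)
    finally show ?thesis unfolding c using meas by simp
  qed
  then show ?thesis using \<rho>_meas \<rho>_pos by blast
qed

text \<open>On \<open>E\<close> the function \<open>f\<close> is arbitrary, but every subset of a
  null set is measurable for the completion.\<close>

lemma measurable_completion_AE_eq:
  fixes f h :: "'z \<Rightarrow> ennreal"
  assumes h: "h \<in> borel_measurable Q" and E: "E \<in> null_sets Q"
    and eq: "\<And>z. z \<in> space Q \<Longrightarrow> z \<notin> E \<Longrightarrow> f z = h z"
  shows "f \<in> borel_measurable (completion Q)"
proof (rule measurableI)
  fix Y :: "ennreal set" assume "Y \<in> sets borel"
  then have "(h -` Y \<inter> space Q) - E \<in> sets Q"
    using measurable_sets[OF h] E by auto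
  moreover have "(f -` Y \<inter> space Q) \<inter> E \<in> sets (completion Q)"
    using E by (intro sets_completionI_sub[of E]) auto
  moreover have "f -` Y \<inter> space (completion Q) = ((h -` Y \<inter> space Q) - E) \<union> ((f -` Y \<inter> space Q) \<inter> E)"
    using eq by auto
  ultimately show "f -` Y \<inter> space (completion Q) \<in> sets (completion Q)"
    by (simp only: sets.Un sets_completionI_sets)
qed simp

lemma area_formula_countable:
  fixes N :: "'p measure" and Q :: "'z measure" and F :: "'p \<Rightarrow> 'z" and A :: "nat \<Rightarrow> 'p set"
  assumes N: "sigma_finite_measure N" and Q: "finite_measure Q"
    and A: "\<And>i. A i \<in> sets N" and inj: "\<And>i. inj_on F (A i)" and disj: "disjoint_family A"
    and im: "\<And>i X. X \<in> sets N \<Longrightarrow> X \<subseteq> A i \<Longrightarrow> F ` X \<in> sets Q"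
    and null: "\<And>i X. X \<in> sets N \<Longrightarrow> X \<subseteq> A i \<Longrightarrow> emeasure Q (F ` X) = 0 \<longleftrightarrow> emeasure N X = 0"
    and S: "S \<in> null_sets N" "F ` S \<in> null_sets Q"
  shows "\<exists>\<rho> :: 'p \<Rightarrow> real. \<rho> \<in> borel_measurable N \<and> (\<forall>p. 0 < \<rho> p) \<and>
    (\<forall>V :: 'p \<Rightarrow> ennreal. V \<in> borel_measurable N \<longrightarrow>
      (\<lambda>z. \<integral>\<^sup>+p. V p * indicator (((\<Union>i. A i) \<union> S) \<inter> F -` {z}) p \<partial>count_space UNIV) \<in> borel_measurable (completion Q) \<and>
      (\<integral>\<^sup>+z. (\<integral>\<^sup>+p. V p * indicator (((\<Union>i. A i) \<union> S) \<inter> F -` {z}) p \<partial>count_space UNIV) \<partial>Q) =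
      (\<integral>\<^sup>+p. V p * ennreal (\<rho> p) * indicator ((\<Union>i. A i) \<union> S) p \<partial>N))"
proof -
  let ?P = "(\<Union>i. A i) \<union> S"
  define c where "c V X z = (\<integral>\<^sup>+p. V p * indicator (X \<inter> F -` {z}) p \<partial>count_space UNIV)"
    for V :: "'p \<Rightarrow> ennreal" and X z
  have "\<forall>i. \<exists>\<rho> :: 'p \<Rightarrow> real. \<rho> \<in> borel_measurable N \<and> (\<forall>p. 0 < \<rho> p) \<and>
    (\<forall>V :: 'p \<Rightarrow> ennreal. V \<in> borel_measurable N \<longrightarrow> c V (A i) \<in> borel_measurable Q \<and>
      (\<integral>\<^sup>+z. c V (A i) z \<partial>Q) = (\<integral>\<^sup>+p. V p * ennreal (\<rho> p) * indicator (A i) p \<partial>N))"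
    unfolding c_def[abs_def]
    by (intro allI area_formula_injective[OF N Q A inj]) (erule (1) im null)+
  from choice[OF this] obtain \<rho> where \<rho>: "\<And>i. \<rho> i \<in> borel_measurable N" "\<And>i p. 0 < \<rho> i p"
    "\<And>i V. V \<in> borel_measurable N \<Longrightarrow> c V (A i) \<in> borel_measurable Q"
    "\<And>i V. V \<in> borel_measurable N \<Longrightarrow>
      (\<integral>\<^sup>+z. c V (A i) z \<partial>Q) = (\<integral>\<^sup>+p. V p * ennreal (\<rho> i p) * indicator (A i) p \<partial>N)"
    by blast
  \<comment> \<open>\<open>LEAST\<close> picks the unique piece through \<open>p\<close> in a
    measurable way. In no piece the index is unspecified, but the value is still positive.\<close>
  define r where "r p = \<rho> (LEAST i. p \<in> A i) p" for p
  have r_eq: "r p = \<rho> i p" if "p \<in> A i" for p i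
  proof -
    have "p \<in> A (LEAST i. p \<in> A i)" using that by (rule LeastI)
    then have "(LEAST i. p \<in> A i) = i" using disj that by (auto simp: disjoint_family_on_def)
    then show ?thesis by (simp add: r_def)
  qed
  have r_meas: "r \<in> borel_measurable N"
    unfolding r_def[abs_def]
  proof (rule measurable_compose_countable[where f="\<lambda>i p. \<rho> i p" and g="\<lambda>p. LEAST i. p \<in> A i"])
    show "\<rho> i \<in> borel_measurable N" for i by (rule \<rho>(1))
    have [measurable]: "A i \<in> sets N" for i by (rule A)
    show "(\<lambda>p. LEAST i. p \<in> A i) \<in> measurable N (count_space UNIV)" by measurable
  qed
  have "c V ?P \<in> borel_measurable (completion Q) \<and>
      (\<integral>\<^sup>+z. c V ?P z \<partial>Q) = (\<integral>\<^sup>+p. V p * ennreal (r p) * indicator ?P p \<partial>N)"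
    if V: "V \<in> borel_measurable N" for V
  proof -
    have sum_ind: "(\<Sum>i. indicator (A i \<inter> X) p) = (indicator ((\<Union>i. A i) \<inter> X) p :: ennreal)" for X p
    proof -
      have "disjoint_family (\<lambda>i. A i \<inter> X)" using disj by (auto simp: disjoint_family_on_def)
      from suminf_indicator[OF this, of p] show ?thesis by (simp add: Int_UN_distrib2)
    qed
    have eq: "c V ?P z = (\<Sum>i. c V (A i) z)" if "z \<notin> F ` S" for z
    proof -
      have "?P \<inter> F -` {z} = (\<Union>i. A i) \<inter> F -` {z}" using that by auto
      then have "c V ?P z = (\<integral>\<^sup>+p. (\<Sum>i. V p * indicator (A i \<inter> F -` {z}) p) \<partial>count_space UNIV)"
        by (simp add: c_def sum_ind)
      also have "\<dots> = (\<Sum>i. c V (A i) z)" unfolding c_def by (rule nn_integral_suminf) simp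
      finally show ?thesis .
    qed
    have [measurable]: "c V (A i) \<in> borel_measurable Q" for i by (rule \<rho>(3)[OF V])
    have "(\<lambda>z. \<Sum>i. c V (A i) z) \<in> borel_measurable Q" by measurable
    then have meas: "c V ?P \<in> borel_measurable (completion Q)"
      using S(2) eq by (rule measurable_completion_AE_eq)
    have "(\<integral>\<^sup>+z. c V ?P z \<partial>Q) = (\<integral>\<^sup>+z. (\<Sum>i. c V (A i) z) \<partial>Q)"
      by (rule nn_integral_cong_AE, rule AE_I'[OF S(2)]) (use eq in auto)
    also have "\<dots> = (\<Sum>i. \<integral>\<^sup>+z. c V (A i) z \<partial>Q)" using \<rho>(3)[OF V] by (rule nn_integral_suminf)
    also have "\<dots> = (\<Sum>i. \<integral>\<^sup>+p. V p * ennreal (r p) * indicator (A i) p \<partial>N)"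
      unfolding \<rho>(4)[OF V]
      by (intro suminf_cong nn_integral_cong) (auto simp: r_eq split: split_indicator)
    also have "\<dots> = (\<integral>\<^sup>+p. (\<Sum>i. V p * ennreal (r p) * indicator (A i) p) \<partial>N)"
      using V r_meas A by (intro nn_integral_suminf[symmetric]) simp
    also have "\<dots> = (\<integral>\<^sup>+p. V p * ennreal (r p) * indicator (\<Union>i. A i) p \<partial>N)"
      using sum_ind[of UNIV] by simp
    also have "\<dots> = (\<integral>\<^sup>+p. V p * ennreal (r p) * indicator ?P p \<partial>N)"
      by (rule nn_integral_cong_AE, rule AE_I'[OF S(1)]) (auto split: split_indicator)
    finally show ?thesis using meas by simp
  qed
  then show ?thesis
    unfolding c_def[abs_def] using r_meas \<rho>(2) by (intro exI[of _ r]) (auto simp: r_def)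
qed

section \<open>Counting hits as a sum over fibres of \<open>F\<close>\<close>

context backward_flow
begin

text \<open>Flowing back from \<open>M\<close> for time \<open>t\<close> and flowing forward again
  are mutually inverse on regular pairs, so the sum over hits can be re-indexed by starting points
  in \<open>M\<close>.\<close>

lemma hits_nn_integral:
  "(\<Sum>\<^sub>\<infinity>p\<in>hits \<Psi> q M \<Omega> b z. ennreal (w p)) =
    (\<integral>\<^sup>+p. ennreal (w (b (- snd p) (fst p), snd p)) * indicator (P \<inter> F -` {z}) p \<partial>count_space UNIV)"
proof -
  let ?\<Theta> = "\<lambda>p. (b (- snd p) (fst p), snd p)"
  have "bij_betw ?\<Theta> (P \<inter> F -` {z}) (hits \<Psi> q M \<Omega> b z)"
  proof (rule bij_betw_byWitness[where f'="\<lambda>p. (b (snd p) (fst p), snd p)"])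
    show "\<forall>p\<in>P \<inter> F -` {z}. (b (snd (?\<Theta> p)) (fst (?\<Theta> p)), snd (?\<Theta> p)) = p"
      using b_inverse P_in_\<Omega> by fastforce
    show "\<forall>p\<in>hits \<Psi> q M \<Omega> b z. ?\<Theta> (b (snd p) (fst p), snd p) = p"
      using b_inverse by (auto simp: hits_def)
    show "?\<Theta> ` (P \<inter> F -` {z}) \<subseteq> hits \<Psi> q M \<Omega> b z"
    proof
      fix y assume "y \<in> ?\<Theta> ` (P \<inter> F -` {z})"
      then obtain m t where p: "(m, t) \<in> P" "(m, t) \<in> F -` {z}" and y: "y = (b (- t) m, t)" by auto
      then have \<Omega>: "(m, - t) \<in> \<Omega>" using P_in_\<Omega> by force
      then have "(b (- t) m, t) \<in> \<Omega>" using \<Omega>_reverse by force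
      moreover have "b t (b (- t) m) = m" using b_inverse[OF \<Omega>] by simp
      ultimately show "y \<in> hits \<Psi> q M \<Omega> b z"
        unfolding y using p b_regular[OF \<Omega>] regular_in by (auto simp: hits_def fiber_def F_def P_def)
    qed
    show "(\<lambda>p. (b (snd p) (fst p), snd p)) ` hits \<Psi> q M \<Omega> b z \<subseteq> P \<inter> F -` {z}"
      using b_inverse \<Omega>_reverse by (auto simp: hits_def P_def F_def fiber_def)
  qed
  from nn_integral_bij_count_space[OF this, of "\<lambda>p. ennreal (w p)"]
  show ?thesis
    unfolding infsum_ennreal_eq_nn_integral by (simp add: nn_integral_count_space_indicator)
qed

text \<open>The lower bound gives \<open>F\<close> a Lipschitz inverse \<open>g\<close> on
  \<open>F\<close> K\<open>, a compact and hence Borel set. So\<close>F \<open>X\<close> is Borel as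
  a preimage under \<open>g\<close>, and null sets pass in both directions.\<close>

lemma F_piece:
  assumes K: "compact K" "K \<subseteq> P" and c: "0 < c" "\<forall>a\<in>K. \<forall>a'\<in>K. c * dist a a' \<le> dist (F a) (F a')"
  shows "inj_on F K" "\<And>X. X \<in> sets borel \<Longrightarrow> X \<subseteq> K \<Longrightarrow> F ` X \<in> sets borel"
    "\<And>X j. X \<subseteq> K \<Longrightarrow> hausdorff_null j (F ` X) \<longleftrightarrow> hausdorff_null j X"
proof -
  show inj: "inj_on F K"
  proof (rule inj_onI)
    fix a a' assume a: "a \<in> K" "a' \<in> K" "F a = F a'"
    then have "c * dist a a' \<le> 0" using c(2) by force
    then show "a = a'" using c(1) by (simp add: mult_le_0_iff)
  qed
  define g where "g = inv_into K F"
  have gF: "g (F a) = a" if "a \<in> K" for a using inj that by (simp add: g_def)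
  have lip: "(1 / c)-lipschitz_on (F ` K) g"
  proof (rule lipschitz_onI)
    fix z z' assume "z \<in> F ` K" "z' \<in> F ` K"
    then obtain a a' where a: "a \<in> K" "a' \<in> K" "z = F a" "z' = F a'" by auto
    then have "dist a a' \<le> dist (F a) (F a') / c"
      using c by (simp add: pos_le_divide_eq mult.commute)
    then show "dist (g z) (g z') \<le> 1 / c * dist z z'" using a gF by simp
  qed (use c in simp)
  have Fl: "locally_lipschitz_on P F" using C1_F by (rule C1_on_imp_locally_lipschitz_on)
  have cont: "continuous_on K F"
    using locally_lipschitz_on_imp_continuous_on[OF Fl] K(2) by (rule continuous_on_subset)
  show "F ` X \<in> sets borel" if X: "X \<in> sets borel" "X \<subseteq> K" for X
  proof -
    have FK: "F ` K \<in> sets borel" using compact_continuous_image[OF cont K(1)] by (intro borel_closed compact_imp_closed)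
    have "g \<in> borel_measurable (restrict_space borel (F ` K))"
      using lip by (intro borel_measurable_continuous_on_restrict lipschitz_on_continuous_on)
    then have "g -` X \<inter> space (restrict_space borel (F ` K)) \<in> sets (restrict_space borel (F ` K))"
      using X(1) by (rule measurable_sets)
    then have "g -` X \<inter> F ` K \<in> sets borel" using FK by (auto simp: space_restrict_space sets_restrict_space_iff)
    moreover have "g -` X \<inter> F ` K = F ` X" using gF X(2) by force
    ultimately show ?thesis by simp
  qed
  show "hausdorff_null j (F ` X) \<longleftrightarrow> hausdorff_null j X" if X: "X \<subseteq> K" for X j
  proof
    assume "hausdorff_null j (F ` X)"
    then have "hausdorff_null j (g ` F ` X)"
      by (rule hausdorff_null_lipschitz_image[OF lipschitz_on_subset[OF lip image_mono[OF X]]])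
    moreover have "g ` F ` X = X" using gF X by force
    ultimately show "hausdorff_null j X" by simp
  next
    assume "hausdorff_null j X"
    then show "hausdorff_null j (F ` X)"
      using X K(2) by (intro hausdorff_null_locally_lipschitz_image[OF Fl]) auto
  qed
qed

end

section \<open>Radon-Nikodym density of the fibre-counting measure\<close>

theorem proposition2:
  fixes \<Psi> M :: "'a::euclidean_space set" and Z :: "'b::euclidean_space set"
    and b :: "real \<Rightarrow> 'a \<Rightarrow> 'a" and \<Omega> :: "('a \<times> real) set" and q :: "'a \<Rightarrow> 'b"
    and d k :: nat and dz :: "'b measure" and dm :: "'a measure"
  assumes "manifold (d + k) \<Psi>"
    and "piecewise_flow (d + k) \<Psi> \<Omega> b"
    and "manifold d Z"
    and "fibration d k \<Psi> Z q"
    and "\<And>z. z \<in> Z \<Longrightarrow> transversal_to_flow k (fiber \<Psi> q z) \<Omega> b"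
    and "1 \<le> d"
    and "M \<subseteq> \<Psi>"
    and "manifold (d - 1) M"
    and "transversal_to_flow (d - 1) M \<Omega> b"
    and "backward_orbit_transversal (d + k) k (d - 1) \<Psi> q M \<Omega> b"
    and "finite_measure dz" and "lebesgue_class d Z dz"
    and "finite_measure dm" and "lebesgue_class (d - 1) M dm"
  shows "\<exists>r :: 'a \<times> real \<Rightarrow> real.
    r \<in> borel_measurable (dm \<Otimes>\<^sub>M restrict_space lborel {0..}) \<and>
    (\<forall>m\<in>M. \<forall>t\<ge>0. 0 < r (m, t)) \<and>
    (\<forall>w. continuous_on (\<Psi> \<times> {0..}) w \<and> (\<forall>p\<in>\<Psi> \<times> {0..}. 0 \<le> w p) \<longrightarrow>
      weighted_count \<Psi> q M \<Omega> b w \<in> borel_measurable (completion dz) \<and>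
      (\<integral>\<^sup>+z. weighted_count \<Psi> q M \<Omega> b w z \<partial>dz) =
      (\<integral>\<^sup>+(m, t)\<in>{(m, t). (m, - t) \<in> \<Omega>}. ennreal (w (b (- t) m, t) * r (m, t))
         \<partial>(dm \<Otimes>\<^sub>M restrict_space lborel {0..})))"
proof -
  interpret backward_flow \<Psi> M Z b \<Omega> q d k
    by (rule backward_flow.intro) (fact assms)+
  interpret dm: finite_measure dm by fact
  let ?C = "M \<times> {0::real..}" and ?Mr = "regular_points (d - 1) M"
  define N where "N = dm \<Otimes>\<^sub>M restrict_space lborel {0::real..}"
  have clM: "closed M" and clZ: "closed Z"
    using assms(3,8) by (auto simp: manifold_def compact_imp_closed)
  have clC: "closed ?C" using clM by (intro closed_Times) auto
  have N: "sigma_finite_measure N"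
    unfolding N_def by (intro sigma_finite_pair_measure sigma_finite_measure_restrict_space
      dm.sigma_finite_measure_axioms lborel.sigma_finite_measure_axioms) auto
  have sets_N: "sets N = sets (restrict_space borel ?C)"
    unfolding N_def using assms(14)
    by (intro sets_pair_restrict_borel) (auto simp: lebesgue_class_def sets_restrict_space)
  have in_N: "X \<in> sets N \<longleftrightarrow> X \<in> sets borel \<and> X \<subseteq> ?C" for X
    unfolding sets_N using clC by (subst sets_restrict_space_iff) auto
  have space_N: "space N = ?C"
    using sets_eq_imp_space_eq[OF sets_N] by (simp add: space_restrict_space)
  note in_dz = sets_lebesgue_class(1)[OF assms(12) clZ]
  \<comment> \<open>\<open>M\<close> has dimension \<open>d - 1\<close> and time adds one;
    \<open>1 \<le> d\<close> makes \<open>Suc (d - 1)\<close> equal to \<open>d\<close>, so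
    \<open>N\<close> and \<open>dz\<close> are compared in the same dimension.\<close>
  have null_N: "emeasure N X = 0 \<longleftrightarrow> hausdorff_null d X" if "X \<in> sets N" for X
    using lebesgue_class_pair_null_iff[OF assms(14) dm.sigma_finite_measure_axioms assms(8), of X]
      that assms(6) by (simp add: N_def)
  note null_dz = lebesgue_class_null_iff[OF assms(12,3)]
  define Pr where "Pr = P \<inter> ?Mr \<times> {0..}"
  have Pr: "Pr \<subseteq> P" "p \<in> Pr \<Longrightarrow> fst p \<in> ?Mr" for p by (auto simp: Pr_def)
  have openin_Pr: "openin (top_of_set ?C) Pr"
    unfolding Pr_def by (intro openin_Int openin_P openin_Times openin_regular_points) auto
  have "\<forall>p. \<exists>U. p \<in> Pr \<longrightarrow> open U \<and> p \<in> U \<and>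
      (\<exists>c>0. \<forall>a\<in>P \<inter> U. \<forall>a'\<in>P \<inter> U. c * dist a a' \<le> dist (F a) (F a'))"
  proof
    fix p
    show "\<exists>U. p \<in> Pr \<longrightarrow> open U \<and> p \<in> U \<and>
      (\<exists>c>0. \<forall>a\<in>P \<inter> U. \<forall>a'\<in>P \<inter> U. c * dist a a' \<le> dist (F a) (F a'))"
    proof (cases "p \<in> Pr")
      case True
      then have "p \<in> P" "fst p \<in> ?Mr" using Pr by auto
      from F_lower_lipschitz[OF this] obtain U c where "open U" "p \<in> U" "0 < c"
        "\<forall>a\<in>P \<inter> U. \<forall>a'\<in>P \<inter> U. c * dist a a' \<le> dist (F a) (F a')" by (elim exE conjE)
      then show ?thesis by (intro exI[of _ U] impI conjI exI[of _ c])
    qed simp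
  qed
  from choice[OF this] obtain U where U_all: "\<forall>p. p \<in> Pr \<longrightarrow> open (U p) \<and> p \<in> U p \<and>
      (\<exists>c>0. \<forall>a\<in>P \<inter> U p. \<forall>a'\<in>P \<inter> U p. c * dist a a' \<le> dist (F a) (F a'))"
    by (elim exE)
  have U: "open (U p)" "p \<in> U p"
    "\<exists>c>0. \<forall>a\<in>P \<inter> U p. \<forall>a'\<in>P \<inter> U p. c * dist a a' \<le> dist (F a) (F a')" if "p \<in> Pr" for p
  proof -
    note h = mp[OF spec[OF U_all] that]
    show "open (U p)" by (rule conjunct1[OF h])
    show "p \<in> U p" by (rule conjunct1[OF conjunct2[OF h]])
    show "\<exists>c>0. \<forall>a\<in>P \<inter> U p. \<forall>a'\<in>P \<inter> U p. c * dist a a' \<le> dist (F a) (F a')"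
      by (rule conjunct2[OF conjunct2[OF h]])
  qed
  obtain K :: "nat \<Rightarrow> ('a \<times> real) set" where K: "\<And>n. compact (K n)" "(\<Union>n. K n) = Pr" "\<And>n. K n \<noteq> {} \<Longrightarrow> \<exists>p\<in>Pr. K n \<subseteq> U p"
    by (rule openin_closed_countable_compacts[OF clC openin_Pr U(1,2)], assumption, assumption, rule that)
  have KP: "K n \<subseteq> P" for n using K(2) Pr(1) by blast
  have K_low: "\<exists>c>0. \<forall>a\<in>K n. \<forall>a'\<in>K n. c * dist a a' \<le> dist (F a) (F a')" for n
  proof (cases "K n = {}")
    case False
    then obtain p where p: "p \<in> Pr" "K n \<subseteq> U p" using K(3) by blast
    then have "K n \<subseteq> P \<inter> U p" using KP by blast
    moreover obtain c where "0 < c" "\<forall>a\<in>P \<inter> U p. \<forall>a'\<in>P \<inter> U p. c * dist a a' \<le> dist (F a) (F a')"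
      using U(3)[OF p(1)] by (elim exE conjE)
    ultimately show ?thesis by (intro exI[of _ c]) (simp add: subset_eq)
  qed (auto intro: exI[of _ 1])
  have F_K: "inj_on F (K n)" "\<And>X. X \<in> sets borel \<Longrightarrow> X \<subseteq> K n \<Longrightarrow> F ` X \<in> sets borel"
    "\<And>X j. X \<subseteq> K n \<Longrightarrow> hausdorff_null j (F ` X) \<longleftrightarrow> hausdorff_null j X" for n
  proof -
    obtain c where c: "0 < c" "\<forall>a\<in>K n. \<forall>a'\<in>K n. c * dist a a' \<le> dist (F a) (F a')"
      using K_low[of n] by (elim exE conjE)
    note piece = F_piece[OF K(1) KP c]
    show "inj_on F (K n)" by (rule piece(1))
    show "F ` X \<in> sets borel" if "X \<in> sets borel" "X \<subseteq> K n" for X using that by (rule piece(2))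
    show "hausdorff_null j (F ` X) \<longleftrightarrow> hausdorff_null j X" if "X \<subseteq> K n" for X j using that by (rule piece(3))
  qed
  \<comment> \<open>Disjointness prevents double counting. The pieces are no longer compact, but
    Borel subsets of compact ones, which is all that \<open>F_K\<close> asks for.\<close>
  define A where "A = disjointed K"
  have AK: "A n \<subseteq> K n" for n unfolding A_def by (rule disjointed_subset)
  have PC: "P \<subseteq> ?C" by (auto simp: P_def)
  have A_N: "A n \<in> sets N" for n
  proof -
    have "K i \<in> sets N" for i
      using K(1)[of i] order_trans[OF KP PC, of i] unfolding in_N
      by (simp add: borel_closed compact_imp_closed)
    then have "range K \<subseteq> sets N" by auto
    then show ?thesis unfolding A_def using sets.range_disjointed_sets by blast
  qed
  have im: "F ` X \<in> sets dz" if "X \<in> sets N" "X \<subseteq> A i" for i X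
  proof -
    have "X \<subseteq> K i" using that AK by blast
    then show ?thesis
      using that F_K(2)[of X i] F_in_Z KP[of i] by (auto simp: in_N in_dz)
  qed
  have null: "emeasure dz (F ` X) = 0 \<longleftrightarrow> emeasure N X = 0" if "X \<in> sets N" "X \<subseteq> A i" for i X
  proof -
    have "X \<subseteq> K i" using that AK by blast
    then show ?thesis
      using null_dz[OF im[OF that]] null_N[OF that(1)] F_K(3)[of X i d] by simp
  qed
  define S where "S = P - Pr"
  obtain K' :: "nat \<Rightarrow> ('a \<times> real) set" where K': "\<And>n. compact (K' n)" "(\<Union>n. K' n) = P"
    by (rule openin_closed_countable_compacts[OF clC openin_P, of "\<lambda>_. UNIV"]) auto
  have closed_sing: "closed (M - ?Mr)"
  proof -
    obtain T where "open T" "?Mr = M \<inter> T"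
      using openin_regular_points[of M "d - 1"] unfolding openin_open by auto
    then have "M - ?Mr = M \<inter> - T" "closed (- T)" by auto
    then show ?thesis using clM by (simp add: closed_Int)
  qed
  have S_eq: "S = (\<Union>n. K' n \<inter> ((M - ?Mr) \<times> {0::real..}))"
    using PC unfolding S_def Pr_def K'(2)[symmetric] by auto
  have S_compact: "compact (K' n \<inter> ((M - ?Mr) \<times> {0::real..}))" for n
    using K'(1) closed_sing by (intro compact_Int_closed closed_Times) auto
  have cont_F: "continuous_on P F" and cont_orbit: "continuous_on P (\<lambda>p. b (- snd p) (fst p))"
    using C1_F C1_orbit by (auto intro: locally_lipschitz_on_imp_continuous_on C1_on_imp_locally_lipschitz_on)
  have S_null: "hausdorff_null d S"
  proof -
    have "hausdorff_null (d - 1) (M - ?Mr)" using assms(8) by (simp add: manifold_def)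
    then have "hausdorff_null (Suc (d - 1)) ((M - ?Mr) \<times> {0::real..})" by (rule hausdorff_null_Times_real)
    then have "hausdorff_null d ((M - ?Mr) \<times> {0::real..})" using assms(6) by simp
    then show ?thesis by (rule hausdorff_null_subset) (auto simp: S_eq)
  qed
  have "S \<in> sets borel"
    unfolding S_eq using S_compact by (intro sets.countable_UN) (auto intro: borel_closed compact_imp_closed)
  then have S_N: "S \<in> null_sets N"
    using S_null null_N PC by (auto simp: null_sets_def in_N S_def)
  have F_S: "F ` S \<in> null_sets dz"
  proof -
    have F_S_eq: "F ` S = (\<Union>n. F ` (K' n \<inter> ((M - ?Mr) \<times> {0::real..})))" unfolding S_eq by (rule image_UN)
    have "compact (F ` (K' n \<inter> ((M - ?Mr) \<times> {0::real..})))" for n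
      using K'(2) by (intro compact_continuous_image S_compact continuous_on_subset[OF cont_F]) auto
    then have "F ` S \<in> sets borel"
      unfolding F_S_eq by (intro sets.countable_UN) (auto intro: borel_closed compact_imp_closed)
    then have "F ` S \<in> sets dz" using F_in_Z by (auto simp: in_dz S_def)
    moreover have "hausdorff_null d (F ` S)"
      using C1_on_imp_locally_lipschitz_on[OF C1_F] S_null
      by (rule hausdorff_null_locally_lipschitz_image) (auto simp: S_def)
    ultimately show ?thesis using null_dz by auto
  qed
  have P_eq: "(\<Union>n. A n) \<union> S = P"
    unfolding A_def UN_disjointed_eq K(2) S_def using Pr(1) by auto
  have disj: "disjoint_family A" unfolding A_def by (rule disjoint_family_disjointed)
  have inj: "inj_on F (A n)" for n using F_K(1) AK by (rule inj_on_subset)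
  have "\<exists>r :: 'a \<times> real \<Rightarrow> real. r \<in> borel_measurable N \<and> (\<forall>p. 0 < r p) \<and>
    (\<forall>V :: 'a \<times> real \<Rightarrow> ennreal. V \<in> borel_measurable N \<longrightarrow>
      (\<lambda>z. \<integral>\<^sup>+p. V p * indicator (P \<inter> F -` {z}) p \<partial>count_space UNIV) \<in> borel_measurable (completion dz) \<and>
      (\<integral>\<^sup>+z. (\<integral>\<^sup>+p. V p * indicator (P \<inter> F -` {z}) p \<partial>count_space UNIV) \<partial>dz) =
      (\<integral>\<^sup>+p. V p * ennreal (r p) * indicator P p \<partial>N))"
    by (rule area_formula_countable[OF N assms(11) A_N inj disj _ _ S_N F_S, unfolded P_eq])
      (erule (1) im null)+
  then obtain r :: "'a \<times> real \<Rightarrow> real" where r: "r \<in> borel_measurable N" "\<And>p. 0 < r p"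
    "\<And>V :: 'a \<times> real \<Rightarrow> ennreal. V \<in> borel_measurable N \<Longrightarrow>
      (\<lambda>z. \<integral>\<^sup>+p. V p * indicator (P \<inter> F -` {z}) p \<partial>count_space UNIV) \<in> borel_measurable (completion dz)"
    "\<And>V :: 'a \<times> real \<Rightarrow> ennreal. V \<in> borel_measurable N \<Longrightarrow>
      (\<integral>\<^sup>+z. (\<integral>\<^sup>+p. V p * indicator (P \<inter> F -` {z}) p \<partial>count_space UNIV) \<partial>dz) =
      (\<integral>\<^sup>+p. V p * ennreal (r p) * indicator P p \<partial>N)"
    by blast
  have P_borel: "P \<in> sets borel"
    using openin_P clC unfolding openin_open by auto
  show ?thesis
  proof (intro exI[of _ r] conjI allI impI ballI)
    show "r \<in> borel_measurable (dm \<Otimes>\<^sub>M restrict_space lborel {0..})"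
      using r(1) by (simp add: N_def)
    show "0 < r (m, t)" for m t by (rule r(2))
    fix w :: "'a \<times> real \<Rightarrow> real" assume w: "continuous_on (\<Psi> \<times> {0..}) w \<and> (\<forall>p\<in>\<Psi> \<times> {0..}. 0 \<le> w p)"
    let ?w = "\<lambda>p. w (b (- snd p) (fst p), snd p)"
    \<comment> \<open>The weight along the orbit is continuous only on \<open>P\<close>; extended by
      zero it is Borel, and the fibre sums over \<open>P\<close> do not change.\<close>
    define V where "V p = ennreal (indicator P p *\<^sub>R ?w p)" for p
    have "continuous_on P ?w"
    proof (rule continuous_on_compose2[of "\<Psi> \<times> {0..}" w])
      show "continuous_on (\<Psi> \<times> {0..}) w" using w by simp
      show "continuous_on P (\<lambda>p. (b (- snd p) (fst p), snd p))"
        by (intro continuous_on_Pair cont_orbit continuous_on_snd continuous_on_id)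
      show "(\<lambda>p. (b (- snd p) (fst p), snd p)) ` P \<subseteq> \<Psi> \<times> {0..}"
      proof (rule image_subsetI)
        fix p assume p: "p \<in> P"
        have "b (- snd p) (fst p) \<in> \<Psi>" by (rule regular_in[OF b_regular[OF P_in_\<Omega>[OF p]]])
        then show "(b (- snd p) (fst p), snd p) \<in> \<Psi> \<times> {0..}" using PC p by auto
      qed
    qed
    then have "(\<lambda>p. indicator P p *\<^sub>R ?w p) \<in> borel_measurable borel"
      by (rule borel_measurable_continuous_on_indicator[OF P_borel])
    then have "V \<in> borel_measurable (restrict_space borel ?C)"
      unfolding V_def[abs_def] by (intro measurable_restrict_space1 measurable_compose[OF _ measurable_ennreal])
    then have V: "V \<in> borel_measurable N" by (subst measurable_cong_sets[OF sets_N refl])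
    have count: "weighted_count \<Psi> q M \<Omega> b w =
        (\<lambda>z. \<integral>\<^sup>+p. V p * indicator (P \<inter> F -` {z}) p \<partial>count_space UNIV)"
      unfolding weighted_count_def hits_nn_integral V_def
      by (intro ext nn_integral_cong) (auto split: split_indicator)
    show "weighted_count \<Psi> q M \<Omega> b w \<in> borel_measurable (completion dz)"
      unfolding count by (rule r(3)[OF V])
    show "(\<integral>\<^sup>+z. weighted_count \<Psi> q M \<Omega> b w z \<partial>dz) =
      (\<integral>\<^sup>+(m, t)\<in>{(m, t). (m, - t) \<in> \<Omega>}. ennreal (w (b (- t) m, t) * r (m, t))
         \<partial>(dm \<Otimes>\<^sub>M restrict_space lborel {0..}))"
      unfolding count r(4)[OF V] N_def[symmetric]
    proof (rule nn_integral_cong)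
      fix p assume "p \<in> space N"
      then obtain m t where p: "p = (m, t)" "m \<in> M" "0 \<le> t" by (auto simp: space_N)
      have "p \<in> P \<longleftrightarrow> (m, - t) \<in> \<Omega>" using p by (simp add: P_def)
      then show "V p * ennreal (r p) * indicator P p =
        (case p of (m, t) \<Rightarrow> ennreal (w (b (- t) m, t) * r (m, t))) * indicator {(m, t). (m, - t) \<in> \<Omega>} p"
        using r(2)[of p] p by (auto simp: V_def ennreal_mult'' less_imp_le split: split_indicator)
    qed
  qed
qed

end
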